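(* Let $\Omega\subset\mathbb{C}^m$ be a bounded domain and let $\mathcal{M}$ be a (countably generated) Hilbert module over $\mathcal{A}(\Omega)$ belonging to class (SM). Then $\mathcal{M}$ has a weak resolution by quasi-free Hilbert modules over $\mathcal{A}(\Omega)$.
   Context: $\mathcal{A}(\Omega)$ is the closure, in the supremum norm on $\Omega$, of the functions holomorphic in some neighborhood of the closure of $\Omega$. A Hilbert module over $\mathcal{A}(\Omega)$ is a complex Hilbert space $\mathcal{M}$ that is a unital $\mathcal{A}(\Omega)$-module with continuous multiplication $\mathcal{A}(\Omega)\times\mathcal{M}\to\mathcal{M}$. A submodule is a closed subspace invariant under multiplication; a module map is a bounded linear map commuting with multiplication. A set $\{f_i\}\subset\mathcal{M}$ is generating if the finite sums $\sum\varphi_i f_i$, $\varphi_i\in\mathcal{A}(\Omega)$, are dense in $\mathcal{M}$; $\mathcal{M}$ is countably generated if it has a finite or countable generating set. For $z$ in the closure of $\Omega$, $\mathbb{C}_z$ is the Hilbert module $\mathbb{C}$ with $\varphi v=\varphi(z)v$; $1_z$ is the element $1\in\mathbb{C}_z$. For Hilbert modules $\mathcal{M},\mathcal{N}$, $\mathcal{M}\otimes_{\mathcal{A}}\mathcal{N}$ is the quotient of the Hilbert space tensor product $\mathcal{M}\otimes\mathcal{N}$ by the closed submodule generated by all $\varphi f\otimes g-f\otimes\varphi g$; $f\otimes_{\mathcal{A}}g$ is the class of $f\otimes g$. For $1\le k\le\infty$ ($k=\infty$ meaning countably infinite), $\ell^2_k$ is the $k$-dimensional Hilbert space with standard orthonormal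 basis $\{e_i\}$. A Hilbert module $\mathcal{R}$ is quasi-free of rank $k$ relative to a generating set $\{f_1,f_2,\dots\}$ of $k$ elements if: (i) for each $z\in\Omega$ the vectors $f_i\otimes_{\mathcal{A}}1_z$ form a basis of $\mathcal{R}\otimes_{\mathcal{A}}\mathbb{C}_z$ (meaning only that they are linearly independent and have dense linear span); (ii) the linear maps $X_z$ given on finite linear combinations by $X_z(f_i\otimes_{\mathcal{A}}1_z)=1_z\otimes e_i\in\mathbb{C}_z\otimes\ell^2_k$ are bounded, with norm locally uniformly bounded in $z\in\Omega$; (iii) for $f\in\mathcal{R}$, $f\otimes_{\mathcal{A}}1_z=0$ for every $z\in\Omega$ if and only if $f=0$. It is quasi-free if it is quasi-free of some rank relative to some generating set. If $\mathcal{R}$ is a quasi-free Hilbert module of rank one with generating vector $g$, then $\mathcal{M}$ is smooth relative to $\mathcal{R}$ and $g$ if the map $S:\mathcal{M}\to\mathcal{M}\otimes_{\mathcal{A}}\mathcal{R}$, $Sf=f\otimes_{\mathcal{A}}g$, is one-to-one. $\mathcal{M}$ belongs to class (SM) if it is smooth relative to some rank one quasi-free Hilbert module $\mathcal{R}$ and generating vector $g$. A weak resolution of $\mathcal{M}$ by quasi-free Hilbert modules is a finite or infinite sequence $0\leftarrow\mathcal{M}\xleftarrow{X_0}\mathcal{R}_1\xleftarrow{X_1}\mathcal{R}_2\xleftarrow{X_2}\cdots$ of module maps, with the $\mathcal{R}_i$ quasi-free (in the finite length case the final $\mathcal{R}_i$ is $0$), such that $X_0$ has dense range and $\ker X_i$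 equals the closure of $\operatorname{ran}X_{i+1}$ for all $i\ge 0$. *)

theory Defs
  imports "HOL-Analysis.Analysis" "HOL-Algebra.Module" "HOL-Algebra.AbelCoset"
begin

section \<open>Hilbert spaces\<close>

text \<open>
  Hilbert spaces and Hilbert modules are modules in the sense of HOL-Algebra, with explicit carrier
  and with an inner product, linear in its first argument; the inherited ring multiplication and
  unit of the record are not used. The scalars of a Hilbert space are complex numbers, those of a
  Hilbert module are functions.
\<close>

record ('r, 'a) hilb = "('r, 'a) module" +
  hinner :: "'a \<Rightarrow> 'a \<Rightarrow> complex"

definition hnorm :: "('r, 'a, 'm) hilb_scheme \<Rightarrow> 'a \<Rightarrow> real" where
  "hnorm H x = sqrt (Re (hinner H x x))"

text \<open>The value off the carrier serves the locale \<open>Metric_space\<close>, which wants a total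
  symmetric nonnegative function.\<close>

definition hdist :: "('r, 'a, 'm) hilb_scheme \<Rightarrow> 'a \<Rightarrow> 'a \<Rightarrow> real" where
  "hdist H x y = (if x \<in> carrier H \<and> y \<in> carrier H then hnorm H (x \<ominus>\<^bsub>H\<^esub> y) else 0)"

definition htop :: "('r, 'a, 'm) hilb_scheme \<Rightarrow> 'a topology" where
  "htop H = Metric_space.mtopology (carrier H) (hdist H)"

definition complex_ring :: "complex ring" where
  "complex_ring = \<lparr>carrier = UNIV, mult = (*), one = 1, zero = 0, add = (+)\<rparr>"

locale hilbert_space = Module.module complex_ring H for H (structure) +
  assumes hinner_add_left:
      "\<lbrakk>x \<in> carrier H; y \<in> carrier H; z \<in> carrier H\<rbrakk> \<Longrightarrow>
        hinner H (x \<oplus> y) z = hinner H x z + hinner H y z"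
    and hinner_smult_left:
      "\<lbrakk>x \<in> carrier H; y \<in> carrier H\<rbrakk> \<Longrightarrow> hinner H (c \<odot> x) y = c * hinner H x y"
    and hinner_commute:
      "\<lbrakk>x \<in> carrier H; y \<in> carrier H\<rbrakk> \<Longrightarrow> hinner H y x = cnj (hinner H x y)"
    and hinner_nonneg: "x \<in> carrier H \<Longrightarrow> 0 \<le> Re (hinner H x x)"
    and hinner_definite: "\<lbrakk>x \<in> carrier H; hinner H x x = 0\<rbrakk> \<Longrightarrow> x = \<zero>"
    and complete: "Metric_space.mcomplete (carrier H) (hdist H)"

text \<open>Finite linear combinations of elements of \<open>S\<close> with coefficients in \<open>R\<close>.\<close>

definition lincombs ::
    "('r, 'n) ring_scheme \<Rightarrow> ('r, 'a, 'm) module_scheme \<Rightarrow> 'a set \<Rightarrow> 'a set" where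
  "lincombs R M S =
    {\<Oplus>\<^bsub>M\<^esub>x\<in>F. a x \<odot>\<^bsub>M\<^esub> x | F a. finite F \<and> F \<subseteq> S \<and> a \<in> F \<rightarrow> carrier R}"

text \<open>\<open>X\<close> is an \<open>R\<close>-linear map from \<open>M\<close> to \<open>N\<close> with bound \<open>B\<close>.\<close>

definition bounded_hom ::
    "('r, 'n) ring_scheme \<Rightarrow> ('r, 'a, 'k) hilb_scheme \<Rightarrow> ('r, 'b, 'l) hilb_scheme \<Rightarrow>
     ('a \<Rightarrow> 'b) \<Rightarrow> real \<Rightarrow> bool" where
  "bounded_hom R M N X B \<longleftrightarrow>
     X \<in> carrier M \<rightarrow> carrier N \<and>
     (\<forall>x\<in>carrier M. \<forall>y\<in>carrier M. X (x \<oplus>\<^bsub>M\<^esub> y) = X x \<oplus>\<^bsub>N\<^esub> X y) \<and>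
     (\<forall>r\<in>carrier R. \<forall>x\<in>carrier M. X (r \<odot>\<^bsub>M\<^esub> x) = r \<odot>\<^bsub>N\<^esub> X x) \<and>
     (\<forall>x\<in>carrier M. hnorm N (X x) \<le> B * hnorm M x)"

text \<open>The space \<open>\<ell>\<^sup>2\<^sub>k\<close>; coordinates are numbered from 0.\<close>

definition ell2 :: "enat \<Rightarrow> (complex, nat \<Rightarrow> complex) hilb" where
  "ell2 k =
    \<lparr>carrier = {a. (\<forall>i. \<not> enat i < k \<longrightarrow> a i = 0) \<and> summable (\<lambda>i. (cmod (a i))\<^sup>2)},
     mult = undefined, one = undefined,
     zero = (\<lambda>i. 0), add = (\<lambda>a b i. a i + b i), smult = (\<lambda>c a i. c * a i),
     hinner = (\<lambda>a b. \<Sum>i. a i * cnj (b i))\<rparr>"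

definition ell2_basis :: "nat \<Rightarrow> nat \<Rightarrow> complex" where
  "ell2_basis i = (\<lambda>j. if j = i then 1 else 0)"


section \<open>The Hilbert space tensor product\<close>

text \<open>
  The list \<open>[(x\<^sub>1, y\<^sub>1), \<dots>, (x\<^sub>n, y\<^sub>n)]\<close> stands for the algebraic tensor
  \<open>x\<^sub>1 \<otimes> y\<^sub>1 + \<dots> + x\<^sub>n \<otimes> y\<^sub>n\<close>. The Hilbert space tensor product is the completion: Cauchy
  sequences of such sums, modulo sequences at distance tending to zero. Two lists
  that denote the same algebraic tensor have distance zero and so are identified.
\<close>

definition fsums :: "('r, 'a, 'k) hilb_scheme \<Rightarrow> ('s, 'b, 'l) hilb_scheme \<Rightarrow> ('a \<times> 'b) list set" where
  "fsums M N = lists (carrier M \<times> carrier N)"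

definition fsum_inner ::
    "('r, 'a, 'k) hilb_scheme \<Rightarrow> ('s, 'b, 'l) hilb_scheme \<Rightarrow>
     ('a \<times> 'b) list \<Rightarrow> ('a \<times> 'b) list \<Rightarrow> complex" where
  "fsum_inner M N s t = (\<Sum>(x, y)\<leftarrow>s. \<Sum>(x', y')\<leftarrow>t. hinner M x x' * hinner N y y')"

definition fsum_dist ::
    "('r, 'a, 'k) hilb_scheme \<Rightarrow> ('s, 'b, 'l) hilb_scheme \<Rightarrow>
     ('a \<times> 'b) list \<Rightarrow> ('a \<times> 'b) list \<Rightarrow> real" where
  "fsum_dist M N s t =
    (let d = s @ map (\<lambda>(x, y). (\<ominus>\<^bsub>M\<^esub> x, y)) t in sqrt (Re (fsum_inner M N d d)))"

definition fsum_Cauchy ::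
    "('r, 'a, 'k) hilb_scheme \<Rightarrow> ('s, 'b, 'l) hilb_scheme \<Rightarrow> (nat \<Rightarrow> ('a \<times> 'b) list) set" where
  "fsum_Cauchy M N =
    {s. range s \<subseteq> fsums M N \<and>
        (\<forall>\<epsilon>>0. \<exists>n0. \<forall>m\<ge>n0. \<forall>n\<ge>n0. fsum_dist M N (s m) (s n) < \<epsilon>)}"

definition fsum_rel ::
    "('r, 'a, 'k) hilb_scheme \<Rightarrow> ('s, 'b, 'l) hilb_scheme \<Rightarrow> (nat \<Rightarrow> ('a \<times> 'b) list) rel" where
  "fsum_rel M N =
    {(s, t). s \<in> fsum_Cauchy M N \<and> t \<in> fsum_Cauchy M N \<and>
             (\<lambda>n. fsum_dist M N (s n) (t n)) \<longlonglongrightarrow> 0}"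

type_synonym ('a, 'b) htens = "(nat \<Rightarrow> ('a \<times> 'b) list) set"

definition fsum_class ::
    "('r, 'a, 'k) hilb_scheme \<Rightarrow> ('s, 'b, 'l) hilb_scheme \<Rightarrow>
     (nat \<Rightarrow> ('a \<times> 'b) list) \<Rightarrow> ('a, 'b) htens" where
  "fsum_class M N s = fsum_rel M N `` {s}"

definition fsum_rep :: "('a, 'b) htens \<Rightarrow> nat \<Rightarrow> ('a \<times> 'b) list" where
  "fsum_rep X = (SOME s. s \<in> X)"

text \<open>Scalars, complex numbers or functions, act on the left factor.\<close>

definition htensor ::
    "('r, 'a, 'k) hilb_scheme \<Rightarrow> ('s, 'b, 'l) hilb_scheme \<Rightarrow> ('r, ('a, 'b) htens) hilb" where
  "htensor M N =
    \<lparr>carrier = fsum_Cauchy M N // fsum_rel M N,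
     mult = undefined, one = undefined,
     zero = fsum_class M N (\<lambda>n. []),
     add = (\<lambda>X Y. fsum_class M N (\<lambda>n. fsum_rep X n @ fsum_rep Y n)),
     smult = (\<lambda>r X. fsum_class M N (\<lambda>n. map (\<lambda>(x, y). (r \<odot>\<^bsub>M\<^esub> x, y)) (fsum_rep X n))),
     hinner = (\<lambda>X Y. lim (\<lambda>n. fsum_inner M N (fsum_rep X n) (fsum_rep Y n)))\<rparr>"

definition htens ::
    "('r, 'a, 'k) hilb_scheme \<Rightarrow> ('s, 'b, 'l) hilb_scheme \<Rightarrow> 'a \<Rightarrow> 'b \<Rightarrow> ('a, 'b) htens" where
  "htens M N x y = fsum_class M N (\<lambda>n. [(x, y)])"


section \<open>The algebra \<open>\<A>(\<Omega>)\<close>\<close>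

text \<open>Holomorphy in several variables: a complex linear total derivative at every point.\<close>

definition holomorphic_Cn :: "(complex ^ 'm \<Rightarrow> complex) \<Rightarrow> (complex ^ 'm) set \<Rightarrow> bool" where
  "holomorphic_Cn f U \<longleftrightarrow> open U \<and>
     (\<forall>z\<in>U. \<exists>L. (f has_derivative L) (at z) \<and> (\<forall>c v. L (c *s v) = c * L v))"

text \<open>
  A function in \<open>\<A>(\<Omega>)\<close> is uniformly continuous on \<open>\<Omega>\<close>, when \<open>\<Omega>\<close> is bounded. It is represented by
  its continuous extension to the closure of \<open>\<Omega>\<close>, so that it has values there, and is made
  \<open>undefined\<close> elsewhere. The distance is still the supremum over \<open>\<Omega>\<close>.
\<close>

definition A_carrier :: "(complex ^ 'm) set \<Rightarrow> (complex ^ 'm \<Rightarrow> complex) set" where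
  "A_carrier \<Omega> =
    {\<phi> \<in> extensional (closure \<Omega>). continuous_on (closure \<Omega>) \<phi> \<and>
       (\<forall>\<epsilon>>0. \<exists>U \<psi>. closure \<Omega> \<subseteq> U \<and> holomorphic_Cn \<psi> U \<and> (\<forall>z\<in>\<Omega>. cmod (\<phi> z - \<psi> z) \<le> \<epsilon>))}"

definition A_const :: "(complex ^ 'm) set \<Rightarrow> complex \<Rightarrow> complex ^ 'm \<Rightarrow> complex" where
  "A_const \<Omega> c = (\<lambda>z\<in>closure \<Omega>. c)"

definition A_alg :: "(complex ^ 'm) set \<Rightarrow> (complex ^ 'm \<Rightarrow> complex) ring" where
  "A_alg \<Omega> =
    \<lparr>carrier = A_carrier \<Omega>,
     mult = (\<lambda>\<phi> \<psi>. \<lambda>z\<in>closure \<Omega>. \<phi> z * \<psi> z), one = A_const \<Omega> 1,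
     zero = A_const \<Omega> 0, add = (\<lambda>\<phi> \<psi>. \<lambda>z\<in>closure \<Omega>. \<phi> z + \<psi> z)\<rparr>"

definition A_dist ::
    "(complex ^ 'm) set \<Rightarrow> (complex ^ 'm \<Rightarrow> complex) \<Rightarrow> (complex ^ 'm \<Rightarrow> complex) \<Rightarrow> real" where
  "A_dist \<Omega> \<phi> \<psi> =
    (if \<phi> \<in> A_carrier \<Omega> \<and> \<psi> \<in> A_carrier \<Omega> then SUP z\<in>\<Omega>. cmod (\<phi> z - \<psi> z) else 0)"

definition A_top :: "(complex ^ 'm) set \<Rightarrow> (complex ^ 'm \<Rightarrow> complex) topology" where
  "A_top \<Omega> = Metric_space.mtopology (A_carrier \<Omega>) (A_dist \<Omega>)"


section \<open>Hilbert modules\<close>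

type_synonym ('m, 'a) hmod = "(complex ^ 'm \<Rightarrow> complex, 'a) hilb"

text \<open>The underlying Hilbert space: restriction of scalars to the constant functions.\<close>

definition underlying :: "(complex ^ 'm) set \<Rightarrow> ('m, 'a) hmod \<Rightarrow> (complex, 'a) hilb" where
  "underlying \<Omega> M =
    \<lparr>carrier = carrier M, mult = mult M, one = one M, zero = zero M, add = add M,
     smult = (\<lambda>c x. A_const \<Omega> c \<odot>\<^bsub>M\<^esub> x), hinner = hinner M\<rparr>"

definition hilbert_module :: "(complex ^ 'm) set \<Rightarrow> ('m, 'a) hmod \<Rightarrow> bool" where
  "hilbert_module \<Omega> M \<longleftrightarrow>
     Module.module (A_alg \<Omega>) M \<and> hilbert_space (underlying \<Omega> M) \<and>
     continuous_map (prod_topology (A_top \<Omega>) (htop M)) (htop M) (\<lambda>(\<phi>, x). \<phi> \<odot>\<^bsub>M\<^esub> x)"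

definition closed_submodule :: "(complex ^ 'm) set \<Rightarrow> ('m, 'a) hmod \<Rightarrow> 'a set \<Rightarrow> bool" where
  "closed_submodule \<Omega> M K \<longleftrightarrow> submodule K (A_alg \<Omega>) M \<and> closedin (htop M) K"

definition module_map ::
    "(complex ^ 'm) set \<Rightarrow> ('m, 'a) hmod \<Rightarrow> ('m, 'b) hmod \<Rightarrow> ('a \<Rightarrow> 'b) \<Rightarrow> bool" where
  "module_map \<Omega> M N X \<longleftrightarrow> (\<exists>B. bounded_hom (A_alg \<Omega>) M N X B)"

definition generating :: "(complex ^ 'm) set \<Rightarrow> ('m, 'a) hmod \<Rightarrow> 'a set \<Rightarrow> bool" where
  "generating \<Omega> M S \<longleftrightarrow>
     S \<subseteq> carrier M \<and> htop M closure_of lincombs (A_alg \<Omega>) M S = carrier M"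

definition countably_generated :: "(complex ^ 'm) set \<Rightarrow> ('m, 'a) hmod \<Rightarrow> bool" where
  "countably_generated \<Omega> M \<longleftrightarrow> (\<exists>S. countable S \<and> generating \<Omega> M S)"

definition point_module :: "complex ^ 'm \<Rightarrow> ('m, complex) hmod" where
  "point_module z =
    \<lparr>carrier = UNIV, mult = (*), one = 1, zero = 0, add = (+),
     smult = (\<lambda>\<phi> v. \<phi> z * v), hinner = (\<lambda>v w. v * cnj w)\<rparr>"

text \<open>
  The quotient Hilbert module, with the quotient norm; its inner product is recovered from
  that norm by polarization.
\<close>

definition quot_norm :: "('r, 'a, 'k) hilb_scheme \<Rightarrow> 'a set \<Rightarrow> real" where
  "quot_norm M C = Inf (hnorm M ` C)"

definition quot_smult :: "('r, 'a, 'k) hilb_scheme \<Rightarrow> 'a set \<Rightarrow> 'r \<Rightarrow> 'a set \<Rightarrow> 'a set" where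
  "quot_smult M K r C = (\<Union>x\<in>C. K +>\<^bsub>M\<^esub> (r \<odot>\<^bsub>M\<^esub> x))"

definition hquotient :: "(complex ^ 'm) set \<Rightarrow> ('m, 'a) hmod \<Rightarrow> 'a set \<Rightarrow> ('m, 'a set) hmod" where
  "hquotient \<Omega> M K =
    \<lparr>carrier = a_rcosets\<^bsub>M\<^esub> K,
     mult = undefined, one = undefined,
     zero = K, add = set_add M, smult = quot_smult M K,
     hinner = (\<lambda>C D. (\<Sum>k<4. \<i> ^ k *
       complex_of_real ((quot_norm M (set_add M C (quot_smult M K (A_const \<Omega> (\<i> ^ k)) D)))\<^sup>2)) / 4)\<rparr>"


section \<open>The module tensor product\<close>

definition tensor_relators ::
    "(complex ^ 'm) set \<Rightarrow> ('m, 'a) hmod \<Rightarrow> ('m, 'b) hmod \<Rightarrow> ('a, 'b) htens set" where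
  "tensor_relators \<Omega> M N =
    {htens M N (\<phi> \<odot>\<^bsub>M\<^esub> f) g \<ominus>\<^bsub>htensor M N\<^esub> htens M N f (\<phi> \<odot>\<^bsub>N\<^esub> g) | \<phi> f g.
       \<phi> \<in> A_carrier \<Omega> \<and> f \<in> carrier M \<and> g \<in> carrier N}"

definition tensor_kernel ::
    "(complex ^ 'm) set \<Rightarrow> ('m, 'a) hmod \<Rightarrow> ('m, 'b) hmod \<Rightarrow> ('a, 'b) htens set" where
  "tensor_kernel \<Omega> M N =
    \<Inter>{K. closed_submodule \<Omega> (htensor M N) K \<and> tensor_relators \<Omega> M N \<subseteq> K}"

definition mtensor ::
    "(complex ^ 'm) set \<Rightarrow> ('m, 'a) hmod \<Rightarrow> ('m, 'b) hmod \<Rightarrow> ('m, ('a, 'b) htens set) hmod" where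
  "mtensor \<Omega> M N = hquotient \<Omega> (htensor M N) (tensor_kernel \<Omega> M N)"

definition mtens ::
    "(complex ^ 'm) set \<Rightarrow> ('m, 'a) hmod \<Rightarrow> ('m, 'b) hmod \<Rightarrow> 'a \<Rightarrow> 'b \<Rightarrow> ('a, 'b) htens set" where
  "mtens \<Omega> M N f g = tensor_kernel \<Omega> M N +>\<^bsub>htensor M N\<^esub> htens M N f g"


section \<open>Quasi-free modules, smoothness, weak resolutions\<close>

text \<open>A basis in the weak sense: linearly independent with dense linear span.\<close>

definition weak_basis :: "(complex, 'a) hilb \<Rightarrow> 'i set \<Rightarrow> ('i \<Rightarrow> 'a) \<Rightarrow> bool" where
  "weak_basis H I v \<longleftrightarrow>
     v \<in> I \<rightarrow> carrier H \<and>
     (\<forall>F c. finite F \<and> F \<subseteq> I \<and> (\<Oplus>\<^bsub>H\<^esub>i\<in>F. c i \<odot>\<^bsub>H\<^esub> v i) = \<zero>\<^bsub>H\<^esub> \<longrightarrow> (\<forall>i\<in>F. c i = 0)) \<and>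
     htop H closure_of lincombs complex_ring H (v ` I) = carrier H"

text \<open>The module \<open>R\<close> is quasi-free of rank \<open>k\<close> relative to \<open>{f i | i < k}\<close>. Each map \<open>X\<close> below
  is defined on the linear span of the \<open>f i \<otimes> 1\<close>, with the norm of the module tensor product.\<close>

definition quasi_free_rel ::
    "(complex ^ 'm) set \<Rightarrow> ('m, 'a) hmod \<Rightarrow> enat \<Rightarrow> (nat \<Rightarrow> 'a) \<Rightarrow> bool" where
  "quasi_free_rel \<Omega> R k f \<longleftrightarrow>
    (let I = {i. enat i < k};
         Q = (\<lambda>z. underlying \<Omega> (mtensor \<Omega> R (point_module z)));
         T = (\<lambda>z. underlying \<Omega> (htensor (point_module z) (ell2 k)));
         v = (\<lambda>z i. mtens \<Omega> R (point_module z) (f i) 1)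
     in hilbert_module \<Omega> R \<and> 1 \<le> k \<and> inj_on f I \<and> generating \<Omega> R (f ` I) \<and>
        (\<forall>z\<in>\<Omega>. weak_basis (Q z) I (v z)) \<and>
        (\<forall>z0\<in>\<Omega>. \<exists>r>0. \<exists>B. \<forall>z\<in>\<Omega> \<inter> ball z0 r. \<exists>X.
           bounded_hom complex_ring
             ((Q z)\<lparr>carrier := lincombs complex_ring (Q z) (v z ` I)\<rparr>) (T z) X B \<and>
           (\<forall>i\<in>I. X (v z i) = htens (point_module z) (ell2 k) 1 (ell2_basis i))) \<and>
        (\<forall>h\<in>carrier R.
           (\<forall>z\<in>\<Omega>. mtens \<Omega> R (point_module z) h 1 = \<zero>\<^bsub>Q z\<^esub>) \<longleftrightarrow> h = \<zero>\<^bsub>R\<^esub>))"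

definition quasi_free :: "(complex ^ 'm) set \<Rightarrow> ('m, 'a) hmod \<Rightarrow> bool" where
  "quasi_free \<Omega> R \<longleftrightarrow> (\<exists>k f. quasi_free_rel \<Omega> R k f)"

definition smooth_rel ::
    "(complex ^ 'm) set \<Rightarrow> ('m, 'a) hmod \<Rightarrow> ('m, 'b) hmod \<Rightarrow> 'b \<Rightarrow> bool" where
  "smooth_rel \<Omega> M R g \<longleftrightarrow> inj_on (\<lambda>f. mtens \<Omega> M R f g) (carrier M)"

text \<open>The type argument is the type of the elements of the rank one module.\<close>

definition class_SM :: "'b itself \<Rightarrow> (complex ^ 'm) set \<Rightarrow> ('m, 'a) hmod \<Rightarrow> bool" where
  "class_SM T \<Omega> M \<longleftrightarrow>
     (\<exists>(R :: ('m, 'b) hmod) g. quasi_free_rel \<Omega> R 1 (\<lambda>_. g) \<and> smooth_rel \<Omega> M R g)"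

text \<open>
  A weak resolution of length \<open>L\<close>, which may be infinite, by the modules \<open>R i\<close> with
  \<open>1 \<le> i \<le> L\<close>; for finite \<open>L\<close> the last one is \<open>0\<close>. The maps are \<open>X0 : R 1 \<rightarrow> M\<close> and
  \<open>X i : R (i + 1) \<rightarrow> R i\<close> for \<open>i \<ge> 1\<close>; the first is separate because its codomain has its own type.
\<close>

definition weak_resolution ::
    "(complex ^ 'm) set \<Rightarrow> ('m, 'a) hmod \<Rightarrow> enat \<Rightarrow> (nat \<Rightarrow> ('m, 'c) hmod) \<Rightarrow>
     ('c \<Rightarrow> 'a) \<Rightarrow> (nat \<Rightarrow> 'c \<Rightarrow> 'c) \<Rightarrow> bool" where
  "weak_resolution \<Omega> M L R X0 X \<longleftrightarrow>
     1 \<le> L \<and>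
     (\<forall>i\<ge>1. enat i < L \<longrightarrow> quasi_free \<Omega> (R i)) \<and>
     (\<forall>i. L = enat i \<longrightarrow> hilbert_module \<Omega> (R i) \<and> carrier (R i) = {\<zero>\<^bsub>R i\<^esub>}) \<and>
     module_map \<Omega> (R 1) M X0 \<and>
     (\<forall>i\<ge>1. enat (i + 1) \<le> L \<longrightarrow> module_map \<Omega> (R (i + 1)) (R i) (X i)) \<and>
     htop M closure_of (X0 ` carrier (R 1)) = carrier M \<and>
     (2 \<le> L \<longrightarrow> a_kernel (R 1) M X0 = htop (R 1) closure_of (X 1 ` carrier (R 2))) \<and>
     (\<forall>i\<ge>1. enat (i + 2) \<le> L \<longrightarrow>
        a_kernel (R (i + 1)) (R i) (X i) =
          htop (R (i + 1)) closure_of (X (i + 1) ` carrier (R (i + 2))))"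

text \<open>
  The elements of the modules of the resolution are taken in the type \<^typ>\<open>nat \<Rightarrow> complex\<close>. Nothing
  is lost: \<open>\<A>(\<Omega>)\<close> is separable for bounded \<open>\<Omega>\<close>, so a quasi-free module is a separable Hilbert
  space and can be copied into this type.
\<close>

definition has_weak_resolution :: "(complex ^ 'm) set \<Rightarrow> ('m, 'a) hmod \<Rightarrow> bool" where
  "has_weak_resolution \<Omega> M \<longleftrightarrow>
     (\<exists>L (R :: nat \<Rightarrow> ('m, nat \<Rightarrow> complex) hmod) X0 X. weak_resolution \<Omega> M L R X0 X)"

end

theory Submission
  imports Defs
begin

text \<open>
  Let \<open>R\<close> be the rank one quasi-free module with generating vector \<open>g\<close> for which \<open>M\<close> is smooth. The
  fibre of \<open>R\<close> over \<open>z \<in> \<Omega>\<close> is the line spanned by the class of \<open>g\<close>, so reading off the coordinate on this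
  line gives a functional \<open>\<gamma>\<^sub>z\<close> on \<open>R\<close> with \<open>\<gamma>\<^sub>z (\<phi> r) = \<phi>(z) \<gamma>\<^sub>z (r)\<close> and \<open>\<gamma>\<^sub>z (g) = 1\<close>. These functionals are
  bounded, locally uniformly in \<open>z\<close>, and separate the points of \<open>R\<close> (\<open>rank_one_functionals\<close>).
  
  Let \<open>N\<close> be a Hilbert module with generators \<open>f\<^sub>i\<close>, scaled so that \<open>\<Sum> \<parallel>f\<^sub>i\<parallel>\<^sup>2 < \<infinity>\<close>. Sending \<open>\<Sum> \<phi>\<^sub>i g \<otimes> e\<^sub>i\<close> to
  \<open>\<Sum> \<phi>\<^sub>i f\<^sub>i\<close> would cover \<open>N\<close> by \<open>R \<otimes> \<ell>\<^sup>2\<close>, but this map is in general unbounded. Its graph repairs that: let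
  \<open>G\<close> be the closed submodule of \<open>(R \<otimes> \<ell>\<^sup>2) \<oplus> N\<close> generated by the pairs \<open>d\<^sub>i = (g \<otimes> e\<^sub>i, f\<^sub>i)\<close>. The projection
  of \<open>G\<close> to \<open>N\<close> is bounded and has dense range. The functionals \<open>(h, m) \<mapsto> \<gamma>\<^sub>z (h\<^sub>i)\<close> are dual to the \<open>d\<^sub>i\<close> and
  map \<open>G\<close> boundedly into \<open>\<ell>\<^sup>2\<close>, locally uniformly in \<open>z\<close>. Such a dual system makes \<open>G\<close> quasi-free of infinite
  rank as soon as it separates points (\<open>quasi_free_criterion\<close>), and that means that the graph is closable:
  \<open>(0, m) \<in> G\<close> only for \<open>m = 0\<close>.
  
  Closability comes from bounded bilinear maps \<open>\<beta>\<close> on \<open>N \<times> R\<close> with \<open>\<beta> (\<phi> x, r) = \<beta> (x, \<phi> r)\<close>. For them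
  \<open>\<beta> (\<Sum> \<phi>\<^sub>i f\<^sub>i, g) = \<Sum> \<beta> (f\<^sub>i, \<phi>\<^sub>i g)\<close>, and the right side is small when \<open>\<Sum> \<phi>\<^sub>i g \<otimes> e\<^sub>i\<close> is. Hence \<open>\<beta> (m, g) = 0\<close>
  whenever \<open>(0, m) \<in> G\<close> (\<open>balanced_map_vanishes\<close>). For \<open>N = M\<close> let \<open>\<beta>\<close> be the module tensor product; then
  \<open>m = 0\<close> by smoothness. A module \<open>G\<close> obtained in this way, and each of its submodules \<open>N\<close>, has enough module
  maps \<open>\<Lambda> : N \<rightarrow> \<complex>\<^sub>z\<close> to separate points, and \<open>\<beta> (x, r) = \<Lambda> (x) \<gamma>\<^sub>z (r)\<close> shows that \<open>N\<close> can be covered as well.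
  
  So \<open>M\<close> is covered by a quasi-free module \<open>R\<^sub>1\<close>, the kernel of \<open>R\<^sub>1 \<rightarrow> M\<close> by a quasi-free module \<open>R\<^sub>2\<close>, and so on
  (\<open>weak_resolution_exists\<close>). The kernels are countably generated: \<open>\<A>(\<Omega>)\<close> is separable for the supremum
  norm, so a countably generated Hilbert module is separable, and then so is every subset of it.
  Separability also allows each \<open>G\<close> to be copied into the type of complex sequences.
\<close>


section \<open>Inner products and norms\<close>

text \<open>
  Instances are the vectors of a Hilbert space, lists of pairs that stand for tensors, and the degenerate
  forms to which the Schur product theorem is applied.
\<close>

locale semi_inner =
  fixes L :: "'a set" and pl :: "'a \<Rightarrow> 'a \<Rightarrow> 'a" and sc :: "complex \<Rightarrow> 'a \<Rightarrow> 'a"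
    and B :: "'a \<Rightarrow> 'a \<Rightarrow> complex"
  assumes pl_closed: "\<lbrakk>x \<in> L; y \<in> L\<rbrakk> \<Longrightarrow> pl x y \<in> L"
    and sc_closed: "x \<in> L \<Longrightarrow> sc c x \<in> L"
    and add_left: "\<lbrakk>x \<in> L; y \<in> L; z \<in> L\<rbrakk> \<Longrightarrow> B (pl x y) z = B x z + B y z"
    and sc_left: "\<lbrakk>x \<in> L; y \<in> L\<rbrakk> \<Longrightarrow> B (sc c x) y = c * B x y"
    and hermitian: "\<lbrakk>x \<in> L; y \<in> L\<rbrakk> \<Longrightarrow> B y x = cnj (B x y)"
    and nonneg: "x \<in> L \<Longrightarrow> 0 \<le> Re (B x x)"
begin

lemma add_right: "\<lbrakk>x \<in> L; y \<in> L; z \<in> L\<rbrakk> \<Longrightarrow> B z (pl x y) = B z x + B z y"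
  by (metis add_left complex_cnj_add hermitian pl_closed)

lemma sc_right: "\<lbrakk>x \<in> L; y \<in> L\<rbrakk> \<Longrightarrow> B x (sc c y) = cnj c * B x y"
  by (metis complex_cnj_mult hermitian sc_closed sc_left)

lemma self_real: "x \<in> L \<Longrightarrow> B x x = of_real (Re (B x x))"
  using hermitian[of x x] by (simp add: complex_eq_iff)

lemma Cauchy_Schwarz_sq:
  assumes x: "x \<in> L" and y: "y \<in> L"
  shows "(cmod (B x y))\<^sup>2 \<le> Re (B x x) * Re (B y y)"
proof -
  define b a c where "b = B x y" and "a = Re (B x x)" and "c = Re (B y y)"
  have yx: "B y x = cnj b" using hermitian[OF x y] b_def by simp
  \<comment> \<open>the form is nonnegative on \<open>x - (t * B x y) y\<close>; the optimal choice is \<open>t = 1 / c\<close>, and for \<open>c = 0\<close> a large \<open>t\<close> forces \<open>b = 0\<close>\<close>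
  have ineq: "0 \<le> a - 2 * t * (cmod b)\<^sup>2 + t\<^sup>2 * (cmod b)\<^sup>2 * c" for t :: real
  proof -
    let ?w = "pl x (sc (- (of_real t * b)) y)"
    have w: "?w \<in> L" using x y by (simp add: pl_closed sc_closed)
    have "B ?w ?w = B x x + cnj (- (of_real t * b)) * b + (- (of_real t * b)) * cnj b
       + (- (of_real t * b)) * cnj (- (of_real t * b)) * B y y"
      using x y by (simp add: add_left add_right sc_left sc_right sc_closed pl_closed yx
          flip: b_def) (simp add: algebra_simps)
    also have "\<dots> = of_real (a - 2 * t * (cmod b)\<^sup>2 + t\<^sup>2 * (cmod b)\<^sup>2 * c)"
    proof -
      have 1: "B x x = of_real a" "B y y = of_real c" using self_real x y a_def c_def by auto
      have 2: "b * cnj b = of_real ((cmod b)\<^sup>2)" by (simp only: complex_norm_square[symmetric])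
      have "B x x + cnj (- (of_real t * b)) * b + (- (of_real t * b)) * cnj b
       + (- (of_real t * b)) * cnj (- (of_real t * b)) * B y y
       = of_real a - 2 * of_real t * (b * cnj b) + of_real t * of_real t * (b * cnj b) * of_real c"
        unfolding 1 by (simp add: algebra_simps)
      then show ?thesis unfolding 2 by (simp add: power2_eq_square)
    qed
    finally show ?thesis using nonneg[OF w] by simp
  qed
  show ?thesis
  proof (cases "c = 0")
    case True
    have "cmod b = 0"
    proof (rule ccontr)
      assume "cmod b \<noteq> 0"
      then have p: "(cmod b)\<^sup>2 > 0" by simp
      have "0 \<le> a - 2 * ((a + 1) / (cmod b)\<^sup>2) * (cmod b)\<^sup>2" 
        using ineq[of "(a + 1) / (cmod b)\<^sup>2"] True by simp
      then have "0 \<le> a - 2 * (a + 1)" using p by simp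
      moreover have "a \<ge> 0" using nonneg x a_def by simp
      ultimately show False by simp
    qed
    then show ?thesis using True by (simp add: b_def c_def)
  next
    case False
    then have c: "c > 0" using nonneg[OF y] c_def by simp
    have "0 \<le> a - (cmod b)\<^sup>2 / c" using ineq[of "1 / c"] c
      by (simp add: power2_eq_square field_simps)
    then show ?thesis using c unfolding a_def b_def c_def by (simp add: field_simps)
  qed
qed

definition nrm :: "'a \<Rightarrow> real" where "nrm x = sqrt (Re (B x x))"

lemma nrm_nonneg [simp]: "x \<in> L \<Longrightarrow> 0 \<le> nrm x" by (simp add: nrm_def nonneg)

lemma nrm_sq: "x \<in> L \<Longrightarrow> (nrm x)\<^sup>2 = Re (B x x)" by (simp add: nrm_def nonneg)

lemma Cauchy_Schwarz: 
  assumes "x \<in> L" "y \<in> L" shows "cmod (B x y) \<le> nrm x * nrm y"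
  by (rule power2_le_imp_le)
     (use assms Cauchy_Schwarz_sq[OF assms] in \<open>auto simp: power_mult_distrib nrm_sq\<close>)

lemma nrm_triangle:
  assumes x: "x \<in> L" and y: "y \<in> L" shows "nrm (pl x y) \<le> nrm x + nrm y"
proof (rule power2_le_imp_le)
  have "(nrm (pl x y))\<^sup>2 = Re (B x x) + 2 * Re (B x y) + Re (B y y)"
    using x y hermitian[OF x y] by (simp add: nrm_sq pl_closed add_left add_right)
  also have "\<dots> \<le> (nrm x)\<^sup>2 + 2 * (nrm x * nrm y) + (nrm y)\<^sup>2"
    using Cauchy_Schwarz[OF x y] complex_Re_le_cmod[of "B x y"] x y by (simp add: nrm_sq)
  finally show "(nrm (pl x y))\<^sup>2 \<le> (nrm x + nrm y)\<^sup>2" by (simp add: power2_sum)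
qed (use x y in auto)

lemma nrm_sc: "x \<in> L \<Longrightarrow> nrm (sc c x) = cmod c * nrm x"
proof -
  assume x: "x \<in> L"
  have "B (sc c x) (sc c x) = (c * cnj c) * B x x"
    using x by (simp add: sc_left sc_right sc_closed)
  also have "\<dots> = of_real ((cmod c)\<^sup>2 * Re (B x x))"
    using self_real[OF x] by (metis complex_norm_square of_real_mult)
  finally show ?thesis by (simp add: nrm_def real_sqrt_mult)
qed

end

lemma complex_ring_simps [simp]:
  "carrier complex_ring = UNIV" "mult complex_ring = (*)" "one complex_ring = 1"
  "zero complex_ring = 0" "add complex_ring = (+)"
  by (simp_all add: complex_ring_def)

lemma cring_complex_ring: "cring complex_ring"
  by (rule cringI)
    (auto intro!: abelian_groupI comm_monoidI simp: algebra_simps, metis add.right_inverse)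

lemma a_inv_complex_ring [simp]: "\<ominus>\<^bsub>complex_ring\<^esub> c = - c"
proof -
  interpret cring complex_ring by (rule cring_complex_ring)
  show ?thesis using minus_equality[of "- c" c] by simp
qed

text \<open>
  Quotients carry an inner product that is only known through the norm, so whatever concerns distances
  is developed from the norm alone.
\<close>

locale normed_space = Module.module complex_ring H for H (structure) +
  assumes hnorm_triangle: 
      "\<lbrakk>x \<in> carrier H; y \<in> carrier H\<rbrakk> \<Longrightarrow> hnorm H (x \<oplus> y) \<le> hnorm H x + hnorm H y"
    and hnorm_smult: "x \<in> carrier H \<Longrightarrow> hnorm H (c \<odot> x) = cmod c * hnorm H x"
    and hnorm_eq_0D: "\<lbrakk>x \<in> carrier H; hnorm H x = 0\<rbrakk> \<Longrightarrow> x = \<zero>"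
begin

lemma one_smult [simp]: "x \<in> carrier H \<Longrightarrow> 1 \<odot> x = x"
  using smult_one[of x] by simp

lemma zero_smult [simp]: "x \<in> carrier H \<Longrightarrow> 0 \<odot> x = \<zero>"
  using smult_l_null[of x] by simp

lemma minus_smult: "x \<in> carrier H \<Longrightarrow> (- c) \<odot> x = \<ominus> (c \<odot> x)"
  using smult_l_minus[of c x] by simp

lemma smult_add_left: "x \<in> carrier H \<Longrightarrow> (c + d) \<odot> x = c \<odot> x \<oplus> d \<odot> x"
  using smult_l_distr[of c d x] by simp

lemma smult_diff_left: "x \<in> carrier H \<Longrightarrow> (c - d) \<odot> x = c \<odot> x \<ominus> d \<odot> x"
  using smult_add_left[of x c "- d"] by (simp add: minus_smult a_minus_def)

lemma smult_smult: "x \<in> carrier H \<Longrightarrow> c \<odot> (d \<odot> x) = (c * d) \<odot> x"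
  using smult_assoc1[of c d x] by simp

lemma hnorm_zero [simp]: "hnorm H \<zero> = 0"
  using hnorm_smult[of \<zero> 0] smult_r_null[of 0] by simp

lemma hnorm_uminus [simp]: "x \<in> carrier H \<Longrightarrow> hnorm H (\<ominus> x) = hnorm H x"
  using hnorm_smult[of x "-1"] smult_l_minus[of 1 x] smult_one[of x] by simp

lemma hnorm_nonneg [simp]: "x \<in> carrier H \<Longrightarrow> 0 \<le> hnorm H x"
  using hnorm_triangle[of x "\<ominus> x"] by (simp add: M.r_neg)

lemma hnorm_minus_commute: 
  "\<lbrakk>x \<in> carrier H; y \<in> carrier H\<rbrakk> \<Longrightarrow> hnorm H (x \<ominus> y) = hnorm H (y \<ominus> x)"
  using hnorm_uminus[of "x \<ominus> y"] by (simp add: a_minus_def M.minus_add M.a_comm)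

lemma minus_telescope:
  "\<lbrakk>x \<in> carrier H; y \<in> carrier H; z \<in> carrier H\<rbrakk> \<Longrightarrow> (x \<ominus> y) \<oplus> (y \<ominus> z) = x \<ominus> z"
  by (simp add: a_minus_def M.a_assoc M.r_neg1)

lemma minus_add_cancel:
  "\<lbrakk>x \<in> carrier H; y \<in> carrier H\<rbrakk> \<Longrightarrow> (x \<ominus> y) \<oplus> y = x"
  by (simp add: a_minus_def M.a_assoc M.l_neg)

lemma hnorm_minus_triangle:
  "\<lbrakk>x \<in> carrier H; y \<in> carrier H; z \<in> carrier H\<rbrakk> \<Longrightarrow> 
    hnorm H (x \<ominus> z) \<le> hnorm H (x \<ominus> y) + hnorm H (y \<ominus> z)"
  using hnorm_triangle[of "x \<ominus> y" "y \<ominus> z"] by (simp add: minus_telescope)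

lemma hnorm_minus_eq_0_iff:
  assumes "x \<in> carrier H" "y \<in> carrier H" shows "hnorm H (x \<ominus> y) = 0 \<longleftrightarrow> x = y"
  proof
  assume "hnorm H (x \<ominus> y) = 0"
  then have "x \<ominus> y = \<zero>" using assms hnorm_eq_0D[of "x \<ominus> y"] by simp
  then show "x = y" using minus_add_cancel[OF assms] assms by simp
qed (use assms in \<open>simp add: a_minus_def M.r_neg\<close>)

lemma metric: "Metric_space (carrier H) (hdist H)"
proof
  show "0 \<le> hdist H x y" for x y by (simp add: hdist_def)
  show "hdist H x y = hdist H y x" for x y using hnorm_minus_commute by (simp add: hdist_def)
  show "(hdist H x y = 0) = (x = y)" if "x \<in> carrier H" "y \<in> carrier H" for x y
    using that by (simp add: hdist_def hnorm_minus_eq_0_iff)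
  show "hdist H x z \<le> hdist H x y + hdist H y z" 
    if "x \<in> carrier H" "y \<in> carrier H" "z \<in> carrier H" for x y z
    using that by (simp add: hdist_def hnorm_minus_triangle)
qed

sublocale MS: Metric_space "carrier H" "hdist H" by (rule metric)

lemma htop_eq: "htop H = MS.mtopology" by (simp add: htop_def)

lemma closure_of_eq:
  "htop H closure_of S = 
    {x \<in> carrier H. \<forall>e>0. \<exists>y \<in> S. y \<in> carrier H \<and> hnorm H (x \<ominus> y) < e}"
  unfolding htop_eq MS.metric_closure_of by (auto simp: hdist_def)

lemma closedin_iff:
  "closedin (htop H) S \<longleftrightarrow> S \<subseteq> carrier H \<and>
    (\<forall>x \<in> carrier H. (\<forall>e>0. \<exists>y \<in> S. hnorm H (x \<ominus> y) < e) \<longrightarrow> x \<in> S)"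
proof -
  have "closedin (htop H) S \<longleftrightarrow> S \<subseteq> carrier H \<and> htop H closure_of S \<subseteq> S"
    by (metis closure_of_eq closure_of_subset_eq htop_eq MS.topspace_mtopology)
  then show ?thesis unfolding closure_of_eq by blast
qed

lemma mcomplete_iff:
  "MS.mcomplete \<longleftrightarrow> (\<forall>s. (\<forall>n. s n \<in> carrier H) \<and> 
     (\<forall>e>0. \<exists>N. \<forall>m\<ge>N. \<forall>n\<ge>N. hnorm H (s m \<ominus> s n) < e) \<longrightarrow>
     (\<exists>x\<in>carrier H. (\<lambda>n. hnorm H (s n \<ominus> x)) \<longlonglongrightarrow> 0))"
proof -
  have 1: "MS.MCauchy s \<longleftrightarrow> (\<forall>n. s n \<in> carrier H) \<and> 
     (\<forall>e>0. \<exists>N. \<forall>m\<ge>N. \<forall>n\<ge>N. hnorm H (s m \<ominus> s n) < e)" for s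
    unfolding MS.MCauchy_def by (auto simp: hdist_def range_subsetD)
  have 2: "limitin MS.mtopology s x sequentially \<longleftrightarrow> 
     x \<in> carrier H \<and> (\<lambda>n. hnorm H (s n \<ominus> x)) \<longlonglongrightarrow> 0" if "\<forall>n. s n \<in> carrier H" for s x
    unfolding MS.limitin_metric_dist_null using that by (auto simp: hdist_def cong: conj_cong)
  show ?thesis unfolding MS.mcomplete_def 1 Bex_def by (intro all_cong1 imp_cong refl) (use 2 in auto)
qed

end

locale pre_hilbert = Module.module complex_ring H for H (structure) +
  assumes hinner_add_left:
      "\<lbrakk>x \<in> carrier H; y \<in> carrier H; z \<in> carrier H\<rbrakk> \<Longrightarrow>
        hinner H (x \<oplus> y) z = hinner H x z + hinner H y z"
    and hinner_smult_left:
      "\<lbrakk>x \<in> carrier H; y \<in> carrier H\<rbrakk> \<Longrightarrow> hinner H (c \<odot> x) y = c * hinner H x y"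
    and hinner_commute:
      "\<lbrakk>x \<in> carrier H; y \<in> carrier H\<rbrakk> \<Longrightarrow> hinner H y x = cnj (hinner H x y)"
    and hinner_nonneg: "x \<in> carrier H \<Longrightarrow> 0 \<le> Re (hinner H x x)"
    and hinner_definite: "\<lbrakk>x \<in> carrier H; hinner H x x = 0\<rbrakk> \<Longrightarrow> x = \<zero>"
begin

sublocale SI: semi_inner "carrier H" "(\<oplus>)" "(\<odot>)" "hinner H"
  rewrites "SI.nrm = hnorm H"
proof -
  show *: "semi_inner (carrier H) (\<oplus>) (\<odot>) (hinner H)"
    by unfold_locales 
      (auto simp: hinner_add_left hinner_smult_left hinner_nonneg intro: hinner_commute)
  show "semi_inner.nrm (hinner H) = hnorm H"
    by (rule ext) (simp add: semi_inner.nrm_def[OF *] hnorm_def)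
qed

sublocale normed_space H
proof unfold_locales
  show "hnorm H (x \<oplus> y) \<le> hnorm H x + hnorm H y" 
    if "x \<in> carrier H" "y \<in> carrier H" for x y using that by (rule SI.nrm_triangle)
  show "hnorm H (c \<odot> x) = cmod c * hnorm H x" if "x \<in> carrier H" for x c
    using that by (rule SI.nrm_sc)
  show "x = \<zero>" if "x \<in> carrier H" "hnorm H x = 0" for x
  proof (rule hinner_definite)
    show "hinner H x x = 0" using that SI.self_real[of x] SI.nrm_sq[of x] by simp
  qed (use that in auto)
qed

lemma hinner_zero_left [simp]: "x \<in> carrier H \<Longrightarrow> hinner H \<zero> x = 0"
  using hinner_smult_left[of \<zero> x 0] by (simp add: smult_r_null)

lemma hinner_zero_right [simp]: "x \<in> carrier H \<Longrightarrow> hinner H x \<zero> = 0"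
  using hinner_commute[of \<zero> x] by simp

lemma hnorm_sq: "x \<in> carrier H \<Longrightarrow> (hnorm H x)\<^sup>2 = Re (hinner H x x)"
  by (rule SI.nrm_sq)

end

lemma (in hilbert_space) pre_hilbert: "pre_hilbert H"
  by unfold_locales 
    (auto simp: hinner_add_left hinner_smult_left hinner_nonneg hinner_definite intro: hinner_commute)

lemma hilbert_space_iff:
  "hilbert_space H \<longleftrightarrow> pre_hilbert H \<and> Metric_space.mcomplete (carrier H) (hdist H)"
  using hilbert_space.pre_hilbert hilbert_space.complete
  by (auto simp: hilbert_space_def hilbert_space_axioms_def pre_hilbert_def pre_hilbert_axioms_def)

section \<open>The Hilbert space tensor product\<close>

text \<open>
  The operations of \<open>L\<close> satisfy no laws, so a linear combination is described by its pairings.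
\<close>

lemma (in semi_inner) combination:
  assumes "finite I" "I \<noteq> {}" "\<And>i. i \<in> I \<Longrightarrow> x i \<in> L"
  shows "\<exists>u\<in>L. \<forall>w\<in>L. B u w = (\<Sum>i\<in>I. a i * B (x i) w)"
  using assms
proof (induction rule: finite_ne_induct)
  case (singleton i)
  then show ?case by (intro bexI[of _ "sc (a i) (x i)"]) (auto simp: sc_left sc_closed)
next
  case (insert i F)
  then obtain u where u: "u \<in> L" "\<forall>w\<in>L. B u w = (\<Sum>i\<in>F. a i * B (x i) w)" by auto
  show ?case
    by (rule bexI[of _ "pl (sc (a i) (x i)) u"])
       (use u insert in \<open>auto simp: add_left sc_left sc_closed pl_closed\<close>)
qed

text \<open>
  The Schur product theorem. Splitting off from each \<open>y i\<close> its component along one vector \<open>y k\<close> splits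
  the double sum into \<open>c * B u u\<close>, for a linear combination \<open>u\<close> of the \<open>x i\<close>, and the same double sum for the
  remainders \<open>w i\<close>. Since \<open>w k = 0\<close>, the latter has one index less.
\<close>

lemma (in pre_hilbert) Schur_product_nonneg:
  assumes "semi_inner L pl sc B"
    and "finite I" "\<And>i. i \<in> I \<Longrightarrow> x i \<in> L" "\<And>i. i \<in> I \<Longrightarrow> y i \<in> carrier H"
  shows "0 \<le> Re (\<Sum>i\<in>I. \<Sum>j\<in>I. B (x i) (x j) * hinner H (y i) (y j))"
  using assms(2-)
proof (induction I arbitrary: y)
  case (insert k I)
  interpret B: semi_inner L pl sc B by fact
  let ?J = "insert k I"
  have yk: "y k \<in> carrier H" using insert.prems by auto
  have reduce: "(\<Sum>i\<in>?J. \<Sum>j\<in>?J. B (x i) (x j) * hinner H (w i) (w j))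
      = (\<Sum>i\<in>I. \<Sum>j\<in>I. B (x i) (x j) * hinner H (w i) (w j))"
    if "\<And>i. i \<in> ?J \<Longrightarrow> w i \<in> carrier H" "w k = \<zero>" for w
    using that insert.hyps by simp
  show ?case
  proof (cases "y k = \<zero>")
    case True
    have "0 \<le> Re (\<Sum>i\<in>I. \<Sum>j\<in>I. B (x i) (x j) * hinner H (y i) (y j))"
      by (rule insert.IH) (use insert.prems in auto)
    then show ?thesis using reduce[of y] True insert.prems by simp
  next
    case False
    define c where "c = Re (hinner H (y k) (y k))"
    have yy: "hinner H (y k) (y k) = of_real c" using SI.self_real[OF yk] c_def by simp
    have c0: "c \<noteq> 0" using False hinner_definite[OF yk] yy by auto
    have c: "c > 0" using c0 hinner_nonneg[OF yk] c_def by simp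
    define a where "a i = hinner H (y i) (y k) / of_real c" for i
    define w where "w i = y i \<ominus> a i \<odot> y k" for i
    have ak: "a k = 1" using c0 by (simp add: a_def yy)
    have wc: "w i \<in> carrier H" if "i \<in> ?J" for i using insert.prems that yk w_def by auto
    have wk: "w k = \<zero>" using yk by (simp add: w_def ak a_minus_def M.r_neg one_smult)
    have yik: "hinner H (y i) (y k) = a i * of_real c" for i using c0 by (simp add: a_def)
    have yki: "hinner H (y k) (y i) = cnj (a i) * of_real c" if "i \<in> ?J" for i 
      using yik[of i] hinner_commute[of "y i" "y k"] that insert.prems yk by simp
    have split: "hinner H (y i) (y j) = of_real c * (a i * cnj (a j)) + hinner H (w i) (w j)" 
      if "i \<in> ?J" "j \<in> ?J" for i j
    proof -
      have i: "y i \<in> carrier H" and j: "y j \<in> carrier H" using insert.prems that by auto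
      have e: "w i = y i \<oplus> (- a i) \<odot> y k" "w j = y j \<oplus> (- a j) \<odot> y k"
        using i j yk smult_l_minus[of _ "y k"] by (simp_all add: w_def a_minus_def)
      show ?thesis unfolding e using i j yk 
        by (simp add: SI.add_left SI.add_right SI.sc_left SI.sc_right yy yik yki[OF that(2)] ak algebra_simps)
    qed
    obtain u where u: "u \<in> L" "\<forall>v\<in>L. B u v = (\<Sum>i\<in>?J. a i * B (x i) v)"
      using B.combination[of ?J x a] insert by auto
    have buu: "B u u = (\<Sum>i\<in>?J. \<Sum>j\<in>?J. B (x i) (x j) * (a i * cnj (a j)))"
    proof -
      have "B (x i) u = (\<Sum>j\<in>?J. cnj (a j) * B (x i) (x j))" if "i \<in> ?J" for i
      proof -
        have "B (x i) u = cnj (B u (x i))" using B.hermitian u that insert.prems by blast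
        also have "\<dots> = cnj (\<Sum>j\<in>?J. a j * B (x j) (x i))" using u(2) that insert.prems by simp
        also have "\<dots> = (\<Sum>j\<in>?J. cnj (a j) * B (x i) (x j))"
          unfolding cnj_sum 
          by (intro sum.cong refl) (metis B.hermitian complex_cnj_mult insert.prems(1) that)
        finally show ?thesis .
      qed
      then have "B u u = (\<Sum>i\<in>?J. a i * (\<Sum>j\<in>?J. cnj (a j) * B (x i) (x j)))"
        using u by simp
      then show ?thesis by (simp only: sum_distrib_left mult_ac)
    qed
    have "(\<Sum>i\<in>?J. \<Sum>j\<in>?J. B (x i) (x j) * hinner H (y i) (y j))
      = (\<Sum>i\<in>?J. \<Sum>j\<in>?J. of_real c * (B (x i) (x j) * (a i * cnj (a j)))
           + B (x i) (x j) * hinner H (w i) (w j))"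
      by (intro sum.cong refl) (simp only: split distrib_left mult_ac)
    also have "\<dots> = of_real c * B u u + (\<Sum>i\<in>I. \<Sum>j\<in>I. B (x i) (x j) * hinner H (w i) (w j))"
      using reduce[of w] wc wk by (simp only: sum.distrib flip: sum_distrib_left buu)
    finally have "Re (\<Sum>i\<in>?J. \<Sum>j\<in>?J. B (x i) (x j) * hinner H (y i) (y j)) 
      = c * Re (B u u) + Re (\<Sum>i\<in>I. \<Sum>j\<in>I. B (x i) (x j) * hinner H (w i) (w j))"
      by simp
    moreover have "0 \<le> Re (\<Sum>i\<in>I. \<Sum>j\<in>I. B (x i) (x j) * hinner H (w i) (w j))"
      by (rule insert.IH) (use insert.prems wc in auto)
    ultimately show ?thesis using c B.nonneg[OF u(1)] by simp
  qed
qed simp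

lemma fsum_inner_nth:
  "fsum_inner M N s t = (\<Sum>i<length s. \<Sum>j<length t. 
     hinner M (fst (s ! i)) (fst (t ! j)) * hinner N (snd (s ! i)) (snd (t ! j)))"
  unfolding fsum_inner_def by (simp add: sum_list_sum_nth case_prod_beta atLeast0LessThan)

locale tensor_pair = M: pre_hilbert M + N: pre_hilbert N 
  for M :: "(complex, 'a, 'k) hilb_scheme" and N :: "(complex, 'b, 'l) hilb_scheme"
begin

definition fscale :: "complex \<Rightarrow> ('a \<times> 'b) list \<Rightarrow> ('a \<times> 'b) list" where
  "fscale c = map (\<lambda>(x, y). (c \<odot>\<^bsub>M\<^esub> x, y))"

definition fneg :: "('a \<times> 'b) list \<Rightarrow> ('a \<times> 'b) list" where
  "fneg = map (\<lambda>(x, y). (\<ominus>\<^bsub>M\<^esub> x, y))"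

abbreviation "Fs \<equiv> fsums M N"
abbreviation "IP \<equiv> fsum_inner M N"
abbreviation "D \<equiv> fsum_dist M N"

lemma fsums_Nil [simp]: "[] \<in> Fs" by (simp add: fsums_def)
lemma fsums_Cons [simp]: "p # s \<in> Fs \<longleftrightarrow> fst p \<in> carrier M \<and> snd p \<in> carrier N \<and> s \<in> Fs" 
  by (cases p) (auto simp: fsums_def)
lemma fsums_append [simp]: "s @ t \<in> Fs \<longleftrightarrow> s \<in> Fs \<and> t \<in> Fs" by (auto simp: fsums_def)
lemma fsums_fscale [simp]: "s \<in> Fs \<Longrightarrow> fscale c s \<in> Fs" by (induction s) (auto simp: fscale_def)
lemma fsums_fneg [simp]: "s \<in> Fs \<Longrightarrow> fneg s \<in> Fs" by (induction s) (auto simp: fneg_def)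

lemma IP_Nil [simp]: "IP [] t = 0" "IP s [] = 0" by (simp_all add: fsum_inner_nth)

lemma IP_append_left: "IP (s @ s') t = IP s t + IP s' t" by (simp add: fsum_inner_def)

lemma IP_fscale: "s \<in> Fs \<Longrightarrow> t \<in> Fs \<Longrightarrow> IP (fscale c s) t = c * IP s t"
proof (induction s)
  case (Cons p s)
  obtain x y where p: "p = (x, y)" by force
  have "(\<Sum>(x', y')\<leftarrow>t. hinner M (c \<odot>\<^bsub>M\<^esub> x) x' * hinner N y y')
      = c * (\<Sum>(x', y')\<leftarrow>t. hinner M x x' * hinner N y y')"
    using Cons.prems(2)
    by (induction t) (use Cons.prems p in \<open>auto simp: M.hinner_smult_left algebra_simps\<close>)
  then show ?case using Cons p by (simp add: fsum_inner_def fscale_def algebra_simps)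
qed (simp add: fsum_inner_def fscale_def)

lemma fneg_eq: "s \<in> Fs \<Longrightarrow> fneg s = fscale (-1) s"
  by (induction s) (auto simp: fneg_def fscale_def M.minus_smult)

lemma IP_commute: "s \<in> Fs \<Longrightarrow> t \<in> Fs \<Longrightarrow> IP t s = cnj (IP s t)"
proof -
  assume st: "s \<in> Fs" "t \<in> Fs"
  have c: "fst (s ! i) \<in> carrier M" "snd (s ! i) \<in> carrier N" if "i < length s" "s \<in> Fs" for i s
  proof -
    have "s ! i \<in> carrier M \<times> carrier N" using that nth_mem[of i s] by (auto simp: fsums_def)
    then show "fst (s ! i) \<in> carrier M" "snd (s ! i) \<in> carrier N" by auto
  qed
  show ?thesis unfolding fsum_inner_nth cnj_sum
    by (subst sum.swap, intro sum.cong refl)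
       (use c st in \<open>auto simp: M.hinner_commute[of "fst (s ! _)" "fst (t ! _)"] 
          N.hinner_commute[of "snd (s ! _)" "snd (t ! _)"]\<close>)
qed

lemma Schur_lists:
  assumes "semi_inner (carrier M) pl sc B" and s: "s \<in> Fs"
  shows "0 \<le> Re (\<Sum>(x, y)\<leftarrow>s. \<Sum>(x', y')\<leftarrow>s. B x x' * hinner N y y')"
proof -
  have c: "fst (s ! i) \<in> carrier M" "snd (s ! i) \<in> carrier N" if "i < length s" for i
  proof -
    have "s ! i \<in> carrier M \<times> carrier N" using that nth_mem[of i s] s by (auto simp: fsums_def)
    then show "fst (s ! i) \<in> carrier M" "snd (s ! i) \<in> carrier N" by auto
  qed
  have "0 \<le> Re (\<Sum>i<length s. \<Sum>j<length s. 
     B (fst (s ! i)) (fst (s ! j)) * hinner N (snd (s ! i)) (snd (s ! j)))"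
    by (rule N.Schur_product_nonneg[OF assms(1)]) (use c in auto)
  then show ?thesis by (simp add: sum_list_sum_nth case_prod_beta atLeast0LessThan)
qed

sublocale F: semi_inner Fs "(@)" fscale IP
proof unfold_locales
  show "0 \<le> Re (IP s s)" if "s \<in> Fs" for s
    unfolding fsum_inner_def by (rule Schur_lists[OF M.SI.semi_inner_axioms that])
qed (auto simp: IP_append_left IP_fscale intro: IP_commute)

lemma IP_fneg_left: "s \<in> Fs \<Longrightarrow> t \<in> Fs \<Longrightarrow> IP (fneg s) t = - IP s t" 
  by (simp add: fneg_eq IP_fscale)

lemma IP_fneg_right: "s \<in> Fs \<Longrightarrow> t \<in> Fs \<Longrightarrow> IP t (fneg s) = - IP t s" 
  by (simp add: fneg_eq F.sc_right)

lemmas IP_simps = IP_append_left F.add_right IP_fneg_left IP_fneg_right IP_fscale F.sc_right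

lemma D_eq: "D s t = F.nrm (s @ fneg t)"
  by (simp add: fsum_dist_def F.nrm_def fneg_def Let_def)

text \<open>
  Different lists may denote the same tensor. They then have the same pairing with every list, and this
  is what replaces equality of tensors before the passage to classes.
\<close>

lemma nrm_cong: 
  assumes "s \<in> Fs" "t \<in> Fs" "\<And>w. w \<in> Fs \<Longrightarrow> IP s w = IP t w" shows "F.nrm s = F.nrm t"
proof -
  have "IP s s = cnj (IP s t)" using assms IP_commute by metis
  also have "\<dots> = IP t t" using assms IP_commute by metis
  finally show ?thesis by (simp add: F.nrm_def)
qed

lemma D_nonneg [simp]: "s \<in> Fs \<Longrightarrow> t \<in> Fs \<Longrightarrow> 0 \<le> D s t" by (simp add: D_eq)

lemma D_zero:
  assumes "s \<in> Fs" "t \<in> Fs" "\<And>w. w \<in> Fs \<Longrightarrow> IP s w = IP t w" shows "D s t = 0"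
proof -
  have "F.nrm (s @ fneg t) = F.nrm []"
    by (rule nrm_cong) (use assms in \<open>auto simp: IP_simps\<close>)
  then show ?thesis by (simp add: D_eq F.nrm_def)
qed

lemma D_self [simp]: "s \<in> Fs \<Longrightarrow> D s s = 0" by (rule D_zero) auto

lemma D_commute: "s \<in> Fs \<Longrightarrow> t \<in> Fs \<Longrightarrow> D s t = D t s"
proof -
  assume st: "s \<in> Fs" "t \<in> Fs"
  have "F.nrm (s @ fneg t) = F.nrm (fscale (-1) (t @ fneg s))"
    by (rule nrm_cong) (use st in \<open>auto simp: IP_simps\<close>)
  then show ?thesis using st F.nrm_sc[of "t @ fneg s" "-1"] by (simp add: D_eq)
qed

lemma D_triangle:
  assumes "s \<in> Fs" "t \<in> Fs" "u \<in> Fs" shows "D s u \<le> D s t + D t u"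
proof -
  have "F.nrm (s @ fneg u) = F.nrm ((s @ fneg t) @ (t @ fneg u))"
    by (rule nrm_cong) (use assms in \<open>auto simp: IP_simps\<close>)
  then show ?thesis using F.nrm_triangle[of "s @ fneg t" "t @ fneg u"] assms by (simp add: D_eq)
qed

lemma D_append:
  assumes "s \<in> Fs" "t \<in> Fs" "s' \<in> Fs" "t' \<in> Fs" shows "D (s @ t) (s' @ t') \<le> D s s' + D t t'"
proof -
  have "F.nrm ((s @ t) @ fneg (s' @ t')) = F.nrm ((s @ fneg s') @ (t @ fneg t'))"
    by (rule nrm_cong) (use assms in \<open>auto simp: IP_simps\<close>)
  then show ?thesis using F.nrm_triangle[of "s @ fneg s'" "t @ fneg t'"] assms by (simp add: D_eq)
qed

lemma nrm_diff:
  assumes "s \<in> Fs" "t \<in> Fs" shows "\<bar>F.nrm s - F.nrm t\<bar> \<le> D s t"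
proof -
  have *: "F.nrm s \<le> F.nrm t + D s t" if "s \<in> Fs" "t \<in> Fs" for s t
  proof -
    have "F.nrm s = F.nrm ((s @ fneg t) @ t)"
      by (rule nrm_cong) (use that in \<open>auto simp: IP_simps\<close>)
    then show ?thesis using F.nrm_triangle[of "s @ fneg t" t] that by (simp add: D_eq)
  qed
  show ?thesis using *[of s t] *[of t s] assms D_commute[of s t] by simp
qed

lemma IP_diff:
  assumes "s \<in> Fs" "t \<in> Fs" "s' \<in> Fs" "t' \<in> Fs"
  shows "cmod (IP s t - IP s' t') \<le> D s s' * F.nrm t + F.nrm s' * D t t'"
proof -
  have "IP s t - IP s' t' = IP (s @ fneg s') t + IP s' (t @ fneg t')"
    using assms by (simp add: IP_simps)
  also have "cmod \<dots> \<le> cmod (IP (s @ fneg s') t) + cmod (IP s' (t @ fneg t'))" 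
    by (rule norm_triangle_ineq)
  also have "\<dots> \<le> D s s' * F.nrm t + F.nrm s' * D t t'"
    unfolding D_eq by (intro add_mono F.Cauchy_Schwarz) (use assms in auto)
  finally show ?thesis .
qed

definition fmap :: "('a \<Rightarrow> 'a) \<Rightarrow> ('a \<times> 'b) list \<Rightarrow> ('a \<times> 'b) list" where
  "fmap \<rho> = map (\<lambda>(x, y). (\<rho> x, y))"

lemma fmap_simps [simp]: "fmap \<rho> [] = []" "fmap \<rho> ((x, y) # s) = (\<rho> x, y) # fmap \<rho> s"
  by (simp_all add: fmap_def)

definition left_op :: "('a \<Rightarrow> 'a) \<Rightarrow> real \<Rightarrow> bool" where
  "left_op \<rho> C \<longleftrightarrow> 0 \<le> C \<and> (\<forall>x\<in>carrier M. \<rho> x \<in> carrier M \<and> hnorm M (\<rho> x) \<le> C * hnorm M x) \<and>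
     (\<forall>x\<in>carrier M. \<forall>y\<in>carrier M. \<rho> (x \<oplus>\<^bsub>M\<^esub> y) = \<rho> x \<oplus>\<^bsub>M\<^esub> \<rho> y) \<and>
     (\<forall>x\<in>carrier M. \<forall>c. \<rho> (c \<odot>\<^bsub>M\<^esub> x) = c \<odot>\<^bsub>M\<^esub> \<rho> x)"

lemma left_op_smult: "left_op (\<lambda>x. c \<odot>\<^bsub>M\<^esub> x) (cmod c)"
  unfolding left_op_def
proof (intro conjI ballI allI)
  fix x d assume x: "x \<in> carrier M"
  show "c \<odot>\<^bsub>M\<^esub> (d \<odot>\<^bsub>M\<^esub> x) = d \<odot>\<^bsub>M\<^esub> (c \<odot>\<^bsub>M\<^esub> x)"
    using M.smult_assoc1[of c d x] M.smult_assoc1[of d c x] x by (simp add: mult.commute)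
qed (auto simp: M.hnorm_smult M.smult_r_distr)

lemma fsums_fmap: "left_op \<rho> C \<Longrightarrow> s \<in> Fs \<Longrightarrow> fmap \<rho> s \<in> Fs"
  by (induction s) (auto simp: fmap_def left_op_def)

lemma fmap_append: "fmap \<rho> (s @ t) = fmap \<rho> s @ fmap \<rho> t"
  by (simp add: fmap_def)

lemma fmap_fneg: "left_op \<rho> C \<Longrightarrow> s \<in> Fs \<Longrightarrow> fmap \<rho> (fneg s) = fneg (fmap \<rho> s)"
proof (induction s)
  case (Cons p s)
  have "\<rho> (\<ominus>\<^bsub>M\<^esub> x) = \<ominus>\<^bsub>M\<^esub> \<rho> x" if "x \<in> carrier M" for x
  proof -
    have "\<rho> ((-1) \<odot>\<^bsub>M\<^esub> x) = (-1) \<odot>\<^bsub>M\<^esub> \<rho> x" "\<rho> x \<in> carrier M"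
      using Cons.prems(1) that by (auto simp: left_op_def)
    then show ?thesis using that by (simp add: M.minus_smult)
  qed
  then show ?case using Cons by (cases p) (auto simp: fmap_def fneg_def)
qed (simp add: fmap_def fneg_def)

text \<open>
  The operator \<open>\<rho> \<otimes> 1\<close> has the bound of \<open>\<rho>\<close>: the form \<open>C\<^sup>2 \<langle>x, x'\<rangle> - \<langle>\<rho> x, \<rho> x'\<rangle>\<close> is semidefinite, and its Schur
  product with the inner product of \<open>N\<close> gives the difference of the two squared norms.
\<close>

lemma nrm_fmap:
  assumes \<rho>: "left_op \<rho> C" and s: "s \<in> Fs" shows "F.nrm (fmap \<rho> s) \<le> C * F.nrm s"
proof -
  define B where "B x x' = of_real (C\<^sup>2) * hinner M x x' - hinner M (\<rho> x) (\<rho> x')" for x x'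
  have r: "\<And>x. x \<in> carrier M \<Longrightarrow> \<rho> x \<in> carrier M" "C \<ge> 0"
    "\<And>x. x \<in> carrier M \<Longrightarrow> hnorm M (\<rho> x) \<le> C * hnorm M x"
    "\<And>x y. x \<in> carrier M \<Longrightarrow> y \<in> carrier M \<Longrightarrow> \<rho> (x \<oplus>\<^bsub>M\<^esub> y) = \<rho> x \<oplus>\<^bsub>M\<^esub> \<rho> y"
    "\<And>x c. x \<in> carrier M \<Longrightarrow> \<rho> (c \<odot>\<^bsub>M\<^esub> x) = c \<odot>\<^bsub>M\<^esub> \<rho> x"
    using \<rho> by (auto simp: left_op_def)
  have "semi_inner (carrier M) (\<oplus>\<^bsub>M\<^esub>) (\<odot>\<^bsub>M\<^esub>) B"
  proof unfold_locales
    show "0 \<le> Re (B x x)" if x: "x \<in> carrier M" for x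
    proof -
      have "(hnorm M (\<rho> x))\<^sup>2 \<le> (C * hnorm M x)\<^sup>2"
        by (rule power_mono) (use r x in auto)
      then show ?thesis using r x by (simp add: B_def M.hnorm_sq[symmetric] power_mult_distrib)
    qed
    show "B y x = cnj (B x y)" if "x \<in> carrier M" "y \<in> carrier M" for x y
      using that r M.hinner_commute[of x y] M.hinner_commute[of "\<rho> x" "\<rho> y"] by (simp add: B_def)
  qed (use r in \<open>auto simp: B_def M.hinner_add_left M.hinner_smult_left algebra_simps\<close>)
  from Schur_lists[OF this s]
  have "0 \<le> Re (\<Sum>(x, y)\<leftarrow>s. \<Sum>(x', y')\<leftarrow>s. B x x' * hinner N y y')" .
  also have "(\<Sum>(x, y)\<leftarrow>s. \<Sum>(x', y')\<leftarrow>s. B x x' * hinner N y y')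
     = of_real (C\<^sup>2) * IP s s - IP (fmap \<rho> s) (fmap \<rho> s)"
  proof -
    have gen: "(\<Sum>(x', y')\<leftarrow>t. B x x' * hinner N y y') = 
       of_real (C\<^sup>2) * (\<Sum>(x', y')\<leftarrow>t. hinner M x x' * hinner N y y') 
        - (\<Sum>(x', y')\<leftarrow>fmap \<rho> t. hinner M (\<rho> x) x' * hinner N y y')" for x y t
      by (induction t) (auto simp: B_def algebra_simps)
    have inn: "(\<Sum>(x', y')\<leftarrow>s. B x x' * hinner N y y') = 
       of_real (C\<^sup>2) * (\<Sum>(x', y')\<leftarrow>s. hinner M x x' * hinner N y y') 
        - (\<Sum>(x', y')\<leftarrow>fmap \<rho> s. hinner M (\<rho> x) x' * hinner N y y')" for x y
      by (rule gen)
    have "(\<Sum>(x, y)\<leftarrow>t. \<Sum>(x', y')\<leftarrow>s. B x x' * hinner N y y')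
      = of_real (C\<^sup>2) * IP t s - IP (fmap \<rho> t) (fmap \<rho> s)" for t
      by (induction t) (auto simp: fsum_inner_def inn right_diff_distrib distrib_left)
    then show ?thesis .
  qed
  also have "Re (of_real (C\<^sup>2) * IP s s - IP (fmap \<rho> s) (fmap \<rho> s)) 
      = C\<^sup>2 * (F.nrm s)\<^sup>2 - (F.nrm (fmap \<rho> s))\<^sup>2"
    using F.nrm_sq[OF s] F.nrm_sq[OF fsums_fmap[OF \<rho> s]] by simp
  finally have "(F.nrm (fmap \<rho> s))\<^sup>2 \<le> (C * F.nrm s)\<^sup>2" 
    by (simp add: power_mult_distrib)
  moreover have "0 \<le> C * F.nrm s" using r(2) F.nrm_nonneg[OF s] by simp
  ultimately show ?thesis by (rule power2_le_imp_le)
qed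

lemma D_fmap:
  assumes \<rho>: "left_op \<rho> C" and s: "s \<in> Fs" and t: "t \<in> Fs" 
  shows "D (fmap \<rho> s) (fmap \<rho> t) \<le> C * D s t"
proof -
  have "fmap \<rho> s @ fneg (fmap \<rho> t) = fmap \<rho> (s @ fneg t)"
    using assms by (simp add: fmap_append fmap_fneg)
  then show ?thesis using nrm_fmap[OF \<rho>, of "s @ fneg t"] s t by (simp add: D_eq)
qed

end

lemma squeeze_zero:
  fixes f g :: "nat \<Rightarrow> real"
  assumes "g \<longlonglongrightarrow> 0" "\<And>n. 0 \<le> f n" "\<And>n. f n \<le> g n" shows "f \<longlonglongrightarrow> 0"
  by (rule tendsto_sandwich[OF always_eventually always_eventually tendsto_const assms(1)])
     (use assms in auto)

context tensor_pair
begin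

abbreviation "CS \<equiv> fsum_Cauchy M N"
abbreviation "cls \<equiv> fsum_class M N"
abbreviation "T \<equiv> htensor M N"

lemma CS_Fs: "s \<in> CS \<Longrightarrow> s n \<in> Fs" by (auto simp: fsum_Cauchy_def)

lemma CSI:
  assumes "\<And>n. s n \<in> Fs" 
    and "\<And>e. e > 0 \<Longrightarrow> \<exists>n0. \<forall>m\<ge>n0. \<forall>n\<ge>n0. D (s m) (s n) < e"
  shows "s \<in> CS" using assms by (auto simp: fsum_Cauchy_def)

lemma CSD: "s \<in> CS \<Longrightarrow> e > 0 \<Longrightarrow> \<exists>n0. \<forall>m\<ge>n0. \<forall>n\<ge>n0. D (s m) (s n) < e"
  by (auto simp: fsum_Cauchy_def)

lemma CS_const [simp]: "u \<in> Fs \<Longrightarrow> (\<lambda>n. u) \<in> CS" by (rule CSI) auto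

lemma CS_append:
  assumes s: "s \<in> CS" and t: "t \<in> CS" shows "(\<lambda>n. s n @ t n) \<in> CS"
proof (rule CSI)
  fix e :: real assume e: "e > 0"
  obtain a where a: "\<forall>m\<ge>a. \<forall>n\<ge>a. D (s m) (s n) < e / 2" using CSD[OF s, of "e / 2"] e by auto
  obtain b where b: "\<forall>m\<ge>b. \<forall>n\<ge>b. D (t m) (t n) < e / 2" using CSD[OF t, of "e / 2"] e by auto
  have "D (s m @ t m) (s n @ t n) < e" if "m \<ge> max a b" "n \<ge> max a b" for m n
  proof -
    have "D (s m) (s n) < e / 2" "D (t m) (t n) < e / 2" using a b that by auto
    then show ?thesis
      using D_append[of "s m" "t m" "s n" "t n"] CS_Fs s t by fastforce
  qed
  then show "\<exists>n0. \<forall>m\<ge>n0. \<forall>n\<ge>n0. D (s m @ t m) (s n @ t n) < e" by blast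
qed (use s t CS_Fs in auto)

lemma CS_fmap:
  assumes s: "s \<in> CS" and \<rho>: "left_op \<rho> C" shows "(\<lambda>n. fmap \<rho> (s n)) \<in> CS"
proof (rule CSI)
  fix e :: real assume e: "e > 0"
  have C: "C \<ge> 0" using \<rho> by (simp add: left_op_def)
  obtain a where a: "\<forall>m\<ge>a. \<forall>n\<ge>a. D (s m) (s n) < e / (C + 1)" 
    using CSD[OF s, of "e / (C + 1)"] e C by auto
  have "D (fmap \<rho> (s m)) (fmap \<rho> (s n)) < e" if "m \<ge> a" "n \<ge> a" for m n
  proof -
    have "D (fmap \<rho> (s m)) (fmap \<rho> (s n)) \<le> C * D (s m) (s n)"
      using D_fmap[OF \<rho>] CS_Fs[OF s] by blast
    also have "\<dots> \<le> C * (e / (C + 1))" using a that C by (intro mult_left_mono) (auto intro: less_imp_le)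
    also have "\<dots> < e" using e C by (simp add: field_simps)
    finally show ?thesis .
  qed
  then show "\<exists>n0. \<forall>m\<ge>n0. \<forall>n\<ge>n0. D (fmap \<rho> (s m)) (fmap \<rho> (s n)) < e" by blast
qed (use s \<rho> CS_Fs fsums_fmap in auto)

lemma fscale_fmap: "fscale c = fmap (\<lambda>x. c \<odot>\<^bsub>M\<^esub> x)" by (simp add: fscale_def fmap_def)

lemma rel_iff: "(s, t) \<in> fsum_rel M N \<longleftrightarrow> s \<in> CS \<and> t \<in> CS \<and> (\<lambda>n. D (s n) (t n)) \<longlonglongrightarrow> 0"
  by (simp add: fsum_rel_def)

lemma equiv_rel: "equiv CS (fsum_rel M N)"
proof (rule equivI)
  show "fsum_rel M N \<subseteq> CS \<times> CS" by (auto simp: rel_iff)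
  show "refl_on CS (fsum_rel M N)" by (rule refl_onI) (auto simp: rel_iff CS_Fs)
  show "sym (fsum_rel M N)" 
  proof (rule symI)
    fix s t assume "(s, t) \<in> fsum_rel M N"
    moreover have "D (s n) (t n) = D (t n) (s n)" if "s \<in> CS" "t \<in> CS" for n
      using D_commute that CS_Fs by blast
    ultimately show "(t, s) \<in> fsum_rel M N" by (auto simp: rel_iff)
  qed
  show "trans (fsum_rel M N)"
  proof (rule transI)
    fix s t u assume st: "(s, t) \<in> fsum_rel M N" and tu: "(t, u) \<in> fsum_rel M N"
    have "(\<lambda>n. D (s n) (t n) + D (t n) (u n)) \<longlonglongrightarrow> 0 + 0"
      using st tu by (intro tendsto_add) (auto simp: rel_iff)
    then have "(\<lambda>n. D (s n) (u n)) \<longlonglongrightarrow> 0"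
      by (intro squeeze_zero[where f = "\<lambda>n. D (s n) (u n)"]) 
         (use st tu CS_Fs D_triangle D_nonneg in \<open>auto simp: rel_iff\<close>)
    then show "(s, u) \<in> fsum_rel M N" using st tu by (simp add: rel_iff)
  qed
qed

lemma cls_in [simp]: "s \<in> CS \<Longrightarrow> cls s \<in> carrier T"
  by (simp add: htensor_def fsum_class_def quotientI)

lemma cls_eq_iff: "s \<in> CS \<Longrightarrow> t \<in> CS \<Longrightarrow> cls s = cls t \<longleftrightarrow> (\<lambda>n. D (s n) (t n)) \<longlonglongrightarrow> 0"
  using eq_equiv_class_iff[OF equiv_rel, of s t] by (simp add: fsum_class_def rel_iff)

lemma cls_eqI: 
  assumes "s \<in> CS" "t \<in> CS" "\<And>n w. w \<in> Fs \<Longrightarrow> IP (s n) w = IP (t n) w" shows "cls s = cls t"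
  unfolding cls_eq_iff[OF assms(1,2)] using D_zero[OF CS_Fs CS_Fs] assms by simp

lemma T_cases: 
  assumes "X \<in> carrier T" obtains s where "s \<in> CS" "X = cls s"
  using assms by (auto simp: htensor_def fsum_class_def elim!: quotientE)

lemma rep_rel: "s \<in> CS \<Longrightarrow> (s, fsum_rep (cls s)) \<in> fsum_rel M N"
proof -
  assume s: "s \<in> CS"
  have "s \<in> cls s" using s CS_Fs by (auto simp: fsum_class_def rel_iff)
  then have "fsum_rep (cls s) \<in> cls s" unfolding fsum_rep_def by (rule someI[of "\<lambda>t. t \<in> cls s"])
  then show ?thesis by (simp add: fsum_class_def)
qed

lemma rep_CS: "s \<in> CS \<Longrightarrow> fsum_rep (cls s) \<in> CS" using rep_rel by (auto simp: rel_iff)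

lemma rep_lim: "s \<in> CS \<Longrightarrow> (\<lambda>n. D (s n) (fsum_rep (cls s) n)) \<longlonglongrightarrow> 0" 
  using rep_rel by (auto simp: rel_iff)

lemma cls_add: 
  assumes s: "s \<in> CS" and t: "t \<in> CS" shows "cls s \<oplus>\<^bsub>T\<^esub> cls t = cls (\<lambda>n. s n @ t n)"
proof -
  have "(\<lambda>n. D (s n @ t n) (fsum_rep (cls s) n @ fsum_rep (cls t) n)) \<longlonglongrightarrow> 0"
  proof (rule squeeze_zero)
    show "(\<lambda>n. D (s n) (fsum_rep (cls s) n) + D (t n) (fsum_rep (cls t) n)) \<longlonglongrightarrow> 0"
      using tendsto_add[OF rep_lim[OF s] rep_lim[OF t]] by simp
  qed (use D_append D_nonneg CS_Fs s t rep_CS in auto)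
  then have "cls (\<lambda>n. s n @ t n) = cls (\<lambda>n. fsum_rep (cls s) n @ fsum_rep (cls t) n)"
    using cls_eq_iff CS_append s t rep_CS by blast
  then show ?thesis by (simp add: htensor_def)
qed

lemma cls_fmap:
  assumes s: "s \<in> CS" and \<rho>: "left_op \<rho> C"
  shows "cls (\<lambda>n. fmap \<rho> (fsum_rep (cls s) n)) = cls (\<lambda>n. fmap \<rho> (s n))"
proof -
  have "(\<lambda>n. D (fmap \<rho> (fsum_rep (cls s) n)) (fmap \<rho> (s n))) \<longlonglongrightarrow> 0"
  proof (rule squeeze_zero)
    show "(\<lambda>n. C * D (s n) (fsum_rep (cls s) n)) \<longlonglongrightarrow> 0"
      using tendsto_mult[OF tendsto_const rep_lim[OF s], of C] by simp
    fix n
    note F = CS_Fs[OF s, of n] CS_Fs[OF rep_CS[OF s], of n]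
    show "D (fmap \<rho> (fsum_rep (cls s) n)) (fmap \<rho> (s n)) \<le> C * D (s n) (fsum_rep (cls s) n)"
      using D_fmap[OF \<rho> F(2,1)] D_commute[OF F] by simp
    show "0 \<le> D (fmap \<rho> (fsum_rep (cls s) n)) (fmap \<rho> (s n))"
      by (rule D_nonneg; rule fsums_fmap[OF \<rho>]; rule F)
  qed
  then show ?thesis using cls_eq_iff CS_fmap s \<rho> rep_CS by blast
qed

lemma cls_smult: "s \<in> CS \<Longrightarrow> c \<odot>\<^bsub>T\<^esub> cls s = cls (\<lambda>n. fscale c (s n))"
  using cls_fmap[OF _ left_op_smult, of s c] by (simp add: htensor_def fscale_fmap fmap_def)

lemma T_zero: "\<zero>\<^bsub>T\<^esub> = cls (\<lambda>n. [])" by (simp add: htensor_def)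

lemma CS_fscale: "s \<in> CS \<Longrightarrow> (\<lambda>n. fscale c (s n)) \<in> CS"
  using CS_fmap[OF _ left_op_smult] by (simp add: fscale_fmap)

lemma CS_bounded: 
  assumes "s \<in> CS" obtains K where "\<And>n. F.nrm (s n) \<le> K"
proof -
  have "Cauchy (\<lambda>n. F.nrm (s n))"
    unfolding Cauchy_def dist_real_def
  proof (intro allI impI)
    fix e :: real assume "e > 0"
    then obtain n0 where n0: "\<forall>m\<ge>n0. \<forall>n\<ge>n0. D (s m) (s n) < e" using CSD[OF assms, of e] by auto
    have "\<bar>F.nrm (s m) - F.nrm (s n)\<bar> < e" if "m \<ge> n0" "n \<ge> n0" for m n
      using nrm_diff[OF CS_Fs[OF assms, of m] CS_Fs[OF assms, of n]] n0 that by fastforce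
    then show "\<exists>M. \<forall>m\<ge>M. \<forall>n\<ge>M. \<bar>F.nrm (s m) - F.nrm (s n)\<bar> < e" by blast
  qed
  then have "Bseq (\<lambda>n. F.nrm (s n))" by (rule Cauchy_Bseq)
  then show thesis using that by (auto simp: Bseq_def) (meson abs_le_D1)
qed

text \<open>
  The inner product of classes is defined through chosen representatives; the limit exists for all
  Cauchy sequences and does not depend on the choice.
\<close>

lemma IP_conv:
  assumes s: "s \<in> CS" and t: "t \<in> CS"
  shows "(\<lambda>n. IP (s n) (t n)) \<longlonglongrightarrow> hinner T (cls s) (cls t)"
proof -
  have conv: "convergent (\<lambda>n. IP (s n) (t n))" if s: "s \<in> CS" and t: "t \<in> CS" for s t
  proof (rule Cauchy_convergent, rule metric_CauchyI)
    fix e :: real assume e: "e > 0"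
    obtain K where K: "\<And>n. F.nrm (s n) \<le> K" using CS_bounded[OF s] by auto
    obtain L where L: "\<And>n. F.nrm (t n) \<le> L" using CS_bounded[OF t] by auto
    have KL: "K \<ge> 0" "L \<ge> 0" using K[of 0] L[of 0] F.nrm_nonneg[OF CS_Fs[OF s]] 
      F.nrm_nonneg[OF CS_Fs[OF t]] by (meson order_trans)+
    obtain a where a: "\<forall>m\<ge>a. \<forall>n\<ge>a. D (s m) (s n) < e / (K + L + 1)" 
      using CSD[OF s, of "e / (K + L + 1)"] e KL by auto
    obtain b where b: "\<forall>m\<ge>b. \<forall>n\<ge>b. D (t m) (t n) < e / (K + L + 1)" 
      using CSD[OF t, of "e / (K + L + 1)"] e KL by auto
    have "dist (IP (s m) (t m)) (IP (s n) (t n)) < e" if "m \<ge> max a b" "n \<ge> max a b" for m n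
    proof -
      have ab: "D (s m) (s n) < e / (K + L + 1)" "D (t m) (t n) < e / (K + L + 1)" 
        using a b that by auto
      have "cmod (IP (s m) (t m) - IP (s n) (t n)) 
          \<le> D (s m) (s n) * F.nrm (t m) + F.nrm (s n) * D (t m) (t n)"
        by (rule IP_diff) (use s t CS_Fs in auto)
      also have "\<dots> \<le> e / (K + L + 1) * L + K * (e / (K + L + 1))"
        using ab K L KL e D_nonneg CS_Fs[OF s] CS_Fs[OF t] F.nrm_nonneg
        by (intro add_mono mult_mono) (auto intro: less_imp_le)
      also have "\<dots> = e * ((K + L) / (K + L + 1))" by (simp add: algebra_simps add_divide_distrib)
      also have "\<dots> < e * 1" using e KL by (intro mult_strict_left_mono) auto
      finally show ?thesis by (simp add: dist_norm)
    qed
    then show "\<exists>M. \<forall>m\<ge>M. \<forall>n\<ge>M. dist (IP (s m) (t m)) (IP (s n) (t n)) < e" by blast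
  qed
  let ?s = "fsum_rep (cls s)" and ?t = "fsum_rep (cls t)"
  have "(\<lambda>n. IP (?s n) (?t n)) \<longlonglongrightarrow> lim (\<lambda>n. IP (?s n) (?t n))"
    using conv[OF rep_CS[OF s] rep_CS[OF t]] by (simp add: convergent_LIMSEQ_iff)
  then have *: "(\<lambda>n. IP (?s n) (?t n)) \<longlonglongrightarrow> hinner T (cls s) (cls t)" 
    by (simp add: htensor_def)
  obtain K where K: "\<And>n. F.nrm (?s n) \<le> K" using CS_bounded[OF rep_CS[OF s]] by auto
  obtain L where L: "\<And>n. F.nrm (t n) \<le> L" using CS_bounded[OF t] by auto
  have KL: "K \<ge> 0" "L \<ge> 0" using K[of 0] L[of 0] F.nrm_nonneg[OF CS_Fs[OF rep_CS[OF s]]] 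
    F.nrm_nonneg[OF CS_Fs[OF t]] by (meson order_trans)+
  have "(\<lambda>n. IP (s n) (t n) - IP (?s n) (?t n)) \<longlonglongrightarrow> 0"
  proof (rule tendsto_0_le[where K = 1])
    show "(\<lambda>n. D (s n) (?s n) * L + K * D (t n) (?t n)) \<longlonglongrightarrow> 0"
      using tendsto_add[OF tendsto_mult[OF rep_lim[OF s] tendsto_const] 
        tendsto_mult[OF tendsto_const rep_lim[OF t]], of L K] by simp
    show "\<forall>\<^sub>F n in sequentially. norm (IP (s n) (t n) - IP (?s n) (?t n)) 
        \<le> norm (D (s n) (?s n) * L + K * D (t n) (?t n)) * 1"
    proof (rule always_eventually, rule allI)
      fix n
      note F = CS_Fs[OF s, of n] CS_Fs[OF t, of n] CS_Fs[OF rep_CS[OF s], of n] 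
        CS_Fs[OF rep_CS[OF t], of n]
      have "cmod (IP (s n) (t n) - IP (?s n) (?t n)) 
          \<le> D (s n) (?s n) * F.nrm (t n) + F.nrm (?s n) * D (t n) (?t n)"
        by (rule IP_diff) (use F in auto)
      also have "\<dots> \<le> D (s n) (?s n) * L + K * D (t n) (?t n)"
        using K L KL F by (intro add_mono mult_mono) auto
      finally show "norm (IP (s n) (t n) - IP (?s n) (?t n)) 
        \<le> norm (D (s n) (?s n) * L + K * D (t n) (?t n)) * 1" by simp
    qed
  qed
  from tendsto_add[OF this *] show ?thesis by simp
qed

lemma abelian_group_T: "abelian_group T"
proof (rule abelian_groupI)
  fix X Y assume "X \<in> carrier T" "Y \<in> carrier T"
  then obtain s t where st: "s \<in> CS" "t \<in> CS" and e: "X = cls s" "Y = cls t" by (metis T_cases)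
  show "X \<oplus>\<^bsub>T\<^esub> Y \<in> carrier T" 
    unfolding e cls_add[OF st] by (intro cls_in CS_append st)
  show "X \<oplus>\<^bsub>T\<^esub> Y = Y \<oplus>\<^bsub>T\<^esub> X" 
    unfolding e cls_add[OF st] cls_add[OF st(2,1)] 
    by (intro cls_eqI CS_append st) (simp add: IP_append_left)
next
  fix X Y Z assume "X \<in> carrier T" "Y \<in> carrier T" "Z \<in> carrier T"
  then obtain s t u where st: "s \<in> CS" "t \<in> CS" "u \<in> CS" and e: "X = cls s" "Y = cls t" "Z = cls u"
    by (metis T_cases)
  show "X \<oplus>\<^bsub>T\<^esub> Y \<oplus>\<^bsub>T\<^esub> Z = X \<oplus>\<^bsub>T\<^esub> (Y \<oplus>\<^bsub>T\<^esub> Z)" 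
    unfolding e cls_add[OF st(1,2)] cls_add[OF st(2,3)] cls_add[OF CS_append[OF st(1,2)] st(3)] 
      cls_add[OF st(1) CS_append[OF st(2,3)]] by simp
next
  show "\<zero>\<^bsub>T\<^esub> \<in> carrier T" by (simp add: T_zero)
next
  fix X assume "X \<in> carrier T"
  then obtain s where s: "s \<in> CS" and e: "X = cls s" by (metis T_cases)
  show "\<zero>\<^bsub>T\<^esub> \<oplus>\<^bsub>T\<^esub> X = X" unfolding e T_zero cls_add[OF CS_const[OF fsums_Nil] s] by simp
  have "cls (\<lambda>n. fscale (-1) (s n)) \<oplus>\<^bsub>T\<^esub> X = \<zero>\<^bsub>T\<^esub>"
    unfolding e T_zero cls_add[OF CS_fscale[OF s] s]
    by (intro cls_eqI CS_append CS_fscale s CS_const fsums_Nil) 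
       (simp add: IP_append_left IP_fscale CS_Fs[OF s])
  then show "\<exists>Y\<in>carrier T. Y \<oplus>\<^bsub>T\<^esub> X = \<zero>\<^bsub>T\<^esub>" using s CS_fscale cls_in by blast
qed

lemma module_T: "Module.module complex_ring T"
proof (rule moduleI[OF cring_complex_ring abelian_group_T])
  fix c d :: complex and X Y assume "X \<in> carrier T" "Y \<in> carrier T"
  then obtain s t where st: "s \<in> CS" "t \<in> CS" and e: "X = cls s" "Y = cls t" by (metis T_cases)
  show "c \<odot>\<^bsub>T\<^esub> (X \<oplus>\<^bsub>T\<^esub> Y) = c \<odot>\<^bsub>T\<^esub> X \<oplus>\<^bsub>T\<^esub> c \<odot>\<^bsub>T\<^esub> Y"
    
    unfolding e cls_add[OF st] cls_smult[OF st(1)] cls_smult[OF st(2)] cls_smult[OF CS_append[OF st]]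
      cls_add[OF CS_fscale[OF st(1)] CS_fscale[OF st(2)]] by (simp add: fscale_def)
next
  fix c d :: complex and X assume "X \<in> carrier T"
  then obtain s where s: "s \<in> CS" and e: "X = cls s" by (metis T_cases)
  show "c \<odot>\<^bsub>T\<^esub> X \<in> carrier T" unfolding e cls_smult[OF s] by (intro cls_in CS_fscale s)
  show "(c \<oplus>\<^bsub>complex_ring\<^esub> d) \<odot>\<^bsub>T\<^esub> X = c \<odot>\<^bsub>T\<^esub> X \<oplus>\<^bsub>T\<^esub> d \<odot>\<^bsub>T\<^esub> X"
    unfolding e cls_smult[OF s] cls_add[OF CS_fscale[OF s] CS_fscale[OF s]]
    by (intro cls_eqI CS_append CS_fscale s) 
       (simp add: IP_fscale IP_append_left distrib_right CS_Fs[OF s])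
  show "(c \<otimes>\<^bsub>complex_ring\<^esub> d) \<odot>\<^bsub>T\<^esub> X = c \<odot>\<^bsub>T\<^esub> (d \<odot>\<^bsub>T\<^esub> X)"
    unfolding e cls_smult[OF s] cls_smult[OF CS_fscale[OF s]]
    by (intro cls_eqI CS_fscale s) (simp add: IP_fscale CS_Fs[OF s])
  show "\<one>\<^bsub>complex_ring\<^esub> \<odot>\<^bsub>T\<^esub> X = X"
    unfolding e cls_smult[OF s] 
    by (intro cls_eqI CS_fscale s) (simp add: IP_fscale CS_Fs[OF s])
qed

lemma pre_hilbert_T: "pre_hilbert T"
proof (intro pre_hilbert.intro module_T pre_hilbert_axioms.intro)
  fix X Y Z assume "X \<in> carrier T" "Y \<in> carrier T" "Z \<in> carrier T"
  then obtain s t u where st: "s \<in> CS" "t \<in> CS" "u \<in> CS" and e: "X = cls s" "Y = cls t" "Z = cls u"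
    by (metis T_cases)
  have "(\<lambda>n. IP (s n @ t n) (u n)) \<longlonglongrightarrow> hinner T (X \<oplus>\<^bsub>T\<^esub> Y) Z"
    unfolding e cls_add[OF st(1,2)] by (intro IP_conv CS_append st)
  moreover have "(\<lambda>n. IP (s n @ t n) (u n)) \<longlonglongrightarrow> hinner T X Z + hinner T Y Z"
    unfolding e IP_append_left by (intro tendsto_add IP_conv st)
  ultimately show "hinner T (X \<oplus>\<^bsub>T\<^esub> Y) Z = hinner T X Z + hinner T Y Z" by (rule LIMSEQ_unique)
next
  fix X Y c assume "X \<in> carrier T" "Y \<in> carrier T"
  then obtain s t where st: "s \<in> CS" "t \<in> CS" and e: "X = cls s" "Y = cls t" by (metis T_cases)
  have "(\<lambda>n. IP (fscale c (s n)) (t n)) \<longlonglongrightarrow> hinner T (c \<odot>\<^bsub>T\<^esub> X) Y"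
    unfolding e cls_smult[OF st(1)] by (intro IP_conv CS_fscale st)
  moreover have "(\<lambda>n. c * IP (s n) (t n)) \<longlonglongrightarrow> c * hinner T X Y"
    unfolding e by (intro tendsto_mult tendsto_const IP_conv st)
  moreover have "IP (fscale c (s n)) (t n) = c * IP (s n) (t n)" for n
    using st CS_Fs IP_fscale by blast
  ultimately show "hinner T (c \<odot>\<^bsub>T\<^esub> X) Y = c * hinner T X Y" 
    by (auto intro: LIMSEQ_unique)
  have "(\<lambda>n. cnj (IP (s n) (t n))) \<longlonglongrightarrow> cnj (hinner T X Y)"
    unfolding e by (intro tendsto_cnj IP_conv st)
  moreover have "(\<lambda>n. IP (t n) (s n)) \<longlonglongrightarrow> hinner T Y X"
    unfolding e by (intro IP_conv st)
  moreover have "IP (t n) (s n) = cnj (IP (s n) (t n))" for n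
    using st CS_Fs IP_commute by blast
  ultimately show "hinner T Y X = cnj (hinner T X Y)" by (auto intro: LIMSEQ_unique)
next
  fix X assume "X \<in> carrier T"
  then obtain s where s: "s \<in> CS" and e: "X = cls s" by (metis T_cases)
  have lim: "(\<lambda>n. Re (IP (s n) (s n))) \<longlonglongrightarrow> Re (hinner T X X)"
    unfolding e by (intro tendsto_Re IP_conv s)
  show "0 \<le> Re (hinner T X X)"
    by (rule LIMSEQ_le_const[OF lim]) (use s CS_Fs F.nonneg in blast)
  assume "hinner T X X = 0"
  then have "(\<lambda>n. sqrt (Re (IP (s n) (s n)))) \<longlonglongrightarrow> sqrt 0" using lim by (intro tendsto_real_sqrt) simp
  then have "(\<lambda>n. D (s n) []) \<longlonglongrightarrow> 0" by (simp add: D_eq F.nrm_def fneg_def)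
  then show "X = \<zero>\<^bsub>T\<^esub>" using s by (simp add: e T_zero cls_eq_iff)
qed

sublocale T: pre_hilbert T by (rule pre_hilbert_T)

lemma hnorm_cls: "s \<in> CS \<Longrightarrow> (\<lambda>n. F.nrm (s n)) \<longlonglongrightarrow> hnorm T (cls s)"
  unfolding F.nrm_def hnorm_def by (intro tendsto_real_sqrt tendsto_Re IP_conv)

lemma hnorm_cls_const: "u \<in> Fs \<Longrightarrow> hnorm T (cls (\<lambda>n. u)) = F.nrm u"
  using hnorm_cls[of "\<lambda>n. u"] by (simp add: LIMSEQ_const_iff)

lemma htens_in: "\<lbrakk>x \<in> carrier M; y \<in> carrier N\<rbrakk> \<Longrightarrow> htens M N x y \<in> carrier T"
  by (simp add: htens_def)

lemma hnorm_htens: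
  "\<lbrakk>x \<in> carrier M; y \<in> carrier N\<rbrakk> \<Longrightarrow> hnorm T (htens M N x y) = hnorm M x * hnorm N y"
proof -
  assume xy: "x \<in> carrier M" "y \<in> carrier N"
  have "Re (hinner M x x * hinner N y y) = Re (hinner M x x) * Re (hinner N y y)"
    using M.SI.self_real[OF xy(1)] N.SI.self_real[OF xy(2)] by (metis Re_complex_of_real of_real_mult)
  then show ?thesis unfolding htens_def using xy
    by (subst hnorm_cls_const) 
      (simp_all add: F.nrm_def fsum_inner_def hnorm_def real_sqrt_mult del: times_complex.sel)
qed

lemma IP_pair: "IP [(x, y)] w = (\<Sum>(x', y')\<leftarrow>w. hinner M x x' * hinner N y y')"
  by (simp add: fsum_inner_def)

lemma htens_add_left:
  assumes "x \<in> carrier M" "x' \<in> carrier M" "y \<in> carrier N"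
  shows "htens M N (x \<oplus>\<^bsub>M\<^esub> x') y = htens M N x y \<oplus>\<^bsub>T\<^esub> htens M N x' y"
proof -
  have "IP [(x \<oplus>\<^bsub>M\<^esub> x', y)] w = IP ([(x, y)] @ [(x', y)]) w" if "w \<in> Fs" for w
    using that unfolding IP_append_left IP_pair 
    by (induction w) (use assms in \<open>auto simp: M.hinner_add_left algebra_simps\<close>)
  then show ?thesis unfolding htens_def using assms
    by (subst cls_add, simp, simp, intro cls_eqI CS_append) (simp_all)
qed

lemma htens_add_right:
  assumes "x \<in> carrier M" "y \<in> carrier N" "y' \<in> carrier N"
  shows "htens M N x (y \<oplus>\<^bsub>N\<^esub> y') = htens M N x y \<oplus>\<^bsub>T\<^esub> htens M N x y'"
proof -
  have "IP [(x, y \<oplus>\<^bsub>N\<^esub> y')] w = IP ([(x, y)] @ [(x, y')]) w" if "w \<in> Fs" for w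
    using that unfolding IP_append_left IP_pair 
    by (induction w) (use assms in \<open>auto simp: N.hinner_add_left algebra_simps\<close>)
  then show ?thesis unfolding htens_def using assms
    by (subst cls_add, simp, simp, intro cls_eqI CS_append) (simp_all)
qed

lemma htens_smult_left:
  assumes "x \<in> carrier M" "y \<in> carrier N"
  shows "htens M N (c \<odot>\<^bsub>M\<^esub> x) y = c \<odot>\<^bsub>T\<^esub> htens M N x y"
  unfolding htens_def using assms by (subst cls_smult) (auto simp: fscale_def)

lemma htens_smult_right:
  assumes "x \<in> carrier M" "y \<in> carrier N"
  shows "htens M N x (c \<odot>\<^bsub>N\<^esub> y) = c \<odot>\<^bsub>T\<^esub> htens M N x y"
proof -
  have "IP [(x, c \<odot>\<^bsub>N\<^esub> y)] w = IP [(c \<odot>\<^bsub>M\<^esub> x, y)] w" if "w \<in> Fs" for w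
    using that unfolding IP_pair 
    by (induction w) (use assms in \<open>auto simp: N.hinner_smult_left M.hinner_smult_left algebra_simps\<close>)
  then have "htens M N x (c \<odot>\<^bsub>N\<^esub> y) = htens M N (c \<odot>\<^bsub>M\<^esub> x) y" 
    unfolding htens_def using assms by (intro cls_eqI) simp_all
  then show ?thesis using htens_smult_left[OF assms] by simp
qed

end

section \<open>Restriction of scalars and the algebra of a bounded domain\<close>

lemma underlying_simps:
  "carrier (underlying \<Omega> M) = carrier M" "add (underlying \<Omega> M) = add M"
  "zero (underlying \<Omega> M) = zero M" "hinner (underlying \<Omega> M) = hinner M"
  "smult (underlying \<Omega> M) = (\<lambda>c x. A_const \<Omega> c \<odot>\<^bsub>M\<^esub> x)"
  by (simp_all add: underlying_def)

lemma underlying_derived: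
  "a_inv (underlying \<Omega> M) = a_inv M" "a_minus (underlying \<Omega> M) = a_minus M"
  "hnorm (underlying \<Omega> M) = hnorm M" "hdist (underlying \<Omega> M) = hdist M"
  "htop (underlying \<Omega> M) = htop M" "finsum (underlying \<Omega> M) = finsum M"
proof -
  show 1: "a_inv (underlying \<Omega> M) = a_inv M" 
    by (rule ext) (simp add: a_inv_def m_inv_def underlying_simps)
  show 2: "a_minus (underlying \<Omega> M) = a_minus M" 
    by (intro ext) (simp add: a_minus_def underlying_simps 1)
  show 3: "hnorm (underlying \<Omega> M) = hnorm M" by (rule ext) (simp add: hnorm_def underlying_simps)
  show 4: "hdist (underlying \<Omega> M) = hdist M"
    by (intro ext) (simp add: hdist_def underlying_simps 2 3)
  show "htop (underlying \<Omega> M) = htop M" by (simp add: htop_def 4 underlying_simps)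
  show "finsum (underlying \<Omega> M) = finsum M" 
    by (intro ext) (simp add: finsum_def finprod_def underlying_simps)
qed

lemmas underlying_all = underlying_simps underlying_derived

lemma A_alg_simps [simp]:
  "carrier (A_alg \<Omega>) = A_carrier \<Omega>"
  "one (A_alg \<Omega>) = A_const \<Omega> 1" "zero (A_alg \<Omega>) = A_const \<Omega> 0"
  by (simp_all add: A_alg_def)

lemma A_alg_eval:
  "z \<in> closure \<Omega> \<Longrightarrow> (\<phi> \<otimes>\<^bsub>A_alg \<Omega>\<^esub> \<psi>) z = \<phi> z * \<psi> z"
  "z \<in> closure \<Omega> \<Longrightarrow> (\<phi> \<oplus>\<^bsub>A_alg \<Omega>\<^esub> \<psi>) z = \<phi> z + \<psi> z"
  "z \<in> closure \<Omega> \<Longrightarrow> A_const \<Omega> c z = c"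
  by (simp_all add: A_alg_def A_const_def)

lemma in_closure: "z \<in> \<Omega> \<Longrightarrow> z \<in> closure \<Omega>" using closure_subset by blast

definition A_norm :: "(complex ^ 'm) set \<Rightarrow> (complex ^ 'm \<Rightarrow> complex) \<Rightarrow> real" where
  "A_norm \<Omega> \<phi> = (SUP z\<in>\<Omega>. cmod (\<phi> z))"

locale bounded_domain =
  fixes \<Omega> :: "(complex ^ 'm) set"
  assumes bounded_dom: "bounded \<Omega>" and nonempty_dom: "\<Omega> \<noteq> {}"
begin

lemma compact_closure: "compact (closure \<Omega>)" using bounded_dom by (simp add: compact_closure)

lemma A_ext: "\<phi> \<in> A_carrier \<Omega> \<Longrightarrow> \<phi> \<in> extensional (closure \<Omega>)"
  by (simp add: A_carrier_def)

lemma A_continuous: "\<phi> \<in> A_carrier \<Omega> \<Longrightarrow> continuous_on (closure \<Omega>) \<phi>"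
  by (simp add: A_carrier_def)

lemma A_continuous_diff: 
  "\<lbrakk>\<phi> \<in> A_carrier \<Omega>; \<psi> \<in> A_carrier \<Omega>\<rbrakk> \<Longrightarrow> continuous_on (closure \<Omega>) (\<lambda>z. \<phi> z - \<psi> z)"
  by (intro continuous_on_diff A_continuous)

lemma bdd_above_cont: "continuous_on (closure \<Omega>) f \<Longrightarrow> bdd_above ((\<lambda>z. cmod (f z)) ` \<Omega>)"
proof -
  assume "continuous_on (closure \<Omega>) f"
  then have "compact ((\<lambda>z. cmod (f z)) ` closure \<Omega>)"
    by (intro compact_continuous_image compact_closure continuous_intros)
  then have "bdd_above ((\<lambda>z. cmod (f z)) ` closure \<Omega>)"
    by (simp add: compact_imp_bounded bounded_imp_bdd_above)
  then show ?thesis by (rule bdd_above_mono) (use closure_subset in blast)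
qed

lemma norm_le_A_norm: "\<phi> \<in> A_carrier \<Omega> \<Longrightarrow> z \<in> \<Omega> \<Longrightarrow> cmod (\<phi> z) \<le> A_norm \<Omega> \<phi>"
  unfolding A_norm_def by (rule cSUP_upper) (auto intro: bdd_above_cont A_continuous)

lemma A_norm_le: "(\<And>z. z \<in> \<Omega> \<Longrightarrow> cmod (\<phi> z) \<le> b) \<Longrightarrow> A_norm \<Omega> \<phi> \<le> b"
  unfolding A_norm_def by (rule cSUP_least) (use nonempty_dom in auto)

lemma A_norm_nonneg: "\<phi> \<in> A_carrier \<Omega> \<Longrightarrow> 0 \<le> A_norm \<Omega> \<phi>"
  using norm_le_A_norm nonempty_dom by (meson all_not_in_conv norm_ge_zero order_trans)

lemma A_const_in: "A_const \<Omega> c \<in> A_carrier \<Omega>"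
proof -
  have "holomorphic_Cn (\<lambda>_. c) (UNIV :: (complex ^ 'm) set)"
    unfolding holomorphic_Cn_def by (auto intro!: exI[of _ "\<lambda>_. 0"])
  moreover have "continuous_on (closure \<Omega>) (\<lambda>z\<in>closure \<Omega>. c)"
    by (rule continuous_on_eq[of _ "\<lambda>_. c"]) auto
  ultimately show ?thesis
    unfolding A_carrier_def A_const_def
    by (auto intro!: exI[of _ UNIV] exI[of _ "\<lambda>_. c"] simp: restrict_def extensional_def in_closure)
qed

lemma A_dist_le: 
  "\<lbrakk>\<phi> \<in> A_carrier \<Omega>; \<psi> \<in> A_carrier \<Omega>; \<And>z. z \<in> \<Omega> \<Longrightarrow> cmod (\<phi> z - \<psi> z) \<le> b\<rbrakk> \<Longrightarrow> A_dist \<Omega> \<phi> \<psi> \<le> b"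
  unfolding A_dist_def using nonempty_dom by (auto intro!: cSUP_least)

lemma le_A_dist:
  "\<lbrakk>\<phi> \<in> A_carrier \<Omega>; \<psi> \<in> A_carrier \<Omega>; z \<in> \<Omega>\<rbrakk> \<Longrightarrow> cmod (\<phi> z - \<psi> z) \<le> A_dist \<Omega> \<phi> \<psi>"
  unfolding A_dist_def
  by (auto intro!: cSUP_upper2[of _ _ z] bdd_above_cont A_continuous_diff)

lemma A_eqI:
  assumes "\<phi> \<in> A_carrier \<Omega>" "\<psi> \<in> A_carrier \<Omega>" "\<And>z. z \<in> \<Omega> \<Longrightarrow> \<phi> z = \<psi> z"
  shows "\<phi> = \<psi>"
proof (rule extensionalityI[OF A_ext A_ext])
  fix z assume z: "z \<in> closure \<Omega>"
  have "(\<lambda>z. \<phi> z - \<psi> z) z = 0"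
    by (rule continuous_constant_on_closure[of \<Omega>])
       (use assms z in \<open>auto intro!: A_continuous_diff\<close>)
  then show "\<phi> z = \<psi> z" by simp
qed (use assms in auto)

lemma A_metric: "Metric_space (A_carrier \<Omega>) (A_dist \<Omega>)"
proof
  obtain z0 where z0: "z0 \<in> \<Omega>" using nonempty_dom by auto
  show nn: "0 \<le> A_dist \<Omega> \<phi> \<psi>" for \<phi> \<psi>
  proof (cases "\<phi> \<in> A_carrier \<Omega> \<and> \<psi> \<in> A_carrier \<Omega>")
    case True
    then show ?thesis using le_A_dist[of \<phi> \<psi> z0] z0 norm_ge_zero order_trans by blast
  qed (auto simp: A_dist_def)
  show "A_dist \<Omega> \<phi> \<psi> = A_dist \<Omega> \<psi> \<phi>" for \<phi> \<psi>
    by (simp add: A_dist_def norm_minus_commute)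
  show "(A_dist \<Omega> \<phi> \<psi> = 0) = (\<phi> = \<psi>)" if "\<phi> \<in> A_carrier \<Omega>" "\<psi> \<in> A_carrier \<Omega>" for \<phi> \<psi>
  proof
    assume "A_dist \<Omega> \<phi> \<psi> = 0"
    then show "\<phi> = \<psi>" using that le_A_dist[OF that] by (intro A_eqI) auto
  next
    assume "\<phi> = \<psi>" then show "A_dist \<Omega> \<phi> \<psi> = 0" 
      using that nn[of \<phi> \<psi>] A_dist_le[OF that, of 0] by auto
  qed
  show "A_dist \<Omega> \<phi> \<rho> \<le> A_dist \<Omega> \<phi> \<psi> + A_dist \<Omega> \<psi> \<rho>" 
    if *: "\<phi> \<in> A_carrier \<Omega>" "\<psi> \<in> A_carrier \<Omega>" "\<rho> \<in> A_carrier \<Omega>" for \<phi> \<psi> \<rho>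
  proof (rule A_dist_le)
    fix z assume "z \<in> \<Omega>"
    then show "cmod (\<phi> z - \<rho> z) \<le> A_dist \<Omega> \<phi> \<psi> + A_dist \<Omega> \<psi> \<rho>"
      using le_A_dist[OF *(1,2)] le_A_dist[OF *(2,3)] 
        norm_triangle_ineq[of "\<phi> z - \<psi> z" "\<psi> z - \<rho> z"] by fastforce
  qed (use * in auto)
qed

text \<open>
  A function is described by rational values on a finite \<open>1 / (n + 1)\<close>-net, up to \<open>1 / (l + 1)\<close>. There are
  countably many descriptions, by uniform continuity every function has descriptions with \<open>l\<close> as large as
  desired, and two functions with the same description are close. One function is kept for each
  description that fits any.
\<close>

lemma A_separable:
  "\<exists>D. countable D \<and> D \<subseteq> A_carrier \<Omega> \<and> (\<forall>\<phi>\<in>A_carrier \<Omega>. \<forall>e>0. \<exists>\<psi>\<in>D. A_dist \<Omega> \<phi> \<psi> < e)"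
proof -
  have "\<exists>k. finite k \<and> closure \<Omega> \<subseteq> (\<Union>c\<in>k. ball c (1 / Suc n))" for n
    using compact_closure[unfolded compact_eq_totally_bounded] 
    by (auto elim!: allE[of _ "1 / real (Suc n)"])
  then obtain K where K: "\<And>n. finite (K n)" "\<And>n. closure \<Omega> \<subseteq> (\<Union>c\<in>K n. ball c (1 / Suc n))"
    by metis
  obtain Q :: "complex set" where Q: "countable Q" 
    "\<And>X. open X \<Longrightarrow> X \<noteq> {} \<Longrightarrow> \<exists>d\<in>Q. d \<in> X"
    using countable_dense_setE by blast
  \<comment> \<open>\<open>q\<close> describes the function \<open>\<phi>\<close> on the net \<open>K n\<close> up to \<open>1 / Suc l\<close>\<close>
  define good where "good n l q \<phi> \<longleftrightarrow> \<phi> \<in> A_carrier \<Omega> \<and> 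
    (\<forall>c\<in>K n. \<forall>z\<in>\<Omega>. dist z c < 1 / Suc n \<longrightarrow> cmod (\<phi> z - q c) \<le> 1 / Suc l)" 
    for n l :: nat and q :: "complex ^ 'm \<Rightarrow> complex" and \<phi>
  define I where "I = Sigma UNIV (\<lambda>(n, l :: nat). K n \<rightarrow>\<^sub>E Q)"
  have "countable I"
    unfolding I_def using K Q by (intro countable_SIGMA) (auto intro!: countable_PiE)
  define pick where "pick = (\<lambda>((n, l), q). SOME \<phi>. good n l q \<phi>)"
  define D where "D = pick ` I \<inter> A_carrier \<Omega>"
  have "\<exists>\<psi>\<in>D. A_dist \<Omega> \<phi> \<psi> < e" if \<phi>: "\<phi> \<in> A_carrier \<Omega>" and e: "e > 0" for \<phi> and e :: real
  proof -
    obtain l :: nat where l: "1 / Suc l < e / 2" using e by (metis half_gt_zero nat_approx_posE)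
    let ?r = "1 / real (Suc l) / 3"
    have "uniformly_continuous_on (closure \<Omega>) \<phi>"
      by (rule compact_uniformly_continuous[OF A_continuous[OF \<phi>] compact_closure])
    moreover have "?r > 0" by simp
    ultimately obtain d where d: "d > 0" 
      "\<And>x y. x \<in> closure \<Omega> \<Longrightarrow> y \<in> closure \<Omega> \<Longrightarrow> dist y x < d \<Longrightarrow> dist (\<phi> y) (\<phi> x) < ?r"
      unfolding uniformly_continuous_on_def by metis
    obtain n :: nat where n: "1 / Suc n < d / 2" using d by (metis half_gt_zero nat_approx_posE)
    have "\<exists>v\<in>Q. \<forall>z\<in>\<Omega>. dist z c < 1 / Suc n \<longrightarrow> cmod (\<phi> z - v) \<le> 1 / Suc l" for c
    proof (cases "\<exists>w\<in>\<Omega>. dist w c < 1 / Suc n")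
      case True
      then obtain w where w: "w \<in> \<Omega>" "dist w c < 1 / Suc n" by auto
      obtain v where v: "v \<in> Q" "v \<in> ball (\<phi> w) ?r" using Q(2)[of "ball (\<phi> w) ?r"] by auto
      have "cmod (\<phi> z - v) \<le> 1 / Suc l" if z: "z \<in> \<Omega>" "dist z c < 1 / Suc n" for z
      proof -
        have "dist z w < d" using dist_triangle2[of z w c] z w n by linarith
        then have "dist (\<phi> z) (\<phi> w) < ?r" using d(2) z w in_closure by blast
        moreover have "dist (\<phi> w) v < ?r" using v by simp
        ultimately have "dist (\<phi> z) v \<le> ?r + ?r" using dist_triangle[of "\<phi> z" v "\<phi> w"] by linarith
        also have "\<dots> \<le> 1 / Suc l" by (simp add: field_simps)
        finally show ?thesis by (simp add: dist_norm)
      qed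
      then show ?thesis using v by blast
    next
      case False
      then show ?thesis using Q(2)[of UNIV] by auto
    qed
    then obtain q where q: "\<And>c. q c \<in> Q" 
      "\<And>c z. z \<in> \<Omega> \<Longrightarrow> dist z c < 1 / Suc n \<Longrightarrow> cmod (\<phi> z - q c) \<le> 1 / Suc l" by metis
    let ?q = "restrict q (K n)"
    have g: "good n l ?q \<phi>" using q \<phi> by (auto simp: good_def)
    define \<psi> where "\<psi> = pick ((n, l), ?q)"
    have \<psi>: "good n l ?q \<psi>" unfolding \<psi>_def pick_def using g by (simp add: someI)
    have "((n, l), ?q) \<in> I" unfolding I_def using q by auto
    then have "\<psi> \<in> D" using \<psi> unfolding D_def \<psi>_def good_def by blast
    moreover have "A_dist \<Omega> \<phi> \<psi> \<le> 1 / Suc l + 1 / Suc l"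
    proof (rule A_dist_le[OF \<phi>])
      show "\<psi> \<in> A_carrier \<Omega>" using \<psi> by (simp add: good_def)
      fix z assume z: "z \<in> \<Omega>"
      then obtain c where c: "c \<in> K n" "dist z c < 1 / Suc n" 
        using K(2)[of n] in_closure[OF z] by (auto simp: dist_commute)
      have "cmod (\<phi> z - ?q c) \<le> 1 / Suc l" "cmod (\<psi> z - ?q c) \<le> 1 / Suc l"
        using g \<psi> c z by (auto simp: good_def)
      then show "cmod (\<phi> z - \<psi> z) \<le> 1 / Suc l + 1 / Suc l"
        using dist_triangle2[of "\<phi> z" "\<psi> z" "?q c"] by (simp add: dist_norm)
    qed
    ultimately show ?thesis using l by (intro bexI[of _ \<psi>]) auto
  qed
  moreover have "countable D" using \<open>countable I\<close> unfolding D_def by blast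
  ultimately show ?thesis by (intro exI[of _ D]) (auto simp: D_def)
qed

end

text \<open>
  That \<open>\<A>(\<Omega>)\<close> is a ring is part of the definition of a module over it, and is taken from there.
\<close>

locale A_ring = bounded_domain \<Omega> + A: cring "A_alg \<Omega>" for \<Omega> :: "(complex ^ 'm) set"
begin

lemma A_uminus_eval: 
  assumes "\<phi> \<in> A_carrier \<Omega>" "z \<in> closure \<Omega>" shows "(\<ominus>\<^bsub>A_alg \<Omega>\<^esub> \<phi>) z = - \<phi> z"
proof -
  have "\<phi> \<oplus>\<^bsub>A_alg \<Omega>\<^esub> (\<ominus>\<^bsub>A_alg \<Omega>\<^esub> \<phi>) = A_const \<Omega> 0" using A.r_neg[of \<phi>] assms by simp
  then have "\<phi> z + (\<ominus>\<^bsub>A_alg \<Omega>\<^esub> \<phi>) z = 0" using assms A_alg_eval by metis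
  then show ?thesis by (simp add: add_eq_0_iff)
qed

lemma A_minus_eval: 
  "\<lbrakk>\<phi> \<in> A_carrier \<Omega>; \<psi> \<in> A_carrier \<Omega>; z \<in> closure \<Omega>\<rbrakk> \<Longrightarrow> (\<phi> \<ominus>\<^bsub>A_alg \<Omega>\<^esub> \<psi>) z = \<phi> z - \<psi> z"
  by (simp add: a_minus_def A_alg_eval A_uminus_eval)

lemma A_closed [simp, intro]: 
  "\<phi> \<in> A_carrier \<Omega> \<Longrightarrow> \<ominus>\<^bsub>A_alg \<Omega>\<^esub> \<phi> \<in> A_carrier \<Omega>"
  "\<lbrakk>\<phi> \<in> A_carrier \<Omega>; \<psi> \<in> A_carrier \<Omega>\<rbrakk> \<Longrightarrow> \<phi> \<ominus>\<^bsub>A_alg \<Omega>\<^esub> \<psi> \<in> A_carrier \<Omega>"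
  "\<lbrakk>\<phi> \<in> A_carrier \<Omega>; \<psi> \<in> A_carrier \<Omega>\<rbrakk> \<Longrightarrow> \<phi> \<oplus>\<^bsub>A_alg \<Omega>\<^esub> \<psi> \<in> A_carrier \<Omega>"
  "\<lbrakk>\<phi> \<in> A_carrier \<Omega>; \<psi> \<in> A_carrier \<Omega>\<rbrakk> \<Longrightarrow> \<phi> \<otimes>\<^bsub>A_alg \<Omega>\<^esub> \<psi> \<in> A_carrier \<Omega>"
  using A.a_inv_closed[of \<phi>] A.minus_closed[of \<phi> \<psi>] A.add.m_closed[of \<phi> \<psi>] A.m_closed[of \<phi> \<psi>] by simp_all

lemma A_dist_eq: 
  "\<lbrakk>\<phi> \<in> A_carrier \<Omega>; \<psi> \<in> A_carrier \<Omega>\<rbrakk> \<Longrightarrow> A_dist \<Omega> \<phi> \<psi> = A_norm \<Omega> (\<phi> \<ominus>\<^bsub>A_alg \<Omega>\<^esub> \<psi>)"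
  unfolding A_dist_def A_norm_def by (auto intro!: SUP_cong simp: A_minus_eval in_closure)

lemma A_norm_scale_le:
  "\<phi> \<in> A_carrier \<Omega> \<Longrightarrow> A_norm \<Omega> (A_const \<Omega> c \<otimes>\<^bsub>A_alg \<Omega>\<^esub> \<phi>) \<le> cmod c * A_norm \<Omega> \<phi>"
  by (rule A_norm_le) (auto simp: A_alg_eval in_closure norm_mult intro!: mult_left_mono norm_le_A_norm)

lemma A_const_mult: "A_const \<Omega> c \<otimes>\<^bsub>A_alg \<Omega>\<^esub> A_const \<Omega> d = A_const \<Omega> (c * d)"
  by (rule A_eqI) (auto simp: A_alg_eval in_closure A_const_in)

lemma A_const_add: "A_const \<Omega> c \<oplus>\<^bsub>A_alg \<Omega>\<^esub> A_const \<Omega> d = A_const \<Omega> (c + d)"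
  by (rule A_eqI) (auto simp: A_alg_eval in_closure A_const_in)

lemma module_underlying:
  assumes "Module.module (A_alg \<Omega>) M" shows "Module.module complex_ring (underlying \<Omega> M)"
proof -
  interpret Module.module "A_alg \<Omega>" M by fact
  have "abelian_group (underlying \<Omega> M)"
  proof (rule abelian_groupI)
    show "\<exists>y\<in>carrier (underlying \<Omega> M). y \<oplus>\<^bsub>underlying \<Omega> M\<^esub> x = \<zero>\<^bsub>underlying \<Omega> M\<^esub>" 
      if "x \<in> carrier (underlying \<Omega> M)" for x
      using that by (intro bexI[of _ "\<ominus>\<^bsub>M\<^esub> x"]) (auto simp: underlying_all M.l_neg)
  qed (auto simp: underlying_all M.a_assoc intro: M.a_comm)
  then show ?thesis
    by (intro moduleI cring_complex_ring)
       (auto simp: underlying_all A_const_in smult_r_distr smult_l_distr[symmetric] smult_assoc1[symmetric]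
          A_const_mult A_const_add smult_one[simplified])
qed

end

section \<open>Hilbert modules and their closed submodules\<close>

lemma restrict_simps:
  "hnorm (M\<lparr>carrier := K\<rparr>) = hnorm M" "underlying \<Omega> (M\<lparr>carrier := K\<rparr>) = (underlying \<Omega> M)\<lparr>carrier := K\<rparr>"
  by (simp_all add: hnorm_def fun_eq_iff underlying_def)

locale pre_hilb_module = bounded_domain \<Omega> for \<Omega> :: "(complex ^ 'm) set" +
  fixes M :: "('m, 'a) hmod" (structure)
  assumes A_module: "Module.module (A_alg \<Omega>) M" and pre_hilbert_und: "pre_hilbert (underlying \<Omega> M)"
begin

sublocale mod: Module.module "A_alg \<Omega>" M by (rule A_module)

sublocale A_ring \<Omega> ..

sublocale H: pre_hilbert "underlying \<Omega> M"
  rewrites "carrier (underlying \<Omega> M) = carrier M" and "add (underlying \<Omega> M) = add M"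
    and "zero (underlying \<Omega> M) = zero M" and "hinner (underlying \<Omega> M) = hinner M"
    and "smult (underlying \<Omega> M) = (\<lambda>c x. A_const \<Omega> c \<odot> x)"
    and "a_inv (underlying \<Omega> M) = a_inv M" and "a_minus (underlying \<Omega> M) = a_minus M"
    and "hnorm (underlying \<Omega> M) = hnorm M" and "hdist (underlying \<Omega> M) = hdist M"
    and "htop (underlying \<Omega> M) = htop M" and "finsum (underlying \<Omega> M) = finsum M"
  using pre_hilbert_und by (auto simp: underlying_all)

lemma action_closed: "\<phi> \<in> A_carrier \<Omega> \<Longrightarrow> x \<in> carrier M \<Longrightarrow> \<phi> \<odot> x \<in> carrier M"
  using mod.smult_closed by simp

lemma action_minus_right: 
  "\<lbrakk>\<phi> \<in> A_carrier \<Omega>; x \<in> carrier M; y \<in> carrier M\<rbrakk> \<Longrightarrow> 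
    \<phi> \<odot> (x \<ominus> y) = \<phi> \<odot> x \<ominus> \<phi> \<odot> y"
  by (simp add: a_minus_def mod.smult_r_distr mod.smult_r_minus)

lemma action_minus_left: 
  "\<lbrakk>\<phi> \<in> A_carrier \<Omega>; \<psi> \<in> A_carrier \<Omega>; x \<in> carrier M\<rbrakk> \<Longrightarrow> 
    (\<phi> \<ominus>\<^bsub>A_alg \<Omega>\<^esub> \<psi>) \<odot> x = \<phi> \<odot> x \<ominus> \<psi> \<odot> x"
  by (simp add: a_minus_def mod.smult_l_distr mod.smult_l_minus)

lemma action_commute_const:
  assumes "\<phi> \<in> A_carrier \<Omega>" "x \<in> carrier M"
  shows "\<phi> \<odot> (A_const \<Omega> c \<odot> x) = A_const \<Omega> c \<odot> (\<phi> \<odot> x)"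
  using assms A_const_in[of c] mod.smult_assoc1[of \<phi> "A_const \<Omega> c" x] 
    mod.smult_assoc1[of "A_const \<Omega> c" \<phi> x] mod.R.m_comm[of \<phi> "A_const \<Omega> c"] by simp



lemma submoduleD:
  assumes "submodule K (A_alg \<Omega>) M"
  shows "K \<subseteq> carrier M" "\<zero> \<in> K" "x \<in> K \<Longrightarrow> \<ominus> x \<in> K" "x \<in> K \<Longrightarrow> y \<in> K \<Longrightarrow> x \<oplus> y \<in> K"
    "\<phi> \<in> A_carrier \<Omega> \<Longrightarrow> x \<in> K \<Longrightarrow> \<phi> \<odot> x \<in> K" "x \<in> K \<Longrightarrow> y \<in> K \<Longrightarrow> x \<ominus> y \<in> K"
  using mod.submoduleE[OF assms] subgroup.one_closed[OF submodule.axioms(1)[OF assms]] 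
  by (auto simp: a_minus_def)

lemma restrict_a_inv:
  assumes "submodule K (A_alg \<Omega>) M" "x \<in> K" shows "\<ominus>\<^bsub>M\<lparr>carrier := K\<rparr>\<^esub> x = \<ominus> x"
proof -
  interpret K: Module.module "A_alg \<Omega>" "M\<lparr>carrier := K\<rparr>" 
    by (rule submodule.submodule_is_module[OF assms(1) mod.module_axioms])
  show ?thesis
    using submoduleD[OF assms(1)] assms(2) K.minus_equality[of "\<ominus> x" x] 
    by (auto simp: mod.M.l_neg)
qed

lemma restrict_minus:
  "submodule K (A_alg \<Omega>) M \<Longrightarrow> y \<in> K \<Longrightarrow> x \<ominus>\<^bsub>M\<lparr>carrier := K\<rparr>\<^esub> y = x \<ominus> y"
  by (simp add: a_minus_def restrict_a_inv)

lemma restrict_pre_hilbert: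
  assumes K: "submodule K (A_alg \<Omega>) M"
  shows "pre_hilbert (underlying \<Omega> (M\<lparr>carrier := K\<rparr>))"
proof -
  have sub: "K \<subseteq> carrier M" using submoduleD[OF K] by auto
  show ?thesis
  proof (intro pre_hilbert.intro pre_hilbert_axioms.intro)
    show "Module.module complex_ring (underlying \<Omega> (M\<lparr>carrier := K\<rparr>))"
      by (rule module_underlying[OF submodule.submodule_is_module[OF K mod.module_axioms]])
  qed (use sub in \<open>auto simp: underlying_all H.hinner_add_left H.hinner_smult_left H.hinner_nonneg subset_iff
        intro: H.hinner_commute H.hinner_definite\<close>)
qed

end

locale hilb_module = bounded_domain \<Omega> for \<Omega> :: "(complex ^ 'm) set" +
  fixes M :: "('m, 'a) hmod" (structure)
  assumes hilbert_module: "hilbert_module \<Omega> M"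

sublocale hilb_module \<subseteq> pre_hilb_module
  by (intro pre_hilb_module.intro bounded_domain_axioms pre_hilb_module_axioms.intro)
     (use hilbert_module hilbert_space.pre_hilbert in \<open>auto simp: hilbert_module_def\<close>)

context hilb_module begin

lemma complete: "H.MS.mcomplete"
  using hilbert_module by (simp add: hilbert_module_def hilbert_space_iff underlying_all)

text \<open>
  Continuity at the origin gives balls of radii \<open>a\<close> and \<open>b\<close> whose products have norm less than 1. Scaling
  both factors to half these radii gives the bound \<open>4 / (a * b)\<close>.
\<close>

lemma action_bound:
  obtains C where "C \<ge> 0" 
    "\<And>\<phi> x. \<phi> \<in> A_carrier \<Omega> \<Longrightarrow> x \<in> carrier M \<Longrightarrow> hnorm M (\<phi> \<odot> x) \<le> C * A_norm \<Omega> \<phi> * hnorm M x"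
proof -
  interpret AM: Metric_space "A_carrier \<Omega>" "A_dist \<Omega>" by (rule A_metric)
  let ?f = "\<lambda>(\<phi>, x). \<phi> \<odot> x" and ?o = "A_const \<Omega> 0"
  have cont: "continuous_map (prod_topology AM.mtopology H.MS.mtopology) H.MS.mtopology ?f"
    using hilbert_module by (simp add: hilbert_module_def A_top_def htop_def)
  let ?S = "{p \<in> topspace (prod_topology AM.mtopology H.MS.mtopology). ?f p \<in> H.MS.mball \<zero> 1}"
  have S: "openin (prod_topology AM.mtopology H.MS.mtopology) ?S"
    using cont by (rule openin_continuous_map_preimage) simp
  have o: "?o \<in> A_carrier \<Omega>" by (rule A_const_in)
  have "?o \<odot> \<zero> = \<zero>" using mod.smult_l_null[of "\<zero>"] by simp
  then have "(?o, \<zero>) \<in> ?S" using o by (simp add: hdist_def a_minus_def)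
  then obtain U V where U: "openin AM.mtopology U" "?o \<in> U" 
    and V: "openin H.MS.mtopology V" "\<zero> \<in> V" and UV: "U \<times> V \<subseteq> ?S"
    using S unfolding openin_prod_topology_alt by meson
  obtain a where a: "a > 0" "AM.mball ?o a \<subseteq> U" using U AM.openin_mtopology by auto
  obtain b where b: "b > 0" "H.MS.mball \<zero> b \<subseteq> V" using V H.MS.openin_mtopology by auto
  have small: "hnorm M (\<phi> \<odot> x) < 1" 
    if "\<phi> \<in> A_carrier \<Omega>" "x \<in> carrier M" "A_norm \<Omega> \<phi> < a" "hnorm M x < b" for \<phi> x
  proof -
    have "A_dist \<Omega> ?o \<phi> \<le> A_norm \<Omega> \<phi>"
      by (rule A_dist_le) (use that o norm_le_A_norm in \<open>auto simp: A_alg_eval in_closure\<close>)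
    moreover have "hdist M \<zero> x = hnorm M x" using that by (simp add: hdist_def a_minus_def)
    ultimately have "(\<phi>, x) \<in> ?S" using that UV a b o by fastforce
    then have "hnorm M (\<zero> \<ominus> \<phi> \<odot> x) < 1" 
      using action_closed[OF that(1,2)] by (simp add: hdist_def)
    then show ?thesis using action_closed[OF that(1,2)] by (simp add: a_minus_def)
  qed
  define C where "C = 4 / (a * b)"
  have "hnorm M (\<phi> \<odot> x) \<le> C * A_norm \<Omega> \<phi> * hnorm M x" 
    if \<phi>: "\<phi> \<in> A_carrier \<Omega>" and x: "x \<in> carrier M" for \<phi> x
  proof (cases "A_norm \<Omega> \<phi> = 0 \<or> hnorm M x = 0")
    case True
    have "\<phi> = ?o" if "A_norm \<Omega> \<phi> = 0"
      using that norm_le_A_norm[OF \<phi>] by (intro A_eqI \<phi> o) (auto simp: A_alg_eval in_closure)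
    moreover have "x = \<zero>" if "hnorm M x = 0" using that x H.hnorm_eq_0D by simp
    ultimately have "\<phi> \<odot> x = \<zero>" 
      using True x \<phi> mod.smult_l_null[of x] mod.smult_r_null[of \<phi>] by auto
    then show ?thesis using True by auto
  next
    case False
    then have p: "A_norm \<Omega> \<phi> > 0" "hnorm M x > 0" 
      using A_norm_nonneg[OF \<phi>] H.hnorm_nonneg[OF x] by auto
    define s t where "s = a / 2 / A_norm \<Omega> \<phi>" and "t = b / 2 / hnorm M x"
    have st: "s > 0" "t > 0" using p a b by (auto simp: s_def t_def)
    let ?\<phi> = "A_const \<Omega> (of_real s) \<otimes>\<^bsub>A_alg \<Omega>\<^esub> \<phi>" and ?x = "A_const \<Omega> (of_real t) \<odot> x"
    have xc: "?x \<in> carrier M" and \<phi>c: "?\<phi> \<in> A_carrier \<Omega>" 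
      using x \<phi> A_const_in action_closed by auto
    have "A_norm \<Omega> ?\<phi> \<le> s * A_norm \<Omega> \<phi>" using A_norm_scale_le[OF \<phi>, of "of_real s"] st by simp
    also have "\<dots> < a" using p a by (simp add: s_def)
    finally have 1: "A_norm \<Omega> ?\<phi> < a" .
    have "hnorm M ?x = t * hnorm M x" using st by (simp add: H.hnorm_smult x)
    then have 2: "hnorm M ?x < b" using p b by (simp add: t_def)
    have "?\<phi> \<odot> ?x = A_const \<Omega> (of_real s) \<odot> (\<phi> \<odot> ?x)"
      using \<phi> xc A_const_in by (intro mod.smult_assoc1) auto
    also have "\<dots> = A_const \<Omega> (of_real s) \<odot> (A_const \<Omega> (of_real t) \<odot> (\<phi> \<odot> x))"
      by (simp only: action_commute_const[OF \<phi> x])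
    also have "\<dots> = A_const \<Omega> (of_real (s * t)) \<odot> (\<phi> \<odot> x)"
      using H.smult_smult[OF action_closed[OF \<phi> x]] by simp
    finally have "?\<phi> \<odot> ?x = A_const \<Omega> (of_real (s * t)) \<odot> (\<phi> \<odot> x)" .
    then have "s * t * hnorm M (\<phi> \<odot> x) = hnorm M (?\<phi> \<odot> ?x)"
      using H.hnorm_smult[of "\<phi> \<odot> x" "of_real (s * t)"] st x \<phi> 
      by (simp add: action_closed norm_mult)
    also have "\<dots> < 1" by (rule small[OF \<phi>c xc 1 2])
    finally have "hnorm M (\<phi> \<odot> x) < 1 / (s * t)" using st by (simp add: field_simps)
    also have "1 / (s * t) = C * A_norm \<Omega> \<phi> * hnorm M x" 
      using p a b by (simp add: s_def t_def C_def)
    finally show ?thesis by simp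
  qed
  moreover have "C \<ge> 0" using a b by (simp add: C_def)
  ultimately show thesis using that by blast
qed

end

text \<open>
  Conversely a bounded action is jointly continuous, because
  \<open>\<phi> x - \<psi> y = (\<phi> - \<psi>) x + \<psi> (x - y)\<close> and \<open>\<parallel>\<psi>\<parallel>\<close> stays bounded near \<open>\<phi>\<close>.
\<close>

lemma (in A_ring) hilbert_moduleI:
  fixes M :: "('m, 'a) hmod" (structure)
  assumes mod: "Module.module (A_alg \<Omega>) M" and hs: "hilbert_space (underlying \<Omega> M)"
    and C: "C \<ge> 0" "\<And>\<phi> x. \<phi> \<in> A_carrier \<Omega> \<Longrightarrow> x \<in> carrier M \<Longrightarrow> 
        hnorm M (\<phi> \<odot> x) \<le> C * A_norm \<Omega> \<phi> * hnorm M x"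
  shows "hilbert_module \<Omega> M"
proof -
  interpret mod: Module.module "A_alg \<Omega>" M by fact
  interpret AM: Metric_space "A_carrier \<Omega>" "A_dist \<Omega>" by (rule A_metric)
  interpret H: pre_hilbert "underlying \<Omega> M" 
    rewrites "carrier (underlying \<Omega> M) = carrier M" and "add (underlying \<Omega> M) = add M"
    and "a_inv (underlying \<Omega> M) = a_inv M" and "a_minus (underlying \<Omega> M) = a_minus M"
    and "hnorm (underlying \<Omega> M) = hnorm M" and "hdist (underlying \<Omega> M) = hdist M"
    and "htop (underlying \<Omega> M) = htop M"
    using hs hilbert_space.pre_hilbert by (auto simp: underlying_all)
  let ?f = "\<lambda>(\<phi>, x). \<phi> \<odot> x"
  have "continuous_map (prod_topology AM.mtopology H.MS.mtopology) H.MS.mtopology ?f"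
    unfolding continuous_map_def
  proof (intro conjI allI impI)
    show "?f \<in> topspace (prod_topology AM.mtopology H.MS.mtopology) \<rightarrow> topspace H.MS.mtopology"
      using mod.smult_closed by auto
    fix U assume U: "openin H.MS.mtopology U"
    show "openin (prod_topology AM.mtopology H.MS.mtopology)
          {p \<in> topspace (prod_topology AM.mtopology H.MS.mtopology). ?f p \<in> U}"
      unfolding openin_prod_topology_alt
    proof (intro allI impI)
      fix \<phi> x assume "(\<phi>, x) \<in> {p \<in> topspace (prod_topology AM.mtopology H.MS.mtopology). ?f p \<in> U}"
      then have \<phi>: "\<phi> \<in> A_carrier \<Omega>" and x: "x \<in> carrier M" and in_U: "\<phi> \<odot> x \<in> U" by auto
      obtain e where e: "e > 0" "H.MS.mball (\<phi> \<odot> x) e \<subseteq> U" using U in_U H.MS.openin_mtopology by auto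
      \<comment> \<open>\<open>K - 1\<close> collects what multiplies \<open>d\<close> in the estimate; adding 1 makes the final inequality strict\<close>
      define K where "K = C * (A_norm \<Omega> \<phi> + 1 + hnorm M x) + 1"
      have K: "K > 0" using C(1) A_norm_nonneg[OF \<phi>] H.hnorm_nonneg[OF x] by (simp add: K_def add_nonneg_pos)
      define d where "d = min 1 (e / K)"
      have d: "0 < d" "d \<le> 1" "K * d \<le> e" using e K by (auto simp: d_def min_def field_simps)
      have "\<psi> \<odot> y \<in> U" if "\<psi> \<in> AM.mball \<phi> d" "y \<in> H.MS.mball x d" for \<psi> y
      proof -
        have \<psi>: "\<psi> \<in> A_carrier \<Omega>" and y: "y \<in> carrier M" using that by auto
        have dn: "A_norm \<Omega> (\<psi> \<ominus>\<^bsub>A_alg \<Omega>\<^esub> \<phi>) < d" 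
          using that AM.commute[of \<phi> \<psi>] \<phi> \<psi> by (simp add: A_dist_eq)
        have dx: "hnorm M (x \<ominus> y) < d" using that x y by (simp add: hdist_def)
        have dc: "\<psi> \<ominus>\<^bsub>A_alg \<Omega>\<^esub> \<phi> \<in> A_carrier \<Omega>" using \<phi> \<psi> by auto
        have "A_norm \<Omega> \<psi> \<le> A_norm \<Omega> \<phi> + d"
        proof (rule A_norm_le)
          fix z assume z: "z \<in> \<Omega>"
          have "cmod (\<psi> z) \<le> cmod (\<phi> z) + cmod (\<psi> z - \<phi> z)" by (rule norm_triangle_sub)
          moreover have "cmod (\<psi> z - \<phi> z) \<le> A_norm \<Omega> (\<psi> \<ominus>\<^bsub>A_alg \<Omega>\<^esub> \<phi>)"
            using norm_le_A_norm[OF dc z] A_minus_eval[OF \<psi> \<phi>] in_closure[OF z] by simp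
          ultimately show "cmod (\<psi> z) \<le> A_norm \<Omega> \<phi> + d" using norm_le_A_norm[OF \<phi> z] dn by simp
        qed
        then have an: "A_norm \<Omega> \<psi> \<le> A_norm \<Omega> \<phi> + 1" using d by simp
        have c: "\<psi> \<odot> x \<in> carrier M" "\<psi> \<odot> y \<in> carrier M" "\<phi> \<odot> x \<in> carrier M"
          using \<phi> \<psi> x y mod.smult_closed by auto
        have "hnorm M (\<phi> \<odot> x \<ominus> \<psi> \<odot> y) 
            \<le> hnorm M (\<phi> \<odot> x \<ominus> \<psi> \<odot> x) + hnorm M (\<psi> \<odot> x \<ominus> \<psi> \<odot> y)"
          using c by (intro H.hnorm_minus_triangle)
        also have "\<psi> \<odot> x \<ominus> \<psi> \<odot> y = \<psi> \<odot> (x \<ominus> y)"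
          using \<psi> x y by (simp add: a_minus_def mod.smult_r_distr mod.smult_r_minus)
        also have "hnorm M (\<phi> \<odot> x \<ominus> \<psi> \<odot> x) = hnorm M ((\<psi> \<ominus>\<^bsub>A_alg \<Omega>\<^esub> \<phi>) \<odot> x)"
          using \<phi> \<psi> x c H.hnorm_minus_commute[of "\<phi> \<odot> x" "\<psi> \<odot> x"] 
          by (simp add: a_minus_def mod.smult_l_distr mod.smult_l_minus)
        also have "hnorm M ((\<psi> \<ominus>\<^bsub>A_alg \<Omega>\<^esub> \<phi>) \<odot> x) + hnorm M (\<psi> \<odot> (x \<ominus> y))
            \<le> C * A_norm \<Omega> (\<psi> \<ominus>\<^bsub>A_alg \<Omega>\<^esub> \<phi>) * hnorm M x + C * A_norm \<Omega> \<psi> * hnorm M (x \<ominus> y)"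
          using dc \<psi> x y by (intro add_mono C(2)) auto
        also have "\<dots> \<le> C * d * hnorm M x + C * (A_norm \<Omega> \<phi> + 1) * d"
          using dn dx an C(1) x y \<psi> \<phi> dc A_norm_nonneg
          by (intro add_mono mult_mono mult_right_mono mult_left_mono mult_nonneg_nonneg) 
             (auto intro: less_imp_le)
        also have "\<dots> = (K - 1) * d" by (simp add: K_def algebra_simps)
        also have "\<dots> < e" using d by (simp add: algebra_simps)
        finally show ?thesis using e c by (auto simp: hdist_def)
      qed
      then show "\<exists>U' V. openin AM.mtopology U' \<and> openin H.MS.mtopology V \<and> \<phi> \<in> U' \<and> x \<in> V \<and>
          U' \<times> V \<subseteq> {p \<in> topspace (prod_topology AM.mtopology H.MS.mtopology). ?f p \<in> U}"
        using \<phi> x d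
        by (intro exI[of _ "AM.mball \<phi> d"] exI[of _ "H.MS.mball x d"]) auto
    qed
  qed
  then show ?thesis using mod hs by (simp add: hilbert_module_def A_top_def htop_def)
qed

context hilb_module begin

lemma closed_submodule_hilbert_module:
  assumes "closed_submodule \<Omega> M K" shows "hilbert_module \<Omega> (M\<lparr>carrier := K\<rparr>)"
proof -
  have K: "submodule K (A_alg \<Omega>) M" and cl: "closedin (htop M) K" 
    using assms by (auto simp: closed_submodule_def)
  have sub: "K \<subseteq> carrier M" using submoduleD[OF K] by auto
  interpret K: pre_hilbert "underlying \<Omega> (M\<lparr>carrier := K\<rparr>)" by (rule restrict_pre_hilbert[OF K])
  have "K.MS.mcomplete" unfolding K.mcomplete_iff
  proof (intro allI impI, elim conjE)
    fix s :: "nat \<Rightarrow> _" assume s: "\<forall>n. s n \<in> carrier (underlying \<Omega> (M\<lparr>carrier := K\<rparr>))"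
      and c: "\<forall>e>0. \<exists>N. \<forall>m\<ge>N. \<forall>n\<ge>N. hnorm (underlying \<Omega> (M\<lparr>carrier := K\<rparr>)) 
           (s m \<ominus>\<^bsub>underlying \<Omega> (M\<lparr>carrier := K\<rparr>)\<^esub> s n) < e"
    have sK: "s n \<in> K" for n using s by (simp add: underlying_all)
    have "\<forall>n. s n \<in> carrier M" using sK sub by auto
    then obtain x where x: "x \<in> carrier M" "(\<lambda>n. hnorm M (s n \<ominus> x)) \<longlonglongrightarrow> 0"
      using complete[unfolded H.mcomplete_iff, rule_format, of s] c sK sub 
      by (auto simp: underlying_all restrict_simps(1) restrict_minus[OF K])
    have "x \<in> K"
    proof -
      have "\<exists>y\<in>K. hnorm M (x \<ominus> y) < e" if "e > 0" for e
      proof -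
        have "\<forall>\<^sub>F n in sequentially. hnorm M (s n \<ominus> x) < e" 
          using order_tendstoD(2)[OF x(2) that] .
        then obtain n where "hnorm M (s n \<ominus> x) < e" by (auto simp: eventually_sequentially)
        then show ?thesis using sK[of n] sub x(1) H.hnorm_minus_commute[of "s n" x] 
          by (intro bexI[of _ "s n"]) auto
      qed
      then show ?thesis using cl x(1) unfolding H.closedin_iff by blast
    qed
    then show "\<exists>x\<in>carrier (underlying \<Omega> (M\<lparr>carrier := K\<rparr>)). (\<lambda>n. hnorm (underlying \<Omega> (M\<lparr>carrier := K\<rparr>)) 
       (s n \<ominus>\<^bsub>underlying \<Omega> (M\<lparr>carrier := K\<rparr>)\<^esub> x)) \<longlonglongrightarrow> 0"
      using x by (intro bexI[of _ x]) (auto simp: underlying_all restrict_simps(1) restrict_minus[OF K])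
  qed
  then have hs: "hilbert_space (underlying \<Omega> (M\<lparr>carrier := K\<rparr>))"
    using K.pre_hilbert_axioms by (simp add: hilbert_space_iff)
  obtain C where C: "C \<ge> 0" "\<And>\<phi> x. \<phi> \<in> A_carrier \<Omega> \<Longrightarrow> x \<in> carrier M \<Longrightarrow> 
        hnorm M (\<phi> \<odot> x) \<le> C * A_norm \<Omega> \<phi> * hnorm M x" using action_bound by metis
  show ?thesis
    by (rule hilbert_moduleI[OF submodule.submodule_is_module[OF K mod.module_axioms] hs C(1)])
       (use C(2) sub in \<open>auto simp: restrict_simps(1)\<close>)
qed

end

section \<open>Quotients and module tensor products\<close>

text \<open>
  The module laws pass to images. This serves both quotients, with the coset map as \<open>h\<close>, and copies of a
  module in another type, with an injection as \<open>h\<close>.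
\<close>

lemma module_image:
  assumes "Module.module R M" and c: "carrier N = h ` carrier M"
    and add: "\<And>x y. x \<in> carrier M \<Longrightarrow> y \<in> carrier M \<Longrightarrow> h x \<oplus>\<^bsub>N\<^esub> h y = h (x \<oplus>\<^bsub>M\<^esub> y)"
    and zero: "\<zero>\<^bsub>N\<^esub> = h \<zero>\<^bsub>M\<^esub>"
    and sm: "\<And>r x. r \<in> carrier R \<Longrightarrow> x \<in> carrier M \<Longrightarrow> r \<odot>\<^bsub>N\<^esub> h x = h (r \<odot>\<^bsub>M\<^esub> x)"
  shows "Module.module R N" "\<And>x. x \<in> carrier M \<Longrightarrow> \<ominus>\<^bsub>N\<^esub> h x = h (\<ominus>\<^bsub>M\<^esub> x)"
    "\<And>x y. x \<in> carrier M \<Longrightarrow> y \<in> carrier M \<Longrightarrow> h x \<ominus>\<^bsub>N\<^esub> h y = h (x \<ominus>\<^bsub>M\<^esub> y)"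
proof -
  interpret Module.module R M by fact
  have "abelian_group N"
  proof (rule abelian_groupI)
    fix u assume "u \<in> carrier N"
    then obtain x where x: "x \<in> carrier M" "u = h x" using c by auto
    show "\<exists>v\<in>carrier N. v \<oplus>\<^bsub>N\<^esub> u = \<zero>\<^bsub>N\<^esub>"
      using x c by (intro bexI[of _ "h (\<ominus>\<^bsub>M\<^esub> x)"]) (auto simp: add zero M.l_neg)
  qed (auto simp: c add zero M.a_assoc, metis M.a_comm)
  then show N: "Module.module R N"
    by (intro moduleI R.is_cring) (auto simp: c sm add smult_l_distr smult_r_distr smult_assoc1)
  interpret N: Module.module R N by fact
  show m: "\<ominus>\<^bsub>N\<^esub> h x = h (\<ominus>\<^bsub>M\<^esub> x)" if "x \<in> carrier M" for x
    by (rule N.minus_equality) (use that c in \<open>auto simp: add zero M.l_neg\<close>)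
  show "h x \<ominus>\<^bsub>N\<^esub> h y = h (x \<ominus>\<^bsub>M\<^esub> y)" if "x \<in> carrier M" "y \<in> carrier M" for x y
    using that by (simp add: a_minus_def m add)
qed

lemma abelian_group_underlyingD: 
  assumes "abelian_group (underlying \<Omega> M)" shows "abelian_group M"
proof -
  interpret U: abelian_group "underlying \<Omega> M" by fact
  show ?thesis
  proof (rule abelian_groupI)
    show "x \<oplus>\<^bsub>M\<^esub> y \<in> carrier M" if "x \<in> carrier M" "y \<in> carrier M" for x y
      using U.add.m_closed[of x y] that by (simp add: underlying_all)
    show "\<zero>\<^bsub>M\<^esub> \<in> carrier M" using U.zero_closed by (simp add: underlying_all)
    show "x \<oplus>\<^bsub>M\<^esub> y \<oplus>\<^bsub>M\<^esub> z = x \<oplus>\<^bsub>M\<^esub> (y \<oplus>\<^bsub>M\<^esub> z)" 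
      if "x \<in> carrier M" "y \<in> carrier M" "z \<in> carrier M" for x y z
      using U.a_assoc[of x y z] that by (simp add: underlying_all)
    show "x \<oplus>\<^bsub>M\<^esub> y = y \<oplus>\<^bsub>M\<^esub> x" if "x \<in> carrier M" "y \<in> carrier M" for x y
      using U.a_comm[of x y] that by (simp add: underlying_all)
    show "\<zero>\<^bsub>M\<^esub> \<oplus>\<^bsub>M\<^esub> x = x" if "x \<in> carrier M" for x
      using U.l_zero[of x] that by (simp add: underlying_all)
    show "\<exists>y\<in>carrier M. y \<oplus>\<^bsub>M\<^esub> x = \<zero>\<^bsub>M\<^esub>" if "x \<in> carrier M" for x
      using U.l_neg[of x] U.a_inv_closed[of x] that by (auto simp: underlying_all)
  qed
qed

locale quotient_module = pre_hilb_module \<Omega> T for \<Omega> :: "(complex ^ 'm) set" and T :: "('m, 'a) hmod" (structure) +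
  fixes K :: "'a set"
  assumes closed_sub: "closed_submodule \<Omega> T K"
begin

lemma sub: "submodule K (A_alg \<Omega>) T" using closed_sub by (simp add: closed_submodule_def)

lemmas subD = submoduleD[OF sub]

sublocale K: abelian_subgroup K T
  by (rule abelian_subgroupI3) 
     (use submodule.axioms(1)[OF sub] in \<open>auto intro: additive_subgroupI mod.M.abelian_group_axioms\<close>)

abbreviation "Q \<equiv> hquotient \<Omega> T K"
definition "\<pi> x = K +> x"

lemma pi_eq_iff: 
  assumes "x \<in> carrier T" "y \<in> carrier T" shows "\<pi> x = \<pi> y \<longleftrightarrow> x \<ominus> y \<in> K"
proof -
  have "x \<ominus> y \<in> K \<longleftrightarrow> x \<in> K +> y" using K.a_rcos_module[OF assms(2,1)] by (simp add: a_minus_def)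
  also have "\<dots> \<longleftrightarrow> \<pi> x = \<pi> y"
    using K.a_rcos_self[OF assms(1)] K.a_repr_independence'[OF _ assms(2), of x] by (auto simp: \<pi>_def)
  finally show ?thesis by simp
qed

lemma pi_mem: "x \<in> carrier T \<Longrightarrow> y \<in> \<pi> x \<longleftrightarrow> y \<in> carrier T \<and> \<pi> y = \<pi> x"
proof
  assume x: "x \<in> carrier T" and y: "y \<in> \<pi> x"
  have "y \<in> carrier T" using K.a_elemrcos_carrier[OF x] y by (simp add: \<pi>_def)
  then show "y \<in> carrier T \<and> \<pi> y = \<pi> x" using K.a_repr_independence'[of y x] x y by (simp add: \<pi>_def)
next
  assume "x \<in> carrier T" "y \<in> carrier T \<and> \<pi> y = \<pi> x"
  then show "y \<in> \<pi> x" using K.a_rcos_self[of y] by (simp add: \<pi>_def)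
qed

lemma carrier_Q: "carrier Q = \<pi> ` carrier T"
  by (auto simp: hquotient_def \<pi>_def A_RCOSETS_def' )

lemma add_Q: "\<lbrakk>x \<in> carrier T; y \<in> carrier T\<rbrakk> \<Longrightarrow> \<pi> x \<oplus>\<^bsub>Q\<^esub> \<pi> y = \<pi> (x \<oplus> y)"
  by (simp add: hquotient_def \<pi>_def K.a_rcos_sum)

lemma zero_Q: "\<zero>\<^bsub>Q\<^esub> = \<pi> \<zero>"
proof -
  have "K +> \<zero> = K" using mod.a_coset_add_zero subD(1) by blast
  then show ?thesis by (simp add: hquotient_def \<pi>_def)
qed

lemma quot_smult_pi:
  assumes "\<phi> \<in> A_carrier \<Omega>" "x \<in> carrier T"
  shows "quot_smult T K \<phi> (\<pi> x) = \<pi> (\<phi> \<odot> x)"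
proof -
  have "\<pi> (\<phi> \<odot> y) = \<pi> (\<phi> \<odot> x)" if "y \<in> \<pi> x" for y
  proof -
    have y: "y \<in> carrier T" "y \<ominus> x \<in> K" using that assms pi_mem pi_eq_iff by auto
    have "\<phi> \<odot> y \<ominus> \<phi> \<odot> x = \<phi> \<odot> (y \<ominus> x)" using y assms by (simp add: action_minus_right)
    then show ?thesis using y assms subD(5) by (simp add: pi_eq_iff action_closed)
  qed
  then have "(\<Union>y\<in>\<pi> x. \<pi> (\<phi> \<odot> y)) = (\<Union>y\<in>\<pi> x. \<pi> (\<phi> \<odot> x))" 
    by (intro SUP_cong refl)
  also have "x \<in> \<pi> x" using assms pi_mem by blast
  then have "(\<Union>y\<in>\<pi> x. \<pi> (\<phi> \<odot> x)) = \<pi> (\<phi> \<odot> x)" by blast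
  finally show ?thesis by (simp add: quot_smult_def \<pi>_def)
qed

lemma smult_Q: "\<lbrakk>\<phi> \<in> A_carrier \<Omega>; x \<in> carrier T\<rbrakk> \<Longrightarrow> \<phi> \<odot>\<^bsub>Q\<^esub> \<pi> x = \<pi> (\<phi> \<odot> x)"
  using quot_smult_pi by (simp add: hquotient_def)

definition "p x = quot_norm T (\<pi> x)"

lemma p_eq: "x \<in> carrier T \<Longrightarrow> p x = Inf {hnorm T y | y. y \<in> carrier T \<and> \<pi> y = \<pi> x}"
proof -
  assume x: "x \<in> carrier T"
  have "hnorm T ` \<pi> x = {hnorm T y | y. y \<in> carrier T \<and> \<pi> y = \<pi> x}" using pi_mem[OF x] by auto
  then show ?thesis by (simp add: p_def quot_norm_def)
qed

lemma p_le: "x \<in> carrier T \<Longrightarrow> p x \<le> hnorm T x"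
  unfolding p_eq by (rule cInf_lower) (auto intro!: bdd_belowI[of _ 0])

lemma p_cong: "\<pi> x = \<pi> y \<Longrightarrow> p x = p y" by (simp add: p_def)

lemma p_approx: 
  assumes "x \<in> carrier T" "e > 0" obtains y where "y \<in> carrier T" "\<pi> y = \<pi> x" "hnorm T y < p x + e"
proof -
  have "\<exists>a\<in>{hnorm T y | y. y \<in> carrier T \<and> \<pi> y = \<pi> x}. a < p x + e"
    by (rule cInf_lessD) (use assms in \<open>auto simp: p_eq\<close>)
  then show thesis using that by auto
qed

lemma p_nonneg: "x \<in> carrier T \<Longrightarrow> 0 \<le> p x"
  unfolding p_eq by (rule cInf_greatest) auto

lemma p_add: assumes x: "x \<in> carrier T" and y: "y \<in> carrier T" shows "p (x \<oplus> y) \<le> p x + p y"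
proof (rule field_le_epsilon)
  fix e :: real assume e: "e > 0"
  obtain x' where x': "x' \<in> carrier T" "\<pi> x' = \<pi> x" "hnorm T x' < p x + e / 2" 
    using p_approx[OF x, of "e / 2"] e by auto
  obtain y' where y': "y' \<in> carrier T" "\<pi> y' = \<pi> y" "hnorm T y' < p y + e / 2" 
    using p_approx[OF y, of "e / 2"] e by auto
  have "\<pi> (x \<oplus> y) = \<pi> (x' \<oplus> y')" using x y x' y' by (metis add_Q)
  then have "p (x \<oplus> y) = p (x' \<oplus> y')" by (rule p_cong)
  also have "\<dots> \<le> hnorm T (x' \<oplus> y')" using x' y' by (intro p_le) auto
  also have "\<dots> \<le> hnorm T x' + hnorm T y'" using x' y' by (intro H.hnorm_triangle)
  finally show "p (x \<oplus> y) \<le> p x + p y + e" using x' y' by simp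
qed

lemma p_smult_le: 
  assumes x: "x \<in> carrier T" shows "p (A_const \<Omega> c \<odot> x) \<le> cmod c * p x"
proof (rule field_le_epsilon)
  fix e :: real assume e: "e > 0"
  define d where "d = e / (cmod c + 1)"
  have k: "cmod c + 1 > 0" by (simp add: add_nonneg_pos)
  have d: "d > 0" using e k by (simp add: d_def)
  have "cmod c * d \<le> (cmod c + 1) * d" using d by (intro mult_right_mono) auto
  then have de: "cmod c * d \<le> e" using k by (simp add: d_def)
  obtain x' where x': "x' \<in> carrier T" "\<pi> x' = \<pi> x" "hnorm T x' < p x + d" 
    using p_approx[OF x d] by auto
  have "\<pi> (A_const \<Omega> c \<odot> x) = \<pi> (A_const \<Omega> c \<odot> x')" using x x' A_const_in by (metis smult_Q)
  then have "p (A_const \<Omega> c \<odot> x) = p (A_const \<Omega> c \<odot> x')" by (rule p_cong)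
  also have "\<dots> \<le> cmod c * hnorm T x'" 
    using p_le[OF action_closed[OF A_const_in x'(1)]] H.hnorm_smult[OF x'(1)] by simp
  also have "\<dots> \<le> cmod c * (p x + d)" using x' by (intro mult_left_mono) auto
  also have "\<dots> \<le> cmod c * p x + e" using de by (simp add: algebra_simps)
  finally show "p (A_const \<Omega> c \<odot> x) \<le> cmod c * p x + e" .
qed

lemma p_smult: 
  assumes x: "x \<in> carrier T" shows "p (A_const \<Omega> c \<odot> x) = cmod c * p x"
proof (cases "c = 0")
  case True
  then show ?thesis using p_smult_le[OF x, of c] p_nonneg[OF action_closed[OF A_const_in x], of c] by simp
next
  case False
  have "A_const \<Omega> (inverse c) \<odot> (A_const \<Omega> c \<odot> x) = x" 
    using H.smult_smult[OF x, of "inverse c" c] H.one_smult[OF x] False by simp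
  then have "p x \<le> cmod (inverse c) * p (A_const \<Omega> c \<odot> x)"
    using p_smult_le[OF action_closed[OF A_const_in x], of "inverse c" c] by simp
  then have "cmod c * p x \<le> p (A_const \<Omega> c \<odot> x)" 
  proof -
    have "cmod c > 0" using False by simp
    then show ?thesis using \<open>p x \<le> cmod (inverse c) * _\<close> by (simp add: norm_inverse field_simps norm_divide)
  qed
  then show ?thesis using p_smult_le[OF x, of c] by simp
qed

lemma p_eq_0D: assumes x: "x \<in> carrier T" and 0: "p x = 0" shows "x \<in> K"
proof -
  have "\<exists>y\<in>K. hnorm T (x \<ominus> y) < e" if e: "e > 0" for e
  proof -
    obtain x' where x': "x' \<in> carrier T" "\<pi> x' = \<pi> x" "hnorm T x' < e" 
      using p_approx[OF x e] 0 by auto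
    have "x \<ominus> x' \<in> K" using pi_eq_iff[OF x x'(1)] x' by simp
    moreover have "x \<ominus> (x \<ominus> x') = x'"
      using x x' mod.M.minus_add[of x "\<ominus> x'"] 
      by (simp add: a_minus_def mod.M.r_neg2 mod.M.a_assoc[symmetric] mod.M.r_neg)
    ultimately show ?thesis using x'(3) by (intro bexI[of _ "x \<ominus> x'"]) auto
  qed
  then show ?thesis using closed_sub x unfolding closed_submodule_def H.closedin_iff by blast
qed

text \<open>
  The polarization formula for a coset with itself involves the norms of its multiples by \<open>1 + \<i> ^ k\<close>,
  whose squared absolute values are 4, 2, 0, 2. So by homogeneity it returns the squared quotient
  norm.
\<close>

lemma hnorm_Q: assumes x: "x \<in> carrier T" shows "hnorm Q (\<pi> x) = p x"
proof -
  have "quot_norm T (\<pi> x <+> quot_smult T K (A_const \<Omega> c) (\<pi> x)) = cmod (1 + c) * p x" for c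
  proof -
    have "\<pi> x <+> quot_smult T K (A_const \<Omega> c) (\<pi> x) = \<pi> (x \<oplus> A_const \<Omega> c \<odot> x)"
      using x add_Q[of x "A_const \<Omega> c \<odot> x"] 
      by (simp add: quot_smult_pi A_const_in action_closed) (simp add: hquotient_def)
    also have "x \<oplus> A_const \<Omega> c \<odot> x = A_const \<Omega> (1 + c) \<odot> x"
      using x by (simp add: H.smult_add_left H.one_smult)
    finally show ?thesis using p_smult[OF x, of "1 + c"] by (simp add: p_def)
  qed
  then have "hinner Q (\<pi> x) (\<pi> x) = (\<Sum>k<4. \<i> ^ k * of_real ((cmod (1 + \<i> ^ k) * p x)\<^sup>2)) / 4"
    by (simp add: hquotient_def)
  also have "\<dots> = of_real ((p x)\<^sup>2)"
  proof -
    have "{..<4::nat} = {0, 1, 2, 3}" by auto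
    moreover have "\<i> ^ 3 = - \<i>" by (simp add: power3_eq_cube)
    moreover have "(cmod (1 + \<i>))\<^sup>2 = 2" "(cmod (1 - \<i>))\<^sup>2 = 2" by (simp_all add: cmod_power2)
    then have "(cmod (1 + \<i>) * p x)\<^sup>2 = 2 * (p x)\<^sup>2" "(cmod (1 - \<i>) * p x)\<^sup>2 = 2 * (p x)\<^sup>2" 
      by (simp_all only: power_mult_distrib)
    ultimately show ?thesis by (simp del: of_real_power of_real_mult) (simp add: mult.commute)
  qed
  finally show ?thesis using p_nonneg[OF x] by (simp add: hnorm_def)
qed

lemma module_Q: "Module.module complex_ring (underlying \<Omega> Q)"
  "x \<in> carrier T \<Longrightarrow> \<ominus>\<^bsub>Q\<^esub> \<pi> x = \<pi> (\<ominus> x)"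
  "x \<in> carrier T \<Longrightarrow> y \<in> carrier T \<Longrightarrow> \<pi> x \<ominus>\<^bsub>Q\<^esub> \<pi> y = \<pi> (x \<ominus> y)"
  using module_image[OF module_underlying[OF A_module], of "underlying \<Omega> Q" \<pi>]
  by (auto simp: underlying_all carrier_Q add_Q zero_Q smult_Q A_const_in)

sublocale Q: normed_space "underlying \<Omega> Q"
  rewrites "carrier (underlying \<Omega> Q) = carrier Q" and "add (underlying \<Omega> Q) = add Q"
    and "zero (underlying \<Omega> Q) = zero Q" 
    and "smult (underlying \<Omega> Q) = (\<lambda>c x. A_const \<Omega> c \<odot>\<^bsub>Q\<^esub> x)"
    and "a_inv (underlying \<Omega> Q) = a_inv Q" and "a_minus (underlying \<Omega> Q) = a_minus Q"
    and "hnorm (underlying \<Omega> Q) = hnorm Q" and "hdist (underlying \<Omega> Q) = hdist Q"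
    and "htop (underlying \<Omega> Q) = htop Q" and "finsum (underlying \<Omega> Q) = finsum Q"
proof -
  show "normed_space (underlying \<Omega> Q)"
  proof (intro normed_space.intro normed_space_axioms.intro module_Q(1), unfold underlying_all carrier_Q)
    show "hnorm Q (u \<oplus>\<^bsub>Q\<^esub> v) \<le> hnorm Q u + hnorm Q v" 
      if "u \<in> \<pi> ` carrier T" "v \<in> \<pi> ` carrier T" for u v
      using that by (auto simp: add_Q hnorm_Q p_add)
    show "hnorm Q (A_const \<Omega> c \<odot>\<^bsub>Q\<^esub> u) = cmod c * hnorm Q u" if "u \<in> \<pi> ` carrier T" for u c
      using that by (auto simp: smult_Q A_const_in hnorm_Q p_smult action_closed)
    show "u = \<zero>\<^bsub>Q\<^esub>" if u: "u \<in> \<pi> ` carrier T" "hnorm Q u = 0" for u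
    proof -
      obtain x where x: "x \<in> carrier T" "u = \<pi> x" using u(1) by (elim imageE)
      then have "x \<in> K" using u(2) p_eq_0D hnorm_Q by simp
      then show ?thesis using x by (simp add: zero_Q pi_eq_iff a_minus_def)
    qed
  qed
qed (simp_all add: underlying_all)

end

text \<open>
  The tensor product sees of its factors the carrier, the addition and the inner product, so it
  commutes with restriction of scalars.
\<close>

lemma tensor_underlying_left [simp]:
  "fsums (underlying \<Omega> M) N = fsums M N" "fsum_inner (underlying \<Omega> M) N = fsum_inner M N"
  "fsum_dist (underlying \<Omega> M) N = fsum_dist M N" "fsum_Cauchy (underlying \<Omega> M) N = fsum_Cauchy M N"
  "fsum_rel (underlying \<Omega> M) N = fsum_rel M N" "fsum_class (underlying \<Omega> M) N = fsum_class M N"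
  "htens (underlying \<Omega> M) N = htens M N" "htensor (underlying \<Omega> M) N = underlying \<Omega> (htensor M N)"
proof -
  show 1: "fsums (underlying \<Omega> M) N = fsums M N" by (simp add: fsums_def underlying_all)
  show 2: "fsum_inner (underlying \<Omega> M) N = fsum_inner M N" by (simp add: fsum_inner_def underlying_all fun_eq_iff)
  show 3: "fsum_dist (underlying \<Omega> M) N = fsum_dist M N" by (simp add: fsum_dist_def underlying_all fun_eq_iff 2)
  show 4: "fsum_Cauchy (underlying \<Omega> M) N = fsum_Cauchy M N" by (simp add: fsum_Cauchy_def 1 3)
  show 5: "fsum_rel (underlying \<Omega> M) N = fsum_rel M N" by (simp add: fsum_rel_def 4 3)
  show 6: "fsum_class (underlying \<Omega> M) N = fsum_class M N" by (simp add: fsum_class_def 5 fun_eq_iff)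
  show "htens (underlying \<Omega> M) N = htens M N" by (simp add: htens_def 6 fun_eq_iff)
  show "htensor (underlying \<Omega> M) N = underlying \<Omega> (htensor M N)"
    unfolding htensor_def underlying_def[of \<Omega> "\<lparr>carrier = _, mult = _, one = _, zero = _, add = _, smult = _, hinner = _\<rparr>"] 
    by (simp add: 2 4 5 6 underlying_all)
qed

lemma tensor_underlying_right [simp]:
  "fsums M (underlying \<Omega> N) = fsums M N" "fsum_inner M (underlying \<Omega> N) = fsum_inner M N"
  "fsum_dist M (underlying \<Omega> N) = fsum_dist M N" "fsum_Cauchy M (underlying \<Omega> N) = fsum_Cauchy M N"
  "fsum_rel M (underlying \<Omega> N) = fsum_rel M N" "fsum_class M (underlying \<Omega> N) = fsum_class M N"
  "htens M (underlying \<Omega> N) = htens M N" "htensor M (underlying \<Omega> N) = htensor M N"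
proof -
  show 1: "fsums M (underlying \<Omega> N) = fsums M N" by (simp add: fsums_def underlying_all)
  show 2: "fsum_inner M (underlying \<Omega> N) = fsum_inner M N" by (simp add: fsum_inner_def underlying_all fun_eq_iff)
  show 3: "fsum_dist M (underlying \<Omega> N) = fsum_dist M N" by (simp add: fsum_dist_def underlying_all fun_eq_iff 2)
  show 4: "fsum_Cauchy M (underlying \<Omega> N) = fsum_Cauchy M N" by (simp add: fsum_Cauchy_def 1 3)
  show 5: "fsum_rel M (underlying \<Omega> N) = fsum_rel M N" by (simp add: fsum_rel_def 4 3)
  show 6: "fsum_class M (underlying \<Omega> N) = fsum_class M N" by (simp add: fsum_class_def 5 fun_eq_iff)
  show "htens M (underlying \<Omega> N) = htens M N" by (simp add: htens_def 6 fun_eq_iff)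
  show "htensor M (underlying \<Omega> N) = htensor M N" by (simp add: htensor_def 2 4 5 6 underlying_all)
qed

locale tensor_modules = M: hilb_module \<Omega> M + N: hilb_module \<Omega> N 
  for \<Omega> :: "(complex ^ 'm) set" and M :: "('m, 'a) hmod" and N :: "('m, 'b) hmod"
begin

sublocale TP: tensor_pair "underlying \<Omega> M" "underlying \<Omega> N"
  by (intro tensor_pair.intro M.pre_hilbert_und N.pre_hilbert_und)

abbreviation "T \<equiv> htensor M N"

lemma left_op_action:
  assumes "\<phi> \<in> A_carrier \<Omega>" obtains C where "TP.left_op (\<lambda>x. \<phi> \<odot>\<^bsub>M\<^esub> x) C"
proof -
  obtain C where C: "C \<ge> 0" "\<And>\<phi> x. \<phi> \<in> A_carrier \<Omega> \<Longrightarrow> x \<in> carrier M \<Longrightarrow> 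
    hnorm M (\<phi> \<odot>\<^bsub>M\<^esub> x) \<le> C * A_norm \<Omega> \<phi> * hnorm M x" using M.action_bound by metis
  have "TP.left_op (\<lambda>x. \<phi> \<odot>\<^bsub>M\<^esub> x) (C * A_norm \<Omega> \<phi>)"
    unfolding TP.left_op_def underlying_all
    using assms C M.A_norm_nonneg[OF assms] M.mod.smult_r_distr
    by (auto simp: M.action_closed M.action_commute_const)
  then show thesis by (rule that)
qed

lemma cls_action:
  assumes "\<phi> \<in> A_carrier \<Omega>" "s \<in> fsum_Cauchy M N"
  shows "\<phi> \<odot>\<^bsub>T\<^esub> fsum_class M N s = fsum_class M N (\<lambda>n. TP.fmap (\<lambda>x. \<phi> \<odot>\<^bsub>M\<^esub> x) (s n))"
    "(\<lambda>n. TP.fmap (\<lambda>x. \<phi> \<odot>\<^bsub>M\<^esub> x) (s n)) \<in> fsum_Cauchy M N"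
proof -
  obtain C where C: "TP.left_op (\<lambda>x. \<phi> \<odot>\<^bsub>M\<^esub> x) C" using left_op_action[OF assms(1)] .
  show "\<phi> \<odot>\<^bsub>T\<^esub> fsum_class M N s = fsum_class M N (\<lambda>n. TP.fmap (\<lambda>x. \<phi> \<odot>\<^bsub>M\<^esub> x) (s n))"
    using TP.cls_fmap[OF _ C] assms by (simp add: htensor_def TP.fmap_def)
  show "(\<lambda>n. TP.fmap (\<lambda>x. \<phi> \<odot>\<^bsub>M\<^esub> x) (s n)) \<in> fsum_Cauchy M N"
    using TP.CS_fmap[OF _ C] assms by simp
qed

text \<open>
  Pairing with a fixed list turns a pointwise identity between operators into one between tensors.
\<close>

lemma IP_fmap_cong:
  assumes "s \<in> fsums M N" "\<And>x y x' y'. x \<in> carrier M \<Longrightarrow> x' \<in> carrier M \<Longrightarrow> 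
     hinner M (\<rho> x) x' = hinner M (\<sigma> x) x' + hinner M (\<tau> x) x'" and w: "w \<in> fsums M N"
  shows "fsum_inner M N (TP.fmap \<rho> s) w = fsum_inner M N (TP.fmap \<sigma> s @ TP.fmap \<tau> s) w"
proof -
  have inner: "(\<Sum>(x', y')\<leftarrow>w. hinner M (\<rho> x) x' * hinner N y y') 
    = (\<Sum>(x', y')\<leftarrow>w. hinner M (\<sigma> x) x' * hinner N y y') 
     + (\<Sum>(x', y')\<leftarrow>w. hinner M (\<tau> x) x' * hinner N y y')" if "x \<in> carrier M" for x y
    using w by (induction w) (use assms(2) that in \<open>auto simp: fsums_def algebra_simps\<close>)
  show ?thesis using assms(1)
    by (induction s) (auto simp: fsum_inner_def fsums_def inner)
qed

lemma T_cases: 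
  assumes "X \<in> carrier T" obtains s where "s \<in> fsum_Cauchy M N" "X = fsum_class M N s"
  using TP.T_cases[simplified, of X thesis] assms by (simp add: underlying_all)

lemma module_T: "Module.module (A_alg \<Omega>) T"
proof (intro moduleI M.mod.R.is_cring)
  show "abelian_group T"
    using TP.abelian_group_T by (auto intro: abelian_group_underlyingD)
  note cs = TP.CS_Fs[simplified]
  fix \<phi> \<psi> X assume "\<phi> \<in> carrier (A_alg \<Omega>)" and "\<psi> \<in> carrier (A_alg \<Omega>)" and "X \<in> carrier T"
  then obtain s where s: "s \<in> fsum_Cauchy M N" "X = fsum_class M N s" 
    and \<phi>: "\<phi> \<in> A_carrier \<Omega>" and \<psi>: "\<psi> \<in> A_carrier \<Omega>"  
    by (metis A_alg_simps(1) T_cases)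
  have sum: "\<phi> \<oplus>\<^bsub>A_alg \<Omega>\<^esub> \<psi> \<in> A_carrier \<Omega>" and prod: "\<phi> \<otimes>\<^bsub>A_alg \<Omega>\<^esub> \<psi> \<in> A_carrier \<Omega>" 
    using \<phi> \<psi> by auto
  note act = cls_action[OF _ s(1)]
  show "(\<phi> \<oplus>\<^bsub>A_alg \<Omega>\<^esub> \<psi>) \<odot>\<^bsub>T\<^esub> X = \<phi> \<odot>\<^bsub>T\<^esub> X \<oplus>\<^bsub>T\<^esub> \<psi> \<odot>\<^bsub>T\<^esub> X"
    unfolding s(2) act(1)[OF sum] act(1)[OF \<phi>] act(1)[OF \<psi>] 
      TP.cls_add[simplified underlying_all tensor_underlying_left tensor_underlying_right, OF act(2)[OF \<phi>] act(2)[OF \<psi>]]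
    by (rule TP.cls_eqI[simplified]; (rule act(2)[OF sum] TP.CS_append[simplified, OF act(2)[OF \<phi>] act(2)[OF \<psi>]])?)
       (use \<phi> \<psi> in \<open>auto intro!: IP_fmap_cong cs[OF s(1)] 
          simp: M.mod.smult_l_distr M.H.hinner_add_left M.action_closed\<close>)
  have eq: "TP.fmap (\<lambda>x. (\<phi> \<otimes>\<^bsub>A_alg \<Omega>\<^esub> \<psi>) \<odot>\<^bsub>M\<^esub> x) (s n) 
      = TP.fmap (\<lambda>x. \<phi> \<odot>\<^bsub>M\<^esub> x) (TP.fmap (\<lambda>x. \<psi> \<odot>\<^bsub>M\<^esub> x) (s n))" for n
    using cs[OF s(1), of n] \<phi> \<psi> by (auto simp: TP.fmap_def fsums_def M.mod.smult_assoc1)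
  show "(\<phi> \<otimes>\<^bsub>A_alg \<Omega>\<^esub> \<psi>) \<odot>\<^bsub>T\<^esub> X = \<phi> \<odot>\<^bsub>T\<^esub> (\<psi> \<odot>\<^bsub>T\<^esub> X)"
    unfolding s(2) act(1)[OF prod] act(1)[OF \<psi>] cls_action(1)[OF \<phi> act(2)[OF \<psi>]] eq ..
  show "\<phi> \<odot>\<^bsub>T\<^esub> X \<in> carrier T"
    unfolding s(2) act(1)[OF \<phi>] using TP.cls_in[simplified underlying_all tensor_underlying_left tensor_underlying_right, OF act(2)[OF \<phi>]] .
next
  fix X assume "X \<in> carrier T"
  then obtain s where s: "s \<in> fsum_Cauchy M N" "X = fsum_class M N s" by (metis T_cases)
  have "TP.fmap (\<lambda>x. A_const \<Omega> 1 \<odot>\<^bsub>M\<^esub> x) (s n) = s n" for n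
    using TP.CS_Fs[simplified, OF s(1), of n] M.H.one_smult
    by (auto simp: TP.fmap_def fsums_def intro!: map_idI)
  then show "\<one>\<^bsub>A_alg \<Omega>\<^esub> \<odot>\<^bsub>T\<^esub> X = X"
    using cls_action(1)[OF M.A_const_in s(1), of 1] s(2) by simp
next
  fix \<phi> X Y assume "\<phi> \<in> carrier (A_alg \<Omega>)" and "X \<in> carrier T" "Y \<in> carrier T"
  then obtain s t where s: "s \<in> fsum_Cauchy M N" "X = fsum_class M N s" 
    and t: "t \<in> fsum_Cauchy M N" "Y = fsum_class M N t" 
    and \<phi>: "\<phi> \<in> A_carrier \<Omega>"  by (metis A_alg_simps(1) T_cases)
  note add = TP.cls_add[simplified underlying_all tensor_underlying_left tensor_underlying_right]
  show "\<phi> \<odot>\<^bsub>T\<^esub> (X \<oplus>\<^bsub>T\<^esub> Y) = \<phi> \<odot>\<^bsub>T\<^esub> X \<oplus>\<^bsub>T\<^esub> \<phi> \<odot>\<^bsub>T\<^esub> Y"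
    unfolding s(2) t(2) cls_action(1)[OF \<phi> s(1)] cls_action(1)[OF \<phi> t(1)] add[OF s(1) t(1)]
      cls_action(1)[OF \<phi> TP.CS_append[simplified, OF s(1) t(1)]]
      add[OF cls_action(2)[OF \<phi> s(1)] cls_action(2)[OF \<phi> t(1)]]
    by (simp add: TP.fmap_append)
qed

sublocale T: pre_hilb_module \<Omega> T
  using module_T TP.pre_hilbert_T 
  by (intro pre_hilb_module.intro M.bounded_domain_axioms pre_hilb_module_axioms.intro) simp_all

lemma htens_closed: "\<lbrakk>x \<in> carrier M; y \<in> carrier N\<rbrakk> \<Longrightarrow> htens M N x y \<in> carrier T"
  using TP.htens_in[of x y] by (simp add: underlying_all)

lemma htens_add:
  "\<lbrakk>x \<in> carrier M; x' \<in> carrier M; y \<in> carrier N\<rbrakk> \<Longrightarrow> htens M N (x \<oplus>\<^bsub>M\<^esub> x') y = htens M N x y \<oplus>\<^bsub>T\<^esub> htens M N x' y"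
  "\<lbrakk>x \<in> carrier M; y \<in> carrier N; y' \<in> carrier N\<rbrakk> \<Longrightarrow> htens M N x (y \<oplus>\<^bsub>N\<^esub> y') = htens M N x y \<oplus>\<^bsub>T\<^esub> htens M N x y'"
  using TP.htens_add_left[of x x' y] TP.htens_add_right[of x y y'] by (simp_all add: underlying_all)

lemma htens_zero_left: "y \<in> carrier N \<Longrightarrow> htens M N \<zero>\<^bsub>M\<^esub> y = \<zero>\<^bsub>T\<^esub>"
  using TP.hnorm_htens[of "\<zero>\<^bsub>M\<^esub>" y] htens_closed[of "\<zero>\<^bsub>M\<^esub>" y] T.H.hnorm_eq_0D by (simp add: underlying_all)

lemma hnorm_htens: 
  "\<lbrakk>x \<in> carrier M; y \<in> carrier N\<rbrakk> \<Longrightarrow> hnorm T (htens M N x y) = hnorm M x * hnorm N y"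
  using TP.hnorm_htens[of x y] by (simp add: underlying_all)

lemma action_htens:
  "\<lbrakk>\<phi> \<in> A_carrier \<Omega>; x \<in> carrier M; y \<in> carrier N\<rbrakk> \<Longrightarrow> \<phi> \<odot>\<^bsub>T\<^esub> htens M N x y = htens M N (\<phi> \<odot>\<^bsub>M\<^esub> x) y"
  using cls_action(1)[of \<phi> "\<lambda>n. [(x, y)]"] TP.CS_const[of "[(x, y)]"] 
  by (simp add: htens_def TP.fmap_def fsums_def underlying_all)

lemma htens_const_right:
  "\<lbrakk>x \<in> carrier M; y \<in> carrier N\<rbrakk> \<Longrightarrow> htens M N x (A_const \<Omega> c \<odot>\<^bsub>N\<^esub> y) = htens M N (A_const \<Omega> c \<odot>\<^bsub>M\<^esub> x) y"
  using TP.htens_smult_right[of x y c] TP.htens_smult_left[of x y c] by (simp add: underlying_all)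

lemma tensor_kernel_closed_submodule: "closed_submodule \<Omega> T (tensor_kernel \<Omega> M N)"
proof -
  let ?F = "{K. closed_submodule \<Omega> T K \<and> tensor_relators \<Omega> M N \<subseteq> K}"
  have relc: "tensor_relators \<Omega> M N \<subseteq> carrier T"
    by (auto simp: tensor_relators_def intro!: T.mod.M.minus_closed htens_closed M.action_closed N.action_closed)
  have cl: "closedin (htop T) (carrier T)" by (simp add: T.H.closedin_iff)
  \<comment> \<open>the family is not empty, so its intersection is a set of tensors\<close>
  have top: "carrier T \<in> ?F" 
    using T.mod.carrier_is_submodule relc cl by (auto simp: closed_submodule_def)
  have sub: "submodule (\<Inter>?F) (A_alg \<Omega>) T"
  proof (rule T.mod.submoduleI)
    show "\<Inter>?F \<subseteq> carrier T" using top by blast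
  qed (auto simp: closed_submodule_def T.submoduleD)
  moreover have "closedin (htop T) (\<Inter>?F)"
    by (rule closedin_Inter) (use top in \<open>auto simp: closed_submodule_def\<close>)
  ultimately show ?thesis by (simp add: closed_submodule_def tensor_kernel_def)
qed

sublocale quotient_module \<Omega> T "tensor_kernel \<Omega> M N"
  by (intro quotient_module.intro T.pre_hilb_module_axioms quotient_module_axioms.intro tensor_kernel_closed_submodule)

lemma mtensor_eq: "mtensor \<Omega> M N = Q" by (simp add: mtensor_def)
lemma mtens_eq: "mtens \<Omega> M N x y = \<pi> (htens M N x y)" by (simp add: mtens_def \<pi>_def)

lemma relator_in:
  "\<lbrakk>\<phi> \<in> A_carrier \<Omega>; x \<in> carrier M; y \<in> carrier N\<rbrakk> \<Longrightarrow>
    htens M N (\<phi> \<odot>\<^bsub>M\<^esub> x) y \<ominus>\<^bsub>T\<^esub> htens M N x (\<phi> \<odot>\<^bsub>N\<^esub> y) \<in> tensor_kernel \<Omega> M N"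
  unfolding tensor_kernel_def tensor_relators_def by blast

lemma tensor_kernel_least:
  "\<lbrakk>closed_submodule \<Omega> T K; \<And>\<phi> x y. \<lbrakk>\<phi> \<in> A_carrier \<Omega>; x \<in> carrier M; y \<in> carrier N\<rbrakk> \<Longrightarrow>
    htens M N (\<phi> \<odot>\<^bsub>M\<^esub> x) y \<ominus>\<^bsub>T\<^esub> htens M N x (\<phi> \<odot>\<^bsub>N\<^esub> y) \<in> K\<rbrakk> \<Longrightarrow> tensor_kernel \<Omega> M N \<subseteq> K"
  unfolding tensor_kernel_def tensor_relators_def by blast

end

section \<open>Fibres at the points of the domain\<close>

lemma (in tensor_pair) hnorm_cls_const_minus:
  assumes "s \<in> Fs" "t \<in> Fs"
  shows "hnorm T (cls (\<lambda>n. s) \<ominus>\<^bsub>T\<^esub> cls (\<lambda>n. t)) = D s t"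
proof -
  have "cls (\<lambda>n. s) \<ominus>\<^bsub>T\<^esub> cls (\<lambda>n. t) = cls (\<lambda>n. s) \<oplus>\<^bsub>T\<^esub> (-1) \<odot>\<^bsub>T\<^esub> cls (\<lambda>n. t)"
    using assms T.minus_smult[of "cls (\<lambda>n. t)" 1] by (simp add: a_minus_def)
  also have "\<dots> = cls (\<lambda>n. s @ fneg t)" using assms by (simp add: cls_smult cls_add fneg_eq)
  finally show ?thesis using assms by (simp add: hnorm_cls_const D_eq)
qed

lemma hnorm_point [simp]: "hnorm (point_module z) v = cmod v"
  by (simp add: hnorm_def point_module_def complex_mult_cnj cmod_def power2_eq_square)

lemma point_simps [simp]:
  "carrier (point_module z) = UNIV" "add (point_module z) = (+)" "zero (point_module z) = 0"
  "smult (point_module z) \<phi> v = \<phi> z * v" "hinner (point_module z) v w = v * cnj w"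
  by (simp_all add: point_module_def)

lemma (in A_ring) hilbert_module_point:
  assumes z: "z \<in> \<Omega>" shows "hilbert_module \<Omega> (point_module z)"
proof -
  have zc: "z \<in> closure \<Omega>" by (rule in_closure[OF z])
  have mod: "Module.module (A_alg \<Omega>) (point_module z)"
  proof (rule moduleI[OF A.is_cring])
    show "abelian_group (point_module z)"
      by (rule abelian_groupI) (auto simp: algebra_simps intro: exI[of _ "- _"] left_minus)
  qed (auto simp: A_alg_eval[OF zc] algebra_simps)
  interpret P: pre_hilbert "underlying \<Omega> (point_module z)"
    by (intro pre_hilbert.intro module_underlying mod pre_hilbert_axioms.intro)
       (auto simp: underlying_all A_alg_eval[OF zc] algebra_simps)
  have m: "v \<ominus>\<^bsub>point_module z\<^esub> w = v - w" for v w
  proof -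
    interpret p: Module.module "A_alg \<Omega>" "point_module z" by (rule mod)
    have "\<ominus>\<^bsub>point_module z\<^esub> w = - w" using p.minus_equality[of "- w" w] by simp
    then show ?thesis by (simp add: a_minus_def)
  qed
  have "P.MS.mcomplete"
    unfolding P.mcomplete_iff unfolding underlying_all m hnorm_point
  proof (intro allI impI, elim conjE)
    fix s :: "nat \<Rightarrow> complex" assume "\<forall>e>0. \<exists>N. \<forall>m\<ge>N. \<forall>n\<ge>N. cmod (s m - s n) < e"
    then have "Cauchy s" by (simp add: Cauchy_def dist_norm)
    then obtain x where "s \<longlonglongrightarrow> x" using Cauchy_convergent_iff convergent_def by blast
    then have "(\<lambda>n. cmod (s n - x)) \<longlonglongrightarrow> 0" by (simp add: LIM_zero_iff tendsto_norm_zero_iff)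
    then show "\<exists>x\<in>carrier (point_module z). (\<lambda>n. cmod (s n - x)) \<longlonglongrightarrow> 0" by auto
  qed
  then have "hilbert_space (underlying \<Omega> (point_module z))" 
    by (simp add: hilbert_space_iff P.pre_hilbert_axioms)
  then show ?thesis
    by (rule hilbert_moduleI[OF mod, of 1]) 
       (auto simp: norm_mult intro!: mult_right_mono norm_le_A_norm z)
qed

text \<open>
  A module map into \<open>\<complex>\<^sub>z\<close> with its bound \<open>B\<close>. The bound is a parameter because it has to be uniform in \<open>z\<close>.
\<close>

definition functional_at :: "(complex ^ 'm) set \<Rightarrow> ('m, 'a) hmod \<Rightarrow> complex ^ 'm \<Rightarrow> ('a \<Rightarrow> complex) \<Rightarrow> real \<Rightarrow> bool" where
  "functional_at \<Omega> M z \<Lambda> B \<longleftrightarrow> 0 \<le> B \<and>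
    (\<forall>x\<in>carrier M. \<forall>y\<in>carrier M. \<Lambda> (x \<oplus>\<^bsub>M\<^esub> y) = \<Lambda> x + \<Lambda> y) \<and>
    (\<forall>\<phi>\<in>A_carrier \<Omega>. \<forall>x\<in>carrier M. \<Lambda> (\<phi> \<odot>\<^bsub>M\<^esub> x) = \<phi> z * \<Lambda> x) \<and>
    (\<forall>x\<in>carrier M. cmod (\<Lambda> x) \<le> B * hnorm M x)"

lemma (in pre_hilb_module) functional_at_simps:
  assumes "functional_at \<Omega> M z \<Lambda> B" "z \<in> \<Omega>"
  shows "\<lbrakk>x \<in> carrier M; y \<in> carrier M\<rbrakk> \<Longrightarrow> \<Lambda> (x \<oplus> y) = \<Lambda> x + \<Lambda> y"
    "\<lbrakk>\<phi> \<in> A_carrier \<Omega>; x \<in> carrier M\<rbrakk> \<Longrightarrow> \<Lambda> (\<phi> \<odot> x) = \<phi> z * \<Lambda> x"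
    "x \<in> carrier M \<Longrightarrow> cmod (\<Lambda> x) \<le> B * hnorm M x" "0 \<le> B"
    "x \<in> carrier M \<Longrightarrow> \<Lambda> (A_const \<Omega> c \<odot> x) = c * \<Lambda> x"
    "\<lbrakk>x \<in> carrier M; y \<in> carrier M\<rbrakk> \<Longrightarrow> \<Lambda> (x \<ominus> y) = \<Lambda> x - \<Lambda> y" "\<Lambda> \<zero> = 0"
proof -
  show a: "\<And>x y. \<lbrakk>x \<in> carrier M; y \<in> carrier M\<rbrakk> \<Longrightarrow> \<Lambda> (x \<oplus> y) = \<Lambda> x + \<Lambda> y"
    and s: "\<And>\<phi> x. \<lbrakk>\<phi> \<in> A_carrier \<Omega>; x \<in> carrier M\<rbrakk> \<Longrightarrow> \<Lambda> (\<phi> \<odot> x) = \<phi> z * \<Lambda> x"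
    and "\<And>x. x \<in> carrier M \<Longrightarrow> cmod (\<Lambda> x) \<le> B * hnorm M x" "0 \<le> B"
    using assms(1) by (auto simp: functional_at_def)
  show c: "\<Lambda> (A_const \<Omega> c \<odot> x) = c * \<Lambda> x" if "x \<in> carrier M" for x c
    using s[OF A_const_in that, of c] assms(2) by (simp add: A_alg_eval in_closure)
  show "\<Lambda> (x \<ominus> y) = \<Lambda> x - \<Lambda> y" if "x \<in> carrier M" "y \<in> carrier M" for x y
    using a[of x "\<ominus> y"] c[of y "-1"] H.minus_smult[of y 1] H.one_smult[of y] that 
    by (simp add: a_minus_def)
  show "\<Lambda> \<zero> = 0" using a[of "\<zero>" "\<zero>"] by simp
qed

locale fibre = hilb_module \<Omega> M for \<Omega> :: "(complex ^ 'm) set" and M :: "('m, 'a) hmod" (structure) +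
  fixes z :: "complex ^ 'm"
  assumes z: "z \<in> \<Omega>"
begin

sublocale tensor_modules \<Omega> M "point_module z"
  by (intro tensor_modules.intro hilb_module_axioms hilb_module.intro bounded_domain_axioms hilb_module_axioms.intro 
      hilbert_module_point z)

definition "\<tau> x = htens M (point_module z) x 1"
abbreviation "pt x \<equiv> mtens \<Omega> M (point_module z) x 1"

lemma tau_closed [simp]: "x \<in> carrier M \<Longrightarrow> \<tau> x \<in> carrier T" by (simp add: \<tau>_def htens_closed)

lemma tau_add: "\<lbrakk>x \<in> carrier M; y \<in> carrier M\<rbrakk> \<Longrightarrow> \<tau> (x \<oplus> y) = \<tau> x \<oplus>\<^bsub>T\<^esub> \<tau> y"
  by (simp add: \<tau>_def htens_add)

lemma tau_action: "\<lbrakk>\<phi> \<in> A_carrier \<Omega>; x \<in> carrier M\<rbrakk> \<Longrightarrow> \<tau> (\<phi> \<odot> x) = \<phi> \<odot>\<^bsub>T\<^esub> \<tau> x"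
  by (simp add: \<tau>_def action_htens)

lemma tau_zero: "\<tau> \<zero> = \<zero>\<^bsub>T\<^esub>" by (simp add: \<tau>_def htens_zero_left)

lemma tau_minus: "\<lbrakk>x \<in> carrier M; y \<in> carrier M\<rbrakk> \<Longrightarrow> \<tau> (x \<ominus> y) = \<tau> x \<ominus>\<^bsub>T\<^esub> \<tau> y"
  using tau_add[of x "\<ominus> y"] tau_action[OF A_const_in, of y "-1"] H.minus_smult[of y 1] H.one_smult[of y]
    T.H.minus_smult[of "\<tau> y" 1] T.H.one_smult[of "\<tau> y"]
  by (simp add: a_minus_def)

lemma hnorm_tau: "x \<in> carrier M \<Longrightarrow> hnorm T (\<tau> x) = hnorm M x"
  by (simp add: \<tau>_def hnorm_htens)

lemma htens_tau: "x \<in> carrier M \<Longrightarrow> htens M (point_module z) x c = \<tau> (A_const \<Omega> c \<odot> x)"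
  using htens_const_right[of x 1 c] z by (simp add: \<tau>_def A_alg_eval in_closure)

lemma fsum_tau:
  "t \<in> fsums M (point_module z) \<Longrightarrow> \<exists>h\<in>carrier M. fsum_class M (point_module z) (\<lambda>n. t) = \<tau> h"
proof (induction t)
  case Nil
  show ?case using tau_zero by (intro bexI[of _ "\<zero>"]) (auto simp: htensor_def)
next
  case (Cons p t)
  obtain x c where p: "p = (x, c)" by force
  have x: "x \<in> carrier M" and t: "t \<in> fsums M (point_module z)" using Cons.prems p by (auto simp: fsums_def)
  obtain h where h: "h \<in> carrier M" "fsum_class M (point_module z) (\<lambda>n. t) = \<tau> h" using Cons.IH t by auto
  have "fsum_class M (point_module z) (\<lambda>n. p # t) = 
      htens M (point_module z) x c \<oplus>\<^bsub>T\<^esub> fsum_class M (point_module z) (\<lambda>n. t)"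
    using TP.cls_add[of "\<lambda>n. [(x, c)]" "\<lambda>n. t"] TP.CS_const[of t] TP.CS_const[of "[(x, c)]"] x t p
    by (simp add: htens_def fsums_def underlying_all)
  also have "\<dots> = \<tau> (A_const \<Omega> c \<odot> x \<oplus> h)"
    using x h by (simp add: htens_tau tau_add action_closed A_const_in)
  finally show ?case using x h 
    by (intro bexI[of _ "A_const \<Omega> c \<odot> x \<oplus> h"]) (auto intro: action_closed A_const_in)
qed

text \<open>
  A finite sum \<open>\<Sum> x\<^sub>i \<otimes> c\<^sub>i\<close> equals \<open>(\<Sum> c\<^sub>i x\<^sub>i) \<otimes> 1\<close>. Since \<open>\<tau>\<close> is isometric and \<open>M\<close> is complete, limits of
  such sums are again of the form \<open>x \<otimes> 1\<close>.
\<close>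

lemma carrier_T: "carrier T = \<tau> ` carrier M"
proof
  show "carrier T \<subseteq> \<tau> ` carrier M"
  proof
    fix X assume "X \<in> carrier T"
    then obtain s where s: "s \<in> fsum_Cauchy M (point_module z)" "X = fsum_class M (point_module z) s"
      by (rule T_cases)
    note F = TP.CS_Fs[simplified, OF s(1)]
    have "\<forall>n. \<exists>h\<in>carrier M. fsum_class M (point_module z) (\<lambda>k. s n) = \<tau> h"
      using fsum_tau F by blast
    then obtain h where h: "\<And>n. h n \<in> carrier M" 
      "\<And>n. fsum_class M (point_module z) (\<lambda>k. s n) = \<tau> (h n)" by metis
    have D: "fsum_dist M (point_module z) (s m) t = hnorm M (h m \<ominus> y)"
      if "t \<in> fsums M (point_module z)" "fsum_class M (point_module z) (\<lambda>k. t) = \<tau> y" "y \<in> carrier M" for m t y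
      using TP.hnorm_cls_const_minus[of "s m" t] F[of m] that h 
      by (simp add: underlying_all tau_minus[symmetric] hnorm_tau)
    have "\<forall>e>0. \<exists>N. \<forall>m\<ge>N. \<forall>n\<ge>N. hnorm M (h m \<ominus> h n) < e"
      using s(1) D[OF F h(2) h(1)] by (simp add: fsum_Cauchy_def)
    then obtain x where x: "x \<in> carrier M" "(\<lambda>n. hnorm M (h n \<ominus> x)) \<longlonglongrightarrow> 0"
      using complete[unfolded H.mcomplete_iff, rule_format, of h] h(1) by auto
    have l: "[(x, 1)] \<in> fsums M (point_module z)" using x by (simp add: fsums_def)
    have "(\<lambda>n. fsum_dist M (point_module z) (s n) [(x, 1)]) \<longlonglongrightarrow> 0"
      using x D[OF l _ x(1)] by (simp add: \<tau>_def htens_def)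
    then have "X = \<tau> x" 
      using TP.cls_eq_iff[of s "\<lambda>n. [(x, 1)]"] TP.CS_const[of "[(x, 1)]"] l s 
      by (simp add: \<tau>_def htens_def)
    then show "X \<in> \<tau> ` carrier M" using x by blast
  qed
qed auto

lemma pt_eq: "pt x = \<pi> (\<tau> x)" by (simp add: mtens_eq \<tau>_def)

lemma carrier_pt: "carrier Q = pt ` carrier M" by (simp add: carrier_Q carrier_T image_image pt_eq)

lemma pt_closed [simp]: "x \<in> carrier M \<Longrightarrow> pt x \<in> carrier Q" by (simp add: carrier_pt)

lemma pt_add: "\<lbrakk>x \<in> carrier M; y \<in> carrier M\<rbrakk> \<Longrightarrow> pt (x \<oplus> y) = pt x \<oplus>\<^bsub>Q\<^esub> pt y"
  by (simp add: pt_eq tau_add add_Q)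

lemma pt_minus: "\<lbrakk>x \<in> carrier M; y \<in> carrier M\<rbrakk> \<Longrightarrow> pt (x \<ominus> y) = pt x \<ominus>\<^bsub>Q\<^esub> pt y"
  by (simp add: pt_eq tau_minus module_Q(3))

lemma pt_zero: "pt \<zero> = \<zero>\<^bsub>Q\<^esub>" by (simp add: pt_eq tau_zero zero_Q)

lemma pt_const: "x \<in> carrier M \<Longrightarrow> pt (A_const \<Omega> c \<odot> x) = A_const \<Omega> c \<odot>\<^bsub>Q\<^esub> pt x"
  by (simp add: pt_eq tau_action smult_Q A_const_in)

lemma pt_action:
  assumes "\<phi> \<in> A_carrier \<Omega>" "x \<in> carrier M" shows "pt (\<phi> \<odot> x) = A_const \<Omega> (\<phi> z) \<odot>\<^bsub>Q\<^esub> pt x"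
proof -
  have "\<tau> (\<phi> \<odot> x) \<ominus>\<^bsub>T\<^esub> \<tau> (A_const \<Omega> (\<phi> z) \<odot> x) \<in> tensor_kernel \<Omega> M (point_module z)"
    using relator_in[of \<phi> x 1] assms htens_tau[of x "\<phi> z"] by (simp add: \<tau>_def)
  then have "pt (\<phi> \<odot> x) = pt (A_const \<Omega> (\<phi> z) \<odot> x)"
    using assms by (simp add: pt_eq pi_eq_iff action_closed A_const_in)
  then show ?thesis using pt_const assms by simp
qed

lemma hnorm_pt_le: "x \<in> carrier M \<Longrightarrow> hnorm Q (pt x) \<le> hnorm M x"
  using p_le[of "\<tau> x"] by (simp add: pt_eq hnorm_Q hnorm_tau)

lemma pt_approx:
  assumes "x \<in> carrier M" "e > 0" 
  obtains y where "y \<in> carrier M" "pt y = pt x" "hnorm M y < hnorm Q (pt x) + e"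
proof -
  obtain Y where "Y \<in> carrier T" "\<pi> Y = \<pi> (\<tau> x)" "hnorm T Y < p (\<tau> x) + e"
    using p_approx[of "\<tau> x" e] assms by auto
  then show thesis using that assms carrier_T by (auto simp: pt_eq hnorm_Q hnorm_tau)
qed

text \<open>
  The tensors \<open>\<tau> h\<close> with \<open>\<Lambda> h = 0\<close> form a closed submodule. It contains the relators, hence the kernel by
  which the fibre is formed.
\<close>

lemma functional_factors:
  assumes \<Lambda>: "functional_at \<Omega> M z \<Lambda> B" and xy: "x \<in> carrier M" "y \<in> carrier M" "pt x = pt y"
  shows "\<Lambda> x = \<Lambda> y"
proof -
  note L = functional_at_simps[OF \<Lambda> z]
  define K where "K = \<tau> ` {h \<in> carrier M. \<Lambda> h = 0}"
  have KI: "\<tau> h \<in> K" if "h \<in> carrier M" "\<Lambda> h = 0" for h using that by (auto simp: K_def)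
  have "submodule K (A_alg \<Omega>) T"
  proof (rule T.mod.submoduleI)
    show "K \<subseteq> carrier T" by (auto simp: K_def)
    show "\<zero>\<^bsub>T\<^esub> \<in> K" unfolding tau_zero[symmetric] by (rule KI) (simp_all add: L)
    show "\<ominus>\<^bsub>T\<^esub> X \<in> K" if X: "X \<in> K" for X
    proof -
      obtain h where h: "h \<in> carrier M" "\<Lambda> h = 0" "X = \<tau> h" using X by (auto simp: K_def)
      have "\<ominus>\<^bsub>T\<^esub> X = \<tau> (\<zero> \<ominus> h)" using h by (simp add: tau_minus tau_zero) (simp add: a_minus_def)
      then show ?thesis using h by (simp add: KI L)
    qed
    show "X \<oplus>\<^bsub>T\<^esub> Y \<in> K" if "X \<in> K" "Y \<in> K" for X Y
      using that by (auto simp: K_def tau_add[symmetric] L)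
    show "\<phi> \<odot>\<^bsub>T\<^esub> X \<in> K" if "\<phi> \<in> carrier (A_alg \<Omega>)" "X \<in> K" for \<phi> X
      using that by (auto simp: K_def tau_action[symmetric] L action_closed)
  qed
  moreover have "closedin (htop T) K"
    unfolding T.H.closedin_iff
  proof (intro conjI ballI impI)
    show "K \<subseteq> carrier T" by (auto simp: K_def)
    fix X assume "X \<in> carrier T" and ap: "\<forall>e>0. \<exists>Y\<in>K. hnorm T (X \<ominus>\<^bsub>T\<^esub> Y) < e"
    then obtain h where h: "h \<in> carrier M" "X = \<tau> h" by (auto simp: carrier_T)
    have "cmod (\<Lambda> h) \<le> 0 + e" if e: "e > 0" for e
    proof -
      have "e / (B + 1) > 0" using e L(4) by simp
      then obtain k where k: "k \<in> carrier M" "\<Lambda> k = 0" "hnorm T (X \<ominus>\<^bsub>T\<^esub> \<tau> k) < e / (B + 1)" 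
        using ap unfolding K_def by auto
      have "cmod (\<Lambda> h) = cmod (\<Lambda> (h \<ominus> k))" using h k by (simp add: L)
      also have "\<dots> \<le> B * hnorm M (h \<ominus> k)" using h k by (intro L(3)) auto
      also have "\<dots> \<le> B * (e / (B + 1))" 
        using k h L(4) by (intro mult_left_mono) (auto simp: tau_minus[symmetric] hnorm_tau)
      also have "\<dots> \<le> e" using e L(4) by (simp add: field_simps)
      finally show ?thesis by simp
    qed
    then have "cmod (\<Lambda> h) \<le> 0" by (rule field_le_epsilon)
    then show "X \<in> K" using h by (simp add: KI)
  qed
  ultimately have cl: "closed_submodule \<Omega> T K" by (simp add: closed_submodule_def)
  have "tensor_kernel \<Omega> M (point_module z) \<subseteq> K"
  proof (rule tensor_kernel_least[OF cl])
    fix \<phi> x c assume a: "\<phi> \<in> A_carrier \<Omega>" "x \<in> carrier M"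
    have "htens M (point_module z) (\<phi> \<odot> x) c \<ominus>\<^bsub>T\<^esub> htens M (point_module z) x (\<phi> \<odot>\<^bsub>point_module z\<^esub> c)
      = \<tau> (A_const \<Omega> c \<odot> (\<phi> \<odot> x) \<ominus> A_const \<Omega> (\<phi> z * c) \<odot> x)"
      using a by (simp add: htens_tau tau_minus action_closed A_const_in)
    also have "\<dots> \<in> K" using a by (intro KI) (auto simp: L action_closed A_const_in A_alg_eval in_closure z)
    finally show "htens M (point_module z) (\<phi> \<odot> x) c \<ominus>\<^bsub>T\<^esub> 
      htens M (point_module z) x (\<phi> \<odot>\<^bsub>point_module z\<^esub> c) \<in> K" .
  qed
  then have "\<tau> x \<ominus>\<^bsub>T\<^esub> \<tau> y \<in> K" using xy by (auto simp: pt_eq pi_eq_iff)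
  then obtain h where h: "h \<in> carrier M" "\<Lambda> h = 0" "\<tau> (x \<ominus> y) = \<tau> h" 
    using xy by (auto simp: K_def tau_minus)
  have "hnorm M ((x \<ominus> y) \<ominus> h) = 0"
    using h xy hnorm_tau[of "(x \<ominus> y) \<ominus> h"] T.H.hnorm_minus_eq_0_iff[of "\<tau> h" "\<tau> h"]
    by (simp add: tau_minus[of "x \<ominus> y" h])
  then have "x \<ominus> y = h" using h xy by (simp add: H.hnorm_minus_eq_0_iff)
  then have "\<Lambda> x - \<Lambda> y = 0" using L(6)[OF xy(1,2)] h by simp
  then show ?thesis by simp
qed

end

section \<open>Linear combinations and square summable sequences\<close>

context Module.module
begin

lemma lincombs_zero: "\<zero>\<^bsub>M\<^esub> \<in> lincombs R M S"
  unfolding lincombs_def by (rule CollectI, rule exI[of _ "{}"], rule exI[of _ "\<lambda>_. \<zero>"]) simp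

lemma lincombs_closed: "S \<subseteq> carrier M \<Longrightarrow> lincombs R M S \<subseteq> carrier M"
  unfolding lincombs_def by (auto intro!: M.finsum_closed)

lemma lincombs_insert:
  assumes S: "S \<subseteq> carrier M" and x: "x \<in> S" and a: "a \<in> carrier R" and w: "w \<in> lincombs R M S"
  shows "a \<odot>\<^bsub>M\<^esub> x \<oplus>\<^bsub>M\<^esub> w \<in> lincombs R M S"
proof -
  obtain F b where F: "finite F" "F \<subseteq> S" "b \<in> F \<rightarrow> carrier R" "w = (\<Oplus>\<^bsub>M\<^esub>y\<in>F. b y \<odot>\<^bsub>M\<^esub> y)"
    using w by (auto simp: lincombs_def)
  have cl: "\<And>y. y \<in> F \<Longrightarrow> b y \<odot>\<^bsub>M\<^esub> y \<in> carrier M" using F S by (meson PiE smult_closed subsetD)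
  have xM: "x \<in> carrier M" using x S by auto
  \<comment> \<open>\<open>x\<close> may already occur in \<open>w\<close>; then its two coefficients are added\<close>
  define b' where "b' = b(x := if x \<in> F then a \<oplus> b x else a)"
  have eq: "(\<Oplus>\<^bsub>M\<^esub>y\<in>F - {x}. b' y \<odot>\<^bsub>M\<^esub> y) = (\<Oplus>\<^bsub>M\<^esub>y\<in>F - {x}. b y \<odot>\<^bsub>M\<^esub> y)"
    using cl by (intro M.finsum_cong') (auto simp: b'_def)
  have cl': "(\<lambda>y. b y \<odot>\<^bsub>M\<^esub> y) \<in> F - {x} \<rightarrow> carrier M" using cl by auto
  have cl'': "(\<lambda>y. b' y \<odot>\<^bsub>M\<^esub> y) \<in> F - {x} \<rightarrow> carrier M"
    by (intro Pi_I) (use cl in \<open>simp add: b'_def\<close>)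
  have bx: "b' x \<in> carrier R" using a F(3) by (auto simp: b'_def)
  have "(\<Oplus>\<^bsub>M\<^esub>y\<in>insert x (F - {x}). b' y \<odot>\<^bsub>M\<^esub> y) = b' x \<odot>\<^bsub>M\<^esub> x \<oplus>\<^bsub>M\<^esub> (\<Oplus>\<^bsub>M\<^esub>y\<in>F - {x}. b y \<odot>\<^bsub>M\<^esub> y)"
    using F(1) cl'' bx xM by (subst M.finsum_insert) (auto simp: eq)
  also have "\<dots> = a \<odot>\<^bsub>M\<^esub> x \<oplus>\<^bsub>M\<^esub> w"
  proof (cases "x \<in> F")
    case True
    have bF: "b x \<in> carrier R" using F(3) True by auto
    have "w = (\<Oplus>\<^bsub>M\<^esub>y\<in>insert x (F - {x}). b y \<odot>\<^bsub>M\<^esub> y)" using True F(4) by (simp add: insert_absorb)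
    also have "\<dots> = b x \<odot>\<^bsub>M\<^esub> x \<oplus>\<^bsub>M\<^esub> (\<Oplus>\<^bsub>M\<^esub>y\<in>F - {x}. b y \<odot>\<^bsub>M\<^esub> y)"
      using F(1) cl' bF xM by (subst M.finsum_insert) auto
    finally show ?thesis using True a bF xM cl' 
      by (simp add: b'_def smult_l_distr M.a_assoc)
  next
    case False
    then show ?thesis using F by (simp add: b'_def)
  qed
  finally have e: "a \<odot>\<^bsub>M\<^esub> x \<oplus>\<^bsub>M\<^esub> w = (\<Oplus>\<^bsub>M\<^esub>y\<in>insert x (F - {x}). b' y \<odot>\<^bsub>M\<^esub> y)" by simp
  have "b' \<in> insert x (F - {x}) \<rightarrow> carrier R" using bx F(3) by (auto simp: b'_def)
  then show ?thesis unfolding lincombs_def e using F x by blast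
qed

text \<open>
  With \<open>lincombs_insert\<close>, this describes linear combinations as what arises from zero by adding
  multiples of generators. It spares all later proofs the finite sums.
\<close>

lemma lincombs_induct [consumes 2, case_names zero insert]:
  assumes S: "S \<subseteq> carrier M" and u: "u \<in> lincombs R M S"
    and 0: "P \<zero>\<^bsub>M\<^esub>" 
    and ins: "\<And>a x w. \<lbrakk>a \<in> carrier R; x \<in> S; w \<in> lincombs R M S; P w\<rbrakk> \<Longrightarrow> P (a \<odot>\<^bsub>M\<^esub> x \<oplus>\<^bsub>M\<^esub> w)"
  shows "P u"
proof -
  have "P (\<Oplus>\<^bsub>M\<^esub>y\<in>F. b y \<odot>\<^bsub>M\<^esub> y)" if "finite F" "F \<subseteq> S" "b \<in> F \<rightarrow> carrier R" for F b
    using that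
  proof (induction F)
    case (insert x F)
    have cl: "(\<lambda>y. b y \<odot>\<^bsub>M\<^esub> y) \<in> F \<rightarrow> carrier M" "b x \<odot>\<^bsub>M\<^esub> x \<in> carrier M" using insert.prems S by auto
    have "(\<Oplus>\<^bsub>M\<^esub>y\<in>F. b y \<odot>\<^bsub>M\<^esub> y) \<in> lincombs R M S"
      unfolding lincombs_def using insert by blast
    then show ?case using insert cl by (subst M.finsum_insert) (auto intro!: ins)
  qed (simp add: 0)
  then show ?thesis using u by (auto simp: lincombs_def)
qed

lemma lincombs_add:
  assumes S: "S \<subseteq> carrier M" and "u \<in> lincombs R M S" "w \<in> lincombs R M S"
  shows "u \<oplus>\<^bsub>M\<^esub> w \<in> lincombs R M S"
  using assms
proof (induction rule: lincombs_induct)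
  case zero
  then show ?case using lincombs_closed[OF S] by auto
next
  case (insert a x v)
  have "a \<odot>\<^bsub>M\<^esub> x \<oplus>\<^bsub>M\<^esub> v \<oplus>\<^bsub>M\<^esub> w = a \<odot>\<^bsub>M\<^esub> x \<oplus>\<^bsub>M\<^esub> (v \<oplus>\<^bsub>M\<^esub> w)"
    using insert lincombs_closed[OF S] S by (intro M.a_assoc) auto
  then show ?case using lincombs_insert[OF S insert(2,1)] insert by simp
qed

lemma lincombs_smult:
  assumes S: "S \<subseteq> carrier M" and "u \<in> lincombs R M S" and c: "c \<in> carrier R"
  shows "c \<odot>\<^bsub>M\<^esub> u \<in> lincombs R M S"
  using assms(1,2)
proof (induction rule: lincombs_induct)
  case zero
  then show ?case using lincombs_zero smult_r_null[OF c] by simp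
next
  case (insert a x v)
  have "c \<odot>\<^bsub>M\<^esub> (a \<odot>\<^bsub>M\<^esub> x \<oplus>\<^bsub>M\<^esub> v) = (c \<otimes> a) \<odot>\<^bsub>M\<^esub> x \<oplus>\<^bsub>M\<^esub> c \<odot>\<^bsub>M\<^esub> v"
    using insert lincombs_closed[OF S] S c by (simp add: smult_r_distr smult_assoc1 subset_iff)
  then show ?case using lincombs_insert[OF S insert(2)] insert c by simp
qed

lemma lincombs_gen:
  assumes S: "S \<subseteq> carrier M" and "x \<in> S" shows "x \<in> lincombs R M S"
  using lincombs_insert[OF S assms(2) R.one_closed lincombs_zero] assms by (simp add: subset_iff)

end

lemma summable_mult_square:
  fixes a b :: "nat \<Rightarrow> complex"
  assumes "summable (\<lambda>i. (cmod (a i))\<^sup>2)" "summable (\<lambda>i. (cmod (b i))\<^sup>2)"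
  shows "summable (\<lambda>i. a i * b i)"
proof (rule summable_comparison_test')
  show "summable (\<lambda>i. (cmod (a i))\<^sup>2 + (cmod (b i))\<^sup>2)" by (intro summable_add assms)
  show "norm (a i * b i) \<le> (cmod (a i))\<^sup>2 + (cmod (b i))\<^sup>2" for i
    unfolding norm_mult
    using sum_squares_bound[of "cmod (a i)" "cmod (b i)"] 
      mult_nonneg_nonneg[OF norm_ge_zero norm_ge_zero, of "a i" "b i"] by linarith
qed

lemma summable_square_add:
  fixes a b :: "nat \<Rightarrow> complex"
  assumes "summable (\<lambda>i. (cmod (a i))\<^sup>2)" "summable (\<lambda>i. (cmod (b i))\<^sup>2)"
  shows "summable (\<lambda>i. (cmod (a i + b i))\<^sup>2)"
proof (rule summable_comparison_test')
  show "summable (\<lambda>i. 2 * (cmod (a i))\<^sup>2 + 2 * (cmod (b i))\<^sup>2)" by (intro summable_add summable_mult assms)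
  show "norm ((cmod (a i + b i))\<^sup>2) \<le> 2 * (cmod (a i))\<^sup>2 + 2 * (cmod (b i))\<^sup>2" for i
  proof -
    have "(cmod (a i + b i))\<^sup>2 \<le> (cmod (a i) + cmod (b i))\<^sup>2" by (intro power_mono norm_triangle_ineq) auto
    also have "\<dots> \<le> 2 * (cmod (a i))\<^sup>2 + 2 * (cmod (b i))\<^sup>2"
      using sum_squares_bound[of "cmod (a i)" "cmod (b i)"] by (simp add: power2_sum)
    finally show ?thesis by simp
  qed
qed

lemma ell2_simps:
  "a \<in> carrier (ell2 k) \<longleftrightarrow> (\<forall>i. \<not> enat i < k \<longrightarrow> a i = 0) \<and> summable (\<lambda>i. (cmod (a i))\<^sup>2)"
  "zero (ell2 k) = (\<lambda>i. 0)" "add (ell2 k) = (\<lambda>a b i. a i + b i)" "smult (ell2 k) = (\<lambda>c a i. c * a i)"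
  "hinner (ell2 k) a b = (\<Sum>i. a i * cnj (b i))"
  by (auto simp: ell2_def)

lemma ell2_inner_self:
  assumes "summable (\<lambda>i. (cmod (a i))\<^sup>2)"
  shows "hinner (ell2 k) a a = of_real (\<Sum>i. (cmod (a i))\<^sup>2)"
proof -
  have "(\<lambda>i. a i * cnj (a i)) = (\<lambda>i. of_real ((cmod (a i))\<^sup>2))" 
    by (simp only: complex_norm_square)
  then show ?thesis unfolding ell2_simps by (simp only: suminf_of_real[OF assms])
qed

lemma hnorm_ell2: 
  "summable (\<lambda>i. (cmod (a i))\<^sup>2) \<Longrightarrow> hnorm (ell2 k) a = sqrt (\<Sum>i. (cmod (a i))\<^sup>2)"
  by (simp add: hnorm_def ell2_inner_self)

lemma pre_hilbert_ell2: "pre_hilbert (ell2 k)"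
proof (intro pre_hilbert.intro pre_hilbert_axioms.intro)
  show "Module.module complex_ring (ell2 k)"
  proof (rule moduleI[OF cring_complex_ring])
    show "abelian_group (ell2 k)"
    proof (rule abelian_groupI)
      show "\<exists>y\<in>carrier (ell2 k). y \<oplus>\<^bsub>ell2 k\<^esub> x = \<zero>\<^bsub>ell2 k\<^esub>" if "x \<in> carrier (ell2 k)" for x
        using that by (intro bexI[of _ "\<lambda>i. - x i"]) (auto simp: ell2_simps)
    qed (auto simp: ell2_simps add.assoc add.commute intro: summable_square_add)
  qed (auto simp: ell2_simps norm_mult power_mult_distrib algebra_simps intro: summable_mult)
  show "hinner (ell2 k) (x \<oplus>\<^bsub>ell2 k\<^esub> y) w = hinner (ell2 k) x w + hinner (ell2 k) y w"
    if "x \<in> carrier (ell2 k)" "y \<in> carrier (ell2 k)" "w \<in> carrier (ell2 k)" for x y w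
    using that by (auto simp: ell2_simps distrib_right intro!: suminf_add[symmetric] summable_mult_square)
  show "hinner (ell2 k) (c \<odot>\<^bsub>ell2 k\<^esub> x) w = c * hinner (ell2 k) x w"
    if "x \<in> carrier (ell2 k)" "w \<in> carrier (ell2 k)" for x w c
    using that by (auto simp: ell2_simps mult.assoc intro!: suminf_mult summable_mult_square)
  show "hinner (ell2 k) w x = cnj (hinner (ell2 k) x w)"
    if "x \<in> carrier (ell2 k)" "w \<in> carrier (ell2 k)" for x w
  proof -
    have s: "summable (\<lambda>i. x i * cnj (w i))" using that by (auto simp: ell2_simps intro!: summable_mult_square)
    have "(\<lambda>i. cnj (x i * cnj (w i))) sums cnj (\<Sum>i. x i * cnj (w i))"
      by (rule sums_cnj[THEN iffD2, OF summable_sums[OF s]])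
    then show ?thesis by (simp add: ell2_simps sums_iff mult.commute)
  qed
  show "0 \<le> Re (hinner (ell2 k) x x)" if "x \<in> carrier (ell2 k)" for x
    using that by (simp add: ell2_inner_self ell2_simps(1) suminf_nonneg)
  show "x = \<zero>\<^bsub>ell2 k\<^esub>" if "x \<in> carrier (ell2 k)" "hinner (ell2 k) x x = 0" for x
  proof -
    have s: "summable (\<lambda>i. (cmod (x i))\<^sup>2)" using that by (simp add: ell2_simps)
    have "(\<Sum>i. (cmod (x i))\<^sup>2) = 0" using that(2) ell2_inner_self[OF s] by simp
    then have "\<forall>i. (cmod (x i))\<^sup>2 = 0" using suminf_eq_zero_iff[OF s] by simp
    then show ?thesis by (auto simp: ell2_simps)
  qed
qed

lemma ell2_basis_in: "enat i < k \<Longrightarrow> ell2_basis i \<in> carrier (ell2 k)"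
  by (auto simp: ell2_simps ell2_basis_def intro!: summable_finite[of "{i}"] split: if_splits)

lemma hnorm_ell2_basis: "hnorm (ell2 k) (ell2_basis i) = 1"
proof -
  have "(\<lambda>j. (cmod (ell2_basis i j))\<^sup>2) = (\<lambda>j. if j = i then 1 else 0)" by (auto simp: ell2_basis_def)
  moreover have "summable (\<lambda>j. if j = i then 1 else 0 :: real)" by (rule summable_finite[of "{i}"]) auto
  moreover have "(\<Sum>j. if j = i then 1 else 0 :: real) = 1" using suminf_finite[of "{i}" "\<lambda>j. if j = i then 1 else 0 :: real"] by simp
  ultimately show ?thesis by (subst hnorm_ell2) simp_all
qed

text \<open>
  Lines are closed: since \<open>\<parallel>c v - d v\<parallel> = \<bar>c - d\<bar> \<parallel>v\<parallel>\<close>, the coefficients of approximations of \<open>u\<close> form a Cauchy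
  sequence.
\<close>

lemma (in normed_space) closed_line:
  assumes v: "v \<in> carrier H" "v \<noteq> \<zero>" and u: "u \<in> carrier H"
    and ap: "\<And>e. e > 0 \<Longrightarrow> \<exists>c. hnorm H (u \<ominus> c \<odot> v) < e"
  shows "\<exists>c. u = c \<odot> v"
proof -
  have nv: "hnorm H v > 0" using v by (metis hnorm_eq_0D hnorm_nonneg order_le_less)
  have cv: "c \<odot> v \<in> carrier H" for c using smult_closed[of c v] v by simp
  have d: "hnorm H (c \<odot> v \<ominus> d \<odot> v) = cmod (c - d) * hnorm H v" for c d
    using smult_diff_left[OF v(1), of c d] hnorm_smult[OF v(1), of "c - d"] by simp
  have "\<exists>c. hnorm H (u \<ominus> c \<odot> v) < 1 / Suc n" for n by (rule ap) simp
  then obtain c where c: "\<And>n. hnorm H (u \<ominus> c n \<odot> v) < 1 / Suc n" by metis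
  have "Cauchy c"
  proof (rule metric_CauchyI)
    fix e :: real assume e: "e > 0"
    obtain N :: nat where N: "1 / Suc N < e * hnorm H v / 2" 
      using e nv by (metis half_gt_zero mult_pos_pos nat_approx_posE)
    have "dist (c m) (c n) < e" if "m \<ge> N" "n \<ge> N" for m n
    proof -
      have "cmod (c m - c n) * hnorm H v \<le> hnorm H (c m \<odot> v \<ominus> u) + hnorm H (u \<ominus> c n \<odot> v)"
        unfolding d[symmetric] by (intro hnorm_minus_triangle cv u)
      also have "\<dots> < 1 / Suc m + 1 / Suc n" 
        using c[of m] c[of n] hnorm_minus_commute[OF u cv[of "c m"]] by simp
      also have "\<dots> \<le> 1 / Suc N + 1 / Suc N" using that by (intro add_mono divide_left_mono) auto
      also have "\<dots> < e * hnorm H v" using N by simp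
      finally show ?thesis using nv by (simp add: dist_norm)
    qed
    then show "\<exists>M. \<forall>m\<ge>M. \<forall>n\<ge>M. dist (c m) (c n) < e" by blast
  qed
  then obtain l where l: "c \<longlonglongrightarrow> l" using Cauchy_convergent_iff convergent_def by blast
  have "(\<lambda>n. 1 / Suc n + cmod (c n - l) * hnorm H v) \<longlonglongrightarrow> 0 + 0 * hnorm H v"
  proof (intro tendsto_add tendsto_mult tendsto_const)
    show "(\<lambda>n. 1 / real (Suc n)) \<longlonglongrightarrow> 0" 
      using LIMSEQ_inverse_real_of_nat by (simp only: inverse_eq_divide)
    show "(\<lambda>n. cmod (c n - l)) \<longlonglongrightarrow> 0" using l by (simp add: LIM_zero_iff tendsto_norm_zero_iff)
  qed
  moreover have "hnorm H (u \<ominus> l \<odot> v) \<le> 1 / Suc n + cmod (c n - l) * hnorm H v" for n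
    using hnorm_minus_triangle[OF u cv[of "c n"] cv[of l]] c[of n] d[of "c n" l] by simp
  ultimately have "hnorm H (u \<ominus> l \<odot> v) \<le> 0 + 0 * hnorm H v" by (intro LIMSEQ_le_const) auto
  then have "hnorm H (u \<ominus> l \<odot> v) = 0" using u cv by (intro order_antisym) auto
  then have "u = l \<odot> v" using hnorm_minus_eq_0_iff[OF u cv] by simp
  then show ?thesis by blast
qed

section \<open>Rank one modules and a criterion for quasi-freeness\<close>

lemma (in normed_space) lincombs_singleton:
  assumes v: "v \<in> carrier H" and u: "u \<in> lincombs complex_ring H {v}"
  shows "\<exists>c. u = c \<odot> v"
proof -
  have "{v} \<subseteq> carrier H" using v by simp
  then show ?thesis using u
  proof (induction rule: lincombs_induct)
    case zero
    show ?case using zero_smult[OF v] by metis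
  next
    case (insert a x w)
    then obtain c where "w = c \<odot> v" by auto
    then have "a \<odot> x \<oplus> w = (a + c) \<odot> v" using insert v by (simp add: smult_add_left)
    then show ?case by blast
  qed
qed

lemma restrict_hnorm: "hnorm (M\<lparr>carrier := K\<rparr>) = hnorm M"
  by (simp add: hnorm_def fun_eq_iff)

lemma I_one: "{i. enat i < 1} = {0}" by (auto simp: one_enat_def)

context fibre
begin

lemma tensor_pair_ell2: "tensor_pair (underlying \<Omega> (point_module z)) (ell2 k)"
  by (intro tensor_pair.intro N.pre_hilbert_und pre_hilbert_ell2)

text \<open>
  The span of \<open>pt g\<close> is dense in the fibre and closed, so \<open>\<gamma>\<close> can be the coordinate with respect to \<open>pt g\<close>. As
  \<open>X\<close> sends \<open>pt g\<close> to a vector of norm 1, its bound is a bound of \<open>\<gamma>\<close>.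
\<close>

lemma rank_one_functional_ex:
  assumes g: "g \<in> carrier M"
    and wb: "weak_basis (underlying \<Omega> (mtensor \<Omega> M (point_module z))) {0::nat} (\<lambda>i. pt g)"
    and X: "bounded_hom complex_ring
             ((underlying \<Omega> (mtensor \<Omega> M (point_module z)))\<lparr>carrier := 
                lincombs complex_ring (underlying \<Omega> (mtensor \<Omega> M (point_module z))) {pt g}\<rparr>) 
             (underlying \<Omega> (htensor (point_module z) (ell2 1))) X B"
    and X1: "X (pt g) = htens (point_module z) (ell2 1) 1 (ell2_basis 0)"
  shows "\<exists>\<gamma>. functional_at \<Omega> M z \<gamma> \<bar>B\<bar> \<and> \<gamma> g = 1 \<and> (\<forall>x\<in>carrier M. \<gamma> x = 0 \<longrightarrow> pt x = \<zero>\<^bsub>Q\<^esub>)"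
proof -
  let ?v = "pt g"
  interpret E: tensor_pair "underlying \<Omega> (point_module z)" "ell2 1" by (rule tensor_pair_ell2)
  note wb = wb[unfolded mtensor_eq weak_basis_def underlying_all] and X = X[unfolded mtensor_eq]
  have v: "?v \<in> carrier Q" using g by simp
  have v0: "?v \<noteq> \<zero>\<^bsub>Q\<^esub>"
  proof
    assume "?v = \<zero>\<^bsub>Q\<^esub>"
    then have "(\<Oplus>\<^bsub>Q\<^esub>i\<in>{0::nat}. A_const \<Omega> 1 \<odot>\<^bsub>Q\<^esub> ?v) = \<zero>\<^bsub>Q\<^esub>"
      using Q.one_smult[of "\<zero>\<^bsub>Q\<^esub>"] by simp
    then have z: "(\<Oplus>\<^bsub>Q\<^esub>i\<in>{0::nat}. A_const \<Omega> ((\<lambda>_. 1) i) \<odot>\<^bsub>Q\<^esub> ?v) = \<zero>\<^bsub>Q\<^esub>" by simp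
    have ind: "(\<Oplus>\<^bsub>Q\<^esub>i\<in>F. A_const \<Omega> (c i) \<odot>\<^bsub>Q\<^esub> ?v) = \<zero>\<^bsub>Q\<^esub> \<Longrightarrow> finite F \<Longrightarrow> F \<subseteq> {0::nat} 
        \<Longrightarrow> i \<in> F \<Longrightarrow> c i = 0" for F c i using wb by blast
    have "(\<lambda>_. 1 :: complex) (0::nat) = 0" by (rule ind[OF z]) auto
    then show False by simp
  qed
  have nv: "hnorm Q ?v > 0" using v0 Q.hnorm_eq_0D[OF v] Q.hnorm_nonneg[OF v] by (metis order_le_less)
  have cl: "{pt g} \<subseteq> carrier (underlying \<Omega> Q)" using v by (simp add: underlying_all)
  have "\<exists>c. pt x = A_const \<Omega> c \<odot>\<^bsub>Q\<^esub> ?v" if x: "x \<in> carrier M" for x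
  proof (rule Q.closed_line[OF v v0])
    show px: "pt x \<in> carrier Q" using x by simp
    fix e :: real assume e: "e > 0"
    have "pt x \<in> htop Q closure_of lincombs complex_ring (underlying \<Omega> Q) {?v}"
      using wb px by simp
    then obtain u where u: "u \<in> lincombs complex_ring (underlying \<Omega> Q) {?v}" "hnorm Q (pt x \<ominus>\<^bsub>Q\<^esub> u) < e"
      using e unfolding Q.closure_of_eq by blast
    then show "\<exists>c. hnorm Q (pt x \<ominus>\<^bsub>Q\<^esub> A_const \<Omega> c \<odot>\<^bsub>Q\<^esub> ?v) < e"
      using Q.lincombs_singleton[OF v u(1)] by auto
  qed
  then obtain \<gamma> where \<gamma>: "\<And>x. x \<in> carrier M \<Longrightarrow> pt x = A_const \<Omega> (\<gamma> x) \<odot>\<^bsub>Q\<^esub> ?v" by metis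
  have uniq: "c = d" if "A_const \<Omega> c \<odot>\<^bsub>Q\<^esub> ?v = A_const \<Omega> d \<odot>\<^bsub>Q\<^esub> ?v" for c d
  proof -
    have dv: "A_const \<Omega> d \<odot>\<^bsub>Q\<^esub> ?v \<in> carrier Q" using Q.smult_closed[of d ?v] v by simp
    have "A_const \<Omega> (c - d) \<odot>\<^bsub>Q\<^esub> ?v = A_const \<Omega> d \<odot>\<^bsub>Q\<^esub> ?v \<ominus>\<^bsub>Q\<^esub> A_const \<Omega> d \<odot>\<^bsub>Q\<^esub> ?v"
      using Q.smult_diff_left[OF v, of c d] that by simp
    then have "cmod (c - d) * hnorm Q ?v = 0" 
      using Q.hnorm_smult[OF v, of "c - d"] Q.hnorm_minus_eq_0_iff[OF dv dv] by simp
    then show ?thesis using nv by simp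
  qed
  have cv: "A_const \<Omega> c \<odot>\<^bsub>Q\<^esub> ?v \<in> carrier Q" for c using Q.smult_closed[of c ?v] v by simp
  have \<gamma>1: "\<gamma> g = 1" by (rule uniq) (use \<gamma>[OF g] Q.one_smult[OF v] in simp)
  have add: "\<gamma> (x \<oplus> y) = \<gamma> x + \<gamma> y" if "x \<in> carrier M" "y \<in> carrier M" for x y
    by (rule uniq) (use that \<gamma>[of "x \<oplus> y"] \<gamma>[of x] \<gamma>[of y] Q.smult_add_left[OF v, of "\<gamma> x" "\<gamma> y"]
       in \<open>simp add: pt_add\<close>)
  have act: "\<gamma> (\<phi> \<odot> x) = \<phi> z * \<gamma> x" if "\<phi> \<in> A_carrier \<Omega>" "x \<in> carrier M" for \<phi> x
    by (rule uniq) (use that \<gamma>[of "\<phi> \<odot> x"] \<gamma>[of x] Q.smult_smult[OF v, of "\<phi> z" "\<gamma> x"]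
       in \<open>simp add: pt_action action_closed\<close>)
  have bound: "cmod (\<gamma> x) \<le> \<bar>B\<bar> * hnorm M x" if x: "x \<in> carrier M" for x
  proof -
    let ?L = "lincombs complex_ring (underlying \<Omega> Q) {?v}"
    have XL: "\<forall>u\<in>?L. hnorm (htensor (point_module z) (ell2 1)) (X u) \<le> B * hnorm Q u"
      and XS: "\<forall>c. \<forall>u\<in>?L. X (A_const \<Omega> c \<odot>\<^bsub>Q\<^esub> u) = A_const \<Omega> c \<odot>\<^bsub>htensor (point_module z) (ell2 1)\<^esub> X u"
      using X by (simp_all add: bounded_hom_def restrict_hnorm underlying_all)
    have vL: "?v \<in> ?L" using Q.lincombs_gen[of "{?v}" ?v] v by simp
    have "A_const \<Omega> (\<gamma> x) \<odot>\<^bsub>Q\<^esub> ?v \<in> ?L" 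
      using Q.lincombs_smult[of "{?v}" ?v "\<gamma> x"] v vL by simp
    then have b: "hnorm (htensor (point_module z) (ell2 1)) (X (A_const \<Omega> (\<gamma> x) \<odot>\<^bsub>Q\<^esub> ?v)) 
        \<le> B * hnorm Q (A_const \<Omega> (\<gamma> x) \<odot>\<^bsub>Q\<^esub> ?v)"
      using XL by blast
    have "X (A_const \<Omega> (\<gamma> x) \<odot>\<^bsub>Q\<^esub> ?v) = A_const \<Omega> (\<gamma> x) \<odot>\<^bsub>htensor (point_module z) (ell2 1)\<^esub> X ?v"
      using XS vL by blast
    then have "hnorm (htensor (point_module z) (ell2 1)) (X (A_const \<Omega> (\<gamma> x) \<odot>\<^bsub>Q\<^esub> ?v)) = cmod (\<gamma> x)"
      using E.T.hnorm_smult[of "X ?v" "\<gamma> x"] E.htens_in[of 1 "ell2_basis 0"] 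
        E.hnorm_htens[of 1 "ell2_basis 0"] ell2_basis_in[of 0 1]
      by (simp add: underlying_all X1 hnorm_ell2_basis one_enat_def)
    then have "cmod (\<gamma> x) \<le> B * hnorm Q (pt x)" using b \<gamma>[OF x] by simp
    also have "\<dots> \<le> \<bar>B\<bar> * hnorm M x" 
      using hnorm_pt_le[OF x] Q.hnorm_nonneg[of "pt x"] x by (intro mult_mono) auto
    finally show ?thesis .
  qed
  have "pt x = \<zero>\<^bsub>Q\<^esub>" if "x \<in> carrier M" "\<gamma> x = 0" for x
    using \<gamma>[OF that(1)] that(2) Q.zero_smult[OF v] by simp
  then show ?thesis using \<gamma>1 add act bound by (intro exI[of _ \<gamma>]) (auto simp: functional_at_def)
qed

end

locale rank_one = hilb_module \<Omega> R for \<Omega> :: "(complex ^ 'm) set" and R :: "('m, 'b) hmod" +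
  fixes g :: 'b and \<gamma> :: "complex ^ 'm \<Rightarrow> 'b \<Rightarrow> complex"
  assumes g: "g \<in> carrier R" and \<gamma>_g: "\<And>z. z \<in> \<Omega> \<Longrightarrow> \<gamma> z g = 1"
    and \<gamma>_bd: "\<And>z0. z0 \<in> \<Omega> \<Longrightarrow> \<exists>r>0. \<exists>B. \<forall>z\<in>\<Omega> \<inter> ball z0 r. functional_at \<Omega> R z (\<gamma> z) B"
    and \<gamma>_sep: "\<And>x. \<lbrakk>x \<in> carrier R; \<And>z. z \<in> \<Omega> \<Longrightarrow> \<gamma> z x = 0\<rbrakk> \<Longrightarrow> x = \<zero>\<^bsub>R\<^esub>"

theorem rank_one_functionals:
  fixes \<Omega> :: "(complex ^ 'm) set" and R :: "('m, 'b) hmod"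
  assumes "bounded_domain \<Omega>" and qf: "quasi_free_rel \<Omega> R 1 (\<lambda>_. g)"
  shows "\<exists>\<gamma>. rank_one \<Omega> R g \<gamma>"
proof -
  note qf = qf[unfolded quasi_free_rel_def Let_def I_one image_insert image_empty]
  have hm: "hilbert_module \<Omega> R" and gen: "generating \<Omega> R {g}" using qf by blast+
  have iii: "\<forall>h\<in>carrier R. (\<forall>z\<in>\<Omega>. mtens \<Omega> R (point_module z) h 1 = 
      \<zero>\<^bsub>underlying \<Omega> (mtensor \<Omega> R (point_module z))\<^esub>) \<longleftrightarrow> h = \<zero>\<^bsub>R\<^esub>" using qf by blast
  interpret hilb_module \<Omega> R 
    using assms(1) hm by (intro hilb_module.intro hilb_module_axioms.intro)
  have g: "g \<in> carrier R" using gen unfolding generating_def by blast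
  define P where "P z B \<gamma> \<longleftrightarrow> functional_at \<Omega> R z \<gamma> B \<and> \<gamma> g = 1 \<and> 
    (\<forall>x\<in>carrier R. \<gamma> x = 0 \<longrightarrow> mtens \<Omega> R (point_module z) x 1 = \<zero>\<^bsub>mtensor \<Omega> R (point_module z)\<^esub>)" for z B \<gamma>
  have loc: "\<exists>r>0. \<exists>B. \<forall>z\<in>\<Omega> \<inter> ball z0 r. \<exists>\<gamma>. P z B \<gamma>" if z0: "z0 \<in> \<Omega>" for z0
  proof -
    obtain r B where r: "r > 0" and B: "\<forall>z\<in>\<Omega> \<inter> ball z0 r. \<exists>X. bounded_hom complex_ring
             ((underlying \<Omega> (mtensor \<Omega> R (point_module z)))\<lparr>carrier := 
                lincombs complex_ring (underlying \<Omega> (mtensor \<Omega> R (point_module z))) {mtens \<Omega> R (point_module z) g 1}\<rparr>) 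
             (underlying \<Omega> (htensor (point_module z) (ell2 1))) X B \<and>
           (\<forall>i\<in>{0::nat}. X (mtens \<Omega> R (point_module z) g 1) = htens (point_module z) (ell2 1) 1 (ell2_basis i))"
      using bspec[OF qf[THEN conjunct2, THEN conjunct2, THEN conjunct2, THEN conjunct2, THEN conjunct2, THEN conjunct1] z0]
      by (elim exE conjE)
    have "\<exists>\<gamma>. P z \<bar>B\<bar> \<gamma>" if zr: "z \<in> \<Omega> \<inter> ball z0 r" for z
    proof -
      interpret fibre \<Omega> R z using zr by (intro fibre.intro hilb_module_axioms fibre_axioms.intro) simp
      have wb: "weak_basis (underlying \<Omega> (mtensor \<Omega> R (point_module z))) {0::nat} (\<lambda>i. pt g)"
        by (rule bspec[OF qf[THEN conjunct2, THEN conjunct2, THEN conjunct2, THEN conjunct2, THEN conjunct1]]) (use z in simp)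
      obtain X where X: "bounded_hom complex_ring
             ((underlying \<Omega> (mtensor \<Omega> R (point_module z)))\<lparr>carrier := 
                lincombs complex_ring (underlying \<Omega> (mtensor \<Omega> R (point_module z))) {pt g}\<rparr>) 
             (underlying \<Omega> (htensor (point_module z) (ell2 1))) X B"
        "X (pt g) = htens (point_module z) (ell2 1) 1 (ell2_basis 0)"
        using bspec[OF B zr] by (elim exE conjE) simp
      show ?thesis using rank_one_functional_ex[OF g wb X] unfolding P_def mtensor_eq .
    qed
    then show ?thesis using r by blast
  qed
  define \<gamma> where "\<gamma> z = (SOME \<gamma>. \<exists>B. P z B \<gamma>)" for z
  have \<gamma>: "\<exists>B. P z B (\<gamma> z)" if "z \<in> \<Omega>" for z
  proof -
    have "\<exists>\<gamma>. \<exists>B. P z B \<gamma>" using loc[OF that] that centre_in_ball by blast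
    then show ?thesis unfolding \<gamma>_def by (rule someI_ex)
  qed
  \<comment> \<open>the functional is unique, so that the local bounds apply to the chosen one\<close>
  have bd: "functional_at \<Omega> R z (\<gamma> z) B" if z: "z \<in> \<Omega>" and "P z B \<delta>" for z B \<delta>
  proof -
    interpret fibre \<Omega> R z using z by (intro fibre.intro hilb_module_axioms fibre_axioms.intro) simp
    obtain B' where B': "P z B' (\<gamma> z)" using \<gamma>[OF z] by auto
    note L = functional_at_simps[of z "\<gamma> z" B', OF _ z] and L' = functional_at_simps[of z \<delta> B, OF _ z]
    have f: "functional_at \<Omega> R z (\<gamma> z) B'" "functional_at \<Omega> R z \<delta> B" using B' that by (auto simp: P_def)
    have "\<gamma> z x = \<delta> x" if x: "x \<in> carrier R" for x
    proof -
      let ?y = "x \<ominus>\<^bsub>R\<^esub> A_const \<Omega> (\<delta> x) \<odot>\<^bsub>R\<^esub> g"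
      have y: "?y \<in> carrier R" using x g by (simp add: action_closed A_const_in)
      have "\<delta> ?y = 0" using \<open>P z B \<delta>\<close> x g 
        by (simp add: L'(6)[OF f(2)] L'(5)[OF f(2)] action_closed A_const_in P_def)
      then have "pt ?y = pt \<zero>\<^bsub>R\<^esub>" using y \<open>P z B \<delta>\<close> unfolding pt_zero mtensor_eq[symmetric] by (simp add: P_def)
      then have "\<gamma> z ?y = 0" using functional_factors[OF f(1) y mod.M.zero_closed] L(7)[OF f(1)] by simp
      then show ?thesis using B' x g by (simp add: L(6)[OF f(1)] L(5)[OF f(1)] action_closed A_const_in P_def)
    qed
    then show ?thesis using f(2) g by (simp add: functional_at_def action_closed)
  qed
  show ?thesis
  proof (intro exI[of _ \<gamma>] rank_one.intro rank_one_axioms.intro)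
    show "\<exists>r>0. \<exists>B. \<forall>z\<in>\<Omega> \<inter> ball z0 r. functional_at \<Omega> R z (\<gamma> z) B" if "z0 \<in> \<Omega>" for z0
      using loc[OF that] bd by (meson IntE)
    show "x = \<zero>\<^bsub>R\<^esub>" if x: "x \<in> carrier R" "\<And>z. z \<in> \<Omega> \<Longrightarrow> \<gamma> z x = 0" for x
    proof -
      have "mtens \<Omega> R (point_module z) x 1 = \<zero>\<^bsub>mtensor \<Omega> R (point_module z)\<^esub>" if "z \<in> \<Omega>" for z
        using \<gamma>[OF that] x that by (auto simp: P_def)
      then show ?thesis using iii x(1) by (auto simp: underlying_all)
    qed
  qed (use \<gamma> g hilb_module_axioms in \<open>auto simp: P_def\<close>)
qed

lemma (in fibre) pt_finsum:
  assumes "finite F" "f \<in> F \<rightarrow> carrier M"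
  shows "pt (\<Oplus>i\<in>F. A_const \<Omega> (c i) \<odot> f i) = (\<Oplus>\<^bsub>Q\<^esub>i\<in>F. A_const \<Omega> (c i) \<odot>\<^bsub>Q\<^esub> pt (f i))"
  using assms
proof (induction F)
  case (insert i F)
  have cl: "A_const \<Omega> c \<odot>\<^bsub>Q\<^esub> pt x \<in> carrier Q" if "x \<in> carrier M" for c x
    using Q.smult_closed[of c "pt x"] that by simp
  have f: "f i \<in> carrier M" "\<And>j. j \<in> F \<Longrightarrow> f j \<in> carrier M" using insert.prems by auto
  let ?S = "\<Oplus>i\<in>F. A_const \<Omega> (c i) \<odot> f i"
  have S: "?S \<in> carrier M" using f by (intro mod.M.finsum_closed) (auto intro!: action_closed A_const_in)
  have 1: "(\<Oplus>i\<in>insert i F. A_const \<Omega> (c i) \<odot> f i) = A_const \<Omega> (c i) \<odot> f i \<oplus> ?S"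
    using insert.hyps f by (intro mod.M.finsum_insert) (auto intro!: action_closed A_const_in)
  have 2: "(\<Oplus>\<^bsub>Q\<^esub>i\<in>insert i F. A_const \<Omega> (c i) \<odot>\<^bsub>Q\<^esub> pt (f i)) 
      = A_const \<Omega> (c i) \<odot>\<^bsub>Q\<^esub> pt (f i) \<oplus>\<^bsub>Q\<^esub> (\<Oplus>\<^bsub>Q\<^esub>i\<in>F. A_const \<Omega> (c i) \<odot>\<^bsub>Q\<^esub> pt (f i))"
    using insert.hyps f by (intro Q.M.finsum_insert) (auto intro!: cl)
  show ?case unfolding 1 2 pt_add[OF action_closed[OF A_const_in f(1)] S] pt_const[OF f(1)]
    using insert.IH f by auto
qed (simp add: pt_zero)

lemma (in pre_hilb_module) functional_finsum:
  assumes "functional_at \<Omega> M z \<Lambda> B" "z \<in> \<Omega>" "finite F" "f \<in> F \<rightarrow> carrier M"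
  shows "\<Lambda> (\<Oplus>i\<in>F. f i) = (\<Sum>i\<in>F. \<Lambda> (f i))"
  using assms(3,4)
proof (induction F)
  case (insert i F)
  then show ?case
    by (subst mod.M.finsum_insert) (auto simp: functional_at_simps[OF assms(1,2)])
qed (simp add: functional_at_simps[OF assms(1,2)])

context fibre
begin

text \<open>
  Linear independence holds because the dual functionals factor through the fibre. The span is dense
  because a combination \<open>\<Sum> \<phi>\<^sub>i f\<^sub>i\<close> has in the fibre the class of \<open>\<Sum> \<phi>\<^sub>i(z) f\<^sub>i\<close>.
\<close>

lemma weak_basis_fibre:
  assumes gen: "generating \<Omega> M (range f)" and \<Lambda>: "\<And>i. functional_at \<Omega> M z (\<Lambda> i) (B i)"
    and dual: "\<And>i j. \<Lambda> i (f j) = (if i = j then 1 else 0)"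
  shows "weak_basis (underlying \<Omega> Q) (UNIV :: nat set) (\<lambda>i. pt (f i))"
proof -
  have fM: "f i \<in> carrier M" for i using gen by (auto simp: generating_def)
  let ?v = "\<lambda>i. pt (f i)"
  let ?L = "lincombs complex_ring (underlying \<Omega> Q) (range ?v)"
  have vQ: "range ?v \<subseteq> carrier Q" using fM by auto
  note L = functional_at_simps[OF \<Lambda> z]
  have ind: "c i = 0" if F: "finite F" "(\<Oplus>\<^bsub>Q\<^esub>i\<in>F. A_const \<Omega> (c i) \<odot>\<^bsub>Q\<^esub> ?v i) = \<zero>\<^bsub>Q\<^esub>" "i \<in> F" for F c i
  proof -
    let ?x = "\<Oplus>i\<in>F. A_const \<Omega> (c i) \<odot> f i"
    have x: "?x \<in> carrier M" using fM by (auto intro!: mod.M.finsum_closed action_closed A_const_in)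
    have e: "pt ?x = pt \<zero>" using pt_finsum[OF F(1), of f c] F(2) fM by (simp add: pt_zero)
    have "\<Lambda> i ?x = 0" using functional_factors[OF \<Lambda> x mod.M.zero_closed e] L(7) by simp
    moreover have "\<Lambda> i ?x = (\<Sum>j\<in>F. \<Lambda> i (A_const \<Omega> (c j) \<odot> f j))"
      using fM by (intro functional_finsum[OF \<Lambda> z F(1)]) (auto intro!: action_closed A_const_in)
    moreover have "\<dots> = (\<Sum>j\<in>F. if i = j then c j else 0)"
      by (intro sum.cong refl) (simp add: L(5) fM dual)
    ultimately show ?thesis using F by simp
  qed
  have lc: "pt y \<in> ?L" if "y \<in> lincombs (A_alg \<Omega>) M (range f)" for y
  proof -
    have "range f \<subseteq> carrier M" using fM by auto
    then show ?thesis using that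
    proof (induction rule: mod.lincombs_induct)
      case zero
      show ?case using Q.lincombs_zero by (simp add: pt_zero)
    next
      case (insert \<phi> x u)
      have "u \<in> carrier M" using insert(3) mod.lincombs_closed[of "range f"] fM by auto
      then have "pt (\<phi> \<odot> x \<oplus> u) = A_const \<Omega> (\<phi> z) \<odot>\<^bsub>Q\<^esub> pt x \<oplus>\<^bsub>Q\<^esub> pt u"
        using insert(1,2) fM by (auto simp: pt_add pt_action action_closed)
      then show ?case using Q.lincombs_insert[OF vQ _ _ insert(4), of "pt x" "\<phi> z"] insert(2) by auto
    qed
  qed
  have "carrier Q \<subseteq> htop Q closure_of ?L"
  proof
    fix C assume C: "C \<in> carrier Q"
    then obtain x where x: "x \<in> carrier M" "C = pt x" by (auto simp: carrier_pt)
    have "\<exists>D\<in>?L. D \<in> carrier Q \<and> hnorm Q (C \<ominus>\<^bsub>Q\<^esub> D) < e" if e: "e > 0" for e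
    proof -
      have "x \<in> htop M closure_of lincombs (A_alg \<Omega>) M (range f)" using gen x by (simp add: generating_def)
      then obtain y where y: "y \<in> lincombs (A_alg \<Omega>) M (range f)" "y \<in> carrier M" "hnorm M (x \<ominus> y) < e" 
        using e unfolding H.closure_of_eq by blast
      have "hnorm Q (C \<ominus>\<^bsub>Q\<^esub> pt y) < e"
        using hnorm_pt_le[of "x \<ominus> y"] x y by (simp add: pt_minus)
      then show ?thesis using lc[OF y(1)] y(2) by (intro bexI[of _ "pt y"]) auto
    qed
    then show "C \<in> htop Q closure_of ?L" using C unfolding Q.closure_of_eq by blast
  qed
  moreover have "htop Q closure_of ?L \<subseteq> carrier Q" unfolding Q.closure_of_eq by blast
  ultimately have "htop Q closure_of ?L = carrier Q" by blast
  then show ?thesis unfolding weak_basis_def underlying_all using fM ind by auto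
qed

text \<open>
  The sequence of values \<open>\<Lambda> i x\<close> depends only on the class of \<open>x\<close>, and its bound passes to the norm of the
  fibre because that norm is an infimum over representatives.
\<close>

lemma fibre_map:
  assumes \<Lambda>: "\<And>i. functional_at \<Omega> M z (\<Lambda> i) (Bi i)" and B: "B \<ge> 0"
    and bd: "\<And>x. x \<in> carrier M \<Longrightarrow> 
      summable (\<lambda>i. (cmod (\<Lambda> i x))\<^sup>2) \<and> sqrt (\<Sum>i. (cmod (\<Lambda> i x))\<^sup>2) \<le> B * hnorm M x"
    and L: "L \<subseteq> carrier Q"
  shows "\<exists>X. bounded_hom complex_ring ((underlying \<Omega> Q)\<lparr>carrier := L\<rparr>) 
      (underlying \<Omega> (htensor (point_module z) (ell2 \<infinity>))) X B \<and>
    (\<forall>x\<in>carrier M. X (pt x) = htens (point_module z) (ell2 \<infinity>) 1 (\<lambda>i. \<Lambda> i x))"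
proof -
  interpret E: tensor_pair "underlying \<Omega> (point_module z)" "ell2 \<infinity>" by (rule tensor_pair_ell2)
  let ?E = "htensor (point_module z) (ell2 \<infinity>)" and ?Q = "(underlying \<Omega> Q)\<lparr>carrier := L\<rparr>"
  define pre where "pre C = (SOME x. x \<in> carrier M \<and> pt x = C)" for C
  define X where "X C = htens (point_module z) (ell2 \<infinity>) 1 (\<lambda>i. \<Lambda> i (pre C))" for C
  note F = functional_at_simps[OF \<Lambda> z]
  have Xpt: "X (pt x) = htens (point_module z) (ell2 \<infinity>) 1 (\<lambda>i. \<Lambda> i x)" if "x \<in> carrier M" for x
  proof -
    have "pre (pt x) \<in> carrier M \<and> pt (pre (pt x)) = pt x" unfolding pre_def using that by (intro someI) auto
    then have "\<Lambda> i (pre (pt x)) = \<Lambda> i x" for i using functional_factors[OF \<Lambda> _ that] by auto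
    then show ?thesis by (simp add: X_def)
  qed
  have el: "(\<lambda>i. \<Lambda> i x) \<in> carrier (ell2 \<infinity>)" if "x \<in> carrier M" for x
    using bd[OF that] by (simp add: ell2_simps)
  have "bounded_hom complex_ring ?Q (underlying \<Omega> ?E) X B"
    unfolding bounded_hom_def
  proof (intro conjI ballI funcsetI)
    fix C assume "C \<in> carrier ?Q"
    then obtain x where x: "x \<in> carrier M" "C = pt x" using L carrier_pt by auto
    show "X C \<in> carrier (underlying \<Omega> ?E)"
      using E.htens_in[OF _ el[OF x(1)], of 1] x by (simp add: Xpt underlying_all)
    have n: "hnorm ?E (X (pt y)) \<le> B * hnorm M y" if y: "y \<in> carrier M" for y
      using E.hnorm_htens[OF _ el[OF y], of 1] bd[OF y] y by (simp add: Xpt underlying_all hnorm_ell2)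
    have "hnorm ?E (X C) \<le> B * hnorm Q C"
    proof (rule field_le_epsilon)
      fix e :: real assume e: "e > 0"
      have d: "e / (B + 1) > 0" using e B by simp
      obtain y where y: "y \<in> carrier M" "pt y = pt x" "hnorm M y < hnorm Q (pt x) + e / (B + 1)" 
        using pt_approx[OF x(1) d] .
      have "hnorm ?E (X C) \<le> B * hnorm M y" using n[OF y(1)] y(2) x by simp
      also have "\<dots> \<le> B * (hnorm Q C + e / (B + 1))" using y x B by (intro mult_left_mono) auto
      also have "\<dots> \<le> B * hnorm Q C + e" using e B by (simp add: field_simps)
      finally show "hnorm ?E (X C) \<le> B * hnorm Q C + e" .
    qed
    then show "hnorm (underlying \<Omega> ?E) (X C) \<le> B * hnorm ?Q C" by (simp add: restrict_hnorm underlying_all)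
    fix c :: complex
    have "(\<lambda>i. \<Lambda> i (A_const \<Omega> c \<odot> x)) = c \<odot>\<^bsub>ell2 \<infinity>\<^esub> (\<lambda>i. \<Lambda> i x)"
      using x by (simp add: F(5) ell2_simps)
    then have "X (pt (A_const \<Omega> c \<odot> x)) = A_const \<Omega> c \<odot>\<^bsub>?E\<^esub> X (pt x)"
      using E.htens_smult_right[OF _ el[OF x(1)], of 1 c] x by (simp add: Xpt action_closed A_const_in underlying_all)
    then show "X (c \<odot>\<^bsub>?Q\<^esub> C) = c \<odot>\<^bsub>underlying \<Omega> ?E\<^esub> X C" using x by (simp add: pt_const underlying_all)
  next
    fix C D assume "C \<in> carrier ?Q" "D \<in> carrier ?Q"
    then have "C \<in> pt ` carrier M" "D \<in> pt ` carrier M" using L carrier_pt by auto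
    then obtain x y where x: "x \<in> carrier M" "C = pt x" and y: "y \<in> carrier M" "D = pt y" 
      by (elim imageE)
    have "(\<lambda>i. \<Lambda> i (x \<oplus> y)) = (\<lambda>i. \<Lambda> i x) \<oplus>\<^bsub>ell2 \<infinity>\<^esub> (\<lambda>i. \<Lambda> i y)"
      using x y by (simp add: F(1) ell2_simps)
    then have "X (pt (x \<oplus> y)) = X (pt x) \<oplus>\<^bsub>?E\<^esub> X (pt y)"
      using E.htens_add_right[OF _ el[OF x(1)] el[OF y(1)], of 1] x y by (simp add: Xpt underlying_all)
    then show "X (C \<oplus>\<^bsub>?Q\<^esub> D) = X C \<oplus>\<^bsub>underlying \<Omega> ?E\<^esub> X D" using x y by (simp add: pt_add underlying_all)
  qed
  then show ?thesis using Xpt by blast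
qed

end

lemma I_infinity: "{i. enat i < \<infinity>} = UNIV" by simp

text \<open>
  The three conditions for a quasi-free module follow from one system of functionals: duality to the
  generators gives the bases, boundedness into \<open>\<ell>\<^sup>2\<close> gives the maps \<open>X\<^sub>z\<close>, and separation of points gives the
  last condition.
\<close>

theorem (in hilb_module) quasi_free_criterion:
  fixes f :: "nat \<Rightarrow> 'a" and \<Lambda> :: "complex ^ 'm \<Rightarrow> nat \<Rightarrow> 'a \<Rightarrow> complex"
  assumes gen: "generating \<Omega> M (range f)"
    and func: "\<And>z i. z \<in> \<Omega> \<Longrightarrow> \<exists>B. functional_at \<Omega> M z (\<Lambda> z i) B"
    and bound: "\<And>z0. z0 \<in> \<Omega> \<Longrightarrow> \<exists>r>0. \<exists>B\<ge>0. \<forall>z\<in>\<Omega> \<inter> ball z0 r. \<forall>x\<in>carrier M. 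
        summable (\<lambda>i. (cmod (\<Lambda> z i x))\<^sup>2) \<and> sqrt (\<Sum>i. (cmod (\<Lambda> z i x))\<^sup>2) \<le> B * hnorm M x"
    and dual: "\<And>z i j. z \<in> \<Omega> \<Longrightarrow> \<Lambda> z i (f j) = (if i = j then 1 else 0)"
    and sep: "\<And>x. \<lbrakk>x \<in> carrier M; \<And>z i. z \<in> \<Omega> \<Longrightarrow> \<Lambda> z i x = 0\<rbrakk> \<Longrightarrow> x = \<zero>"
  shows "quasi_free_rel \<Omega> M \<infinity> f"
proof -
  have fM: "f i \<in> carrier M" for i using gen by (auto simp: generating_def)
  obtain w where w: "w \<in> \<Omega>" using nonempty_dom by auto
  have "inj f"
  proof (rule injI)
    fix i j assume "f i = f j"
    then show "i = j" using dual[OF w, of i i] dual[OF w, of i j] by (auto split: if_splits)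
  qed
  obtain b where b: "\<And>z i. z \<in> \<Omega> \<Longrightarrow> functional_at \<Omega> M z (\<Lambda> z i) (b z i)" using func by metis
  let ?pt = "\<lambda>z x. mtens \<Omega> M (point_module z) x 1" 
  let ?Q = "\<lambda>z. underlying \<Omega> (mtensor \<Omega> M (point_module z))"
  have wb: "weak_basis (?Q z) UNIV (\<lambda>i. ?pt z (f i))" if z: "z \<in> \<Omega>" for z
  proof -
    interpret fibre \<Omega> M z using z by (intro fibre.intro hilb_module_axioms fibre_axioms.intro)
    show ?thesis unfolding mtensor_eq by (rule weak_basis_fibre[OF gen b[OF z] dual[OF z]])
  qed
  have Xz: "\<exists>r>0. \<exists>B. \<forall>z\<in>\<Omega> \<inter> ball z0 r. \<exists>X. bounded_hom complex_ring
        ((?Q z)\<lparr>carrier := lincombs complex_ring (?Q z) (range (\<lambda>i. ?pt z (f i)))\<rparr>) 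
        (underlying \<Omega> (htensor (point_module z) (ell2 \<infinity>))) X B \<and>
      (\<forall>i\<in>UNIV. X (?pt z (f i)) = htens (point_module z) (ell2 \<infinity>) 1 (ell2_basis i))"
    if z0: "z0 \<in> \<Omega>" for z0
  proof -
    obtain r B where r: "r > 0" and B0: "B \<ge> 0" and B: "\<forall>z\<in>\<Omega> \<inter> ball z0 r. \<forall>x\<in>carrier M. 
        summable (\<lambda>i. (cmod (\<Lambda> z i x))\<^sup>2) \<and> sqrt (\<Sum>i. (cmod (\<Lambda> z i x))\<^sup>2) \<le> B * hnorm M x"
      using bound[OF z0] by (elim exE conjE)
    show ?thesis
    proof (rule exI[of _ r], intro conjI r exI[of _ B] ballI)
      fix z assume zr: "z \<in> \<Omega> \<inter> ball z0 r"
      then have zO: "z \<in> \<Omega>" by simp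
      interpret fibre \<Omega> M z using zO by (intro fibre.intro hilb_module_axioms fibre_axioms.intro)
      have e: "(\<lambda>i. \<Lambda> z i (f k)) = ell2_basis k" for k using dual[OF zO] by (simp add: ell2_basis_def)
      have lQ: "lincombs complex_ring (underlying \<Omega> Q) (range (\<lambda>i. pt (f i))) \<subseteq> carrier Q"
        by (intro Q.lincombs_closed) (use fM in auto)
      obtain X where X: "bounded_hom complex_ring 
          ((underlying \<Omega> Q)\<lparr>carrier := lincombs complex_ring (underlying \<Omega> Q) (range (\<lambda>i. pt (f i)))\<rparr>) 
          (underlying \<Omega> (htensor (point_module z) (ell2 \<infinity>))) X B"
        "\<forall>x\<in>carrier M. X (pt x) = htens (point_module z) (ell2 \<infinity>) 1 (\<lambda>i. \<Lambda> z i x)"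
        using fibre_map[OF b[OF zO] B0 bspec[OF bspec[OF B zr]] lQ] by blast
      show "\<exists>X. bounded_hom complex_ring
          ((?Q z)\<lparr>carrier := lincombs complex_ring (?Q z) (range (\<lambda>i. ?pt z (f i)))\<rparr>) 
          (underlying \<Omega> (htensor (point_module z) (ell2 \<infinity>))) X B \<and>
        (\<forall>i\<in>UNIV. X (?pt z (f i)) = htens (point_module z) (ell2 \<infinity>) 1 (ell2_basis i))"
        unfolding mtensor_eq
      proof (intro exI[of _ X] conjI ballI X(1))
        show "X (pt (f i)) = htens (point_module z) (ell2 \<infinity>) 1 (ell2_basis i)" for i
          using X(2) fM[of i] e[of i] by simp
      qed
    qed
  qed
  have iii: "(\<forall>z\<in>\<Omega>. ?pt z h = \<zero>\<^bsub>?Q z\<^esub>) \<longleftrightarrow> h = \<zero>" if h: "h \<in> carrier M" for h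
  proof
    assume *: "\<forall>z\<in>\<Omega>. ?pt z h = \<zero>\<^bsub>?Q z\<^esub>"
    show "h = \<zero>"
    proof (rule sep[OF h])
      fix z i assume zO: "z \<in> \<Omega>"
      interpret fibre \<Omega> M z using zO by (intro fibre.intro hilb_module_axioms fibre_axioms.intro)
      have "pt h = pt \<zero>" using * zO by (simp add: pt_zero mtensor_eq underlying_all)
      then show "\<Lambda> z i h = 0" 
        using functional_factors[OF b[OF zO] h mod.M.zero_closed] functional_at_simps(7)[OF b[OF zO] zO] by simp
    qed
  next
    assume h0: "h = \<zero>"
    show "\<forall>z\<in>\<Omega>. ?pt z h = \<zero>\<^bsub>?Q z\<^esub>"
    proof
      fix z assume zO: "z \<in> \<Omega>"
      interpret fibre \<Omega> M z using zO by (intro fibre.intro hilb_module_axioms fibre_axioms.intro)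
      show "?pt z h = \<zero>\<^bsub>?Q z\<^esub>" using h0 by (simp add: pt_zero mtensor_eq underlying_all)
    qed
  qed
  show ?thesis
    unfolding quasi_free_rel_def Let_def I_infinity
    using hilbert_module \<open>inj f\<close> gen wb Xz iii by simp
qed

section \<open>Change of the carrier type, separability\<close>

definition transport :: "('a \<Rightarrow> 'c) \<Rightarrow> ('m, 'a) hmod \<Rightarrow> ('m, 'c) hmod" where
  "transport j M = (let i = inv_into (carrier M) j in
    \<lparr>carrier = j ` carrier M, mult = undefined, one = undefined,
     zero = j \<zero>\<^bsub>M\<^esub>, add = (\<lambda>u v. j (i u \<oplus>\<^bsub>M\<^esub> i v)), smult = (\<lambda>\<phi> u. j (\<phi> \<odot>\<^bsub>M\<^esub> i u)),
     hinner = (\<lambda>u v. hinner M (i u) (i v))\<rparr>)"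

locale transported = hilb_module \<Omega> M for \<Omega> :: "(complex ^ 'm) set" and M :: "('m, 'a) hmod" (structure) +
  fixes j :: "'a \<Rightarrow> 'c"
  assumes inj: "inj_on j (carrier M)"
begin

abbreviation "M' \<equiv> transport j M"

lemma tr_simps [simp]:
  "carrier M' = j ` carrier M" "\<zero>\<^bsub>M'\<^esub> = j \<zero>"
  "\<lbrakk>x \<in> carrier M; y \<in> carrier M\<rbrakk> \<Longrightarrow> j x \<oplus>\<^bsub>M'\<^esub> j y = j (x \<oplus> y)"
  "x \<in> carrier M \<Longrightarrow> \<phi> \<odot>\<^bsub>M'\<^esub> j x = j (\<phi> \<odot> x)"
  "\<lbrakk>x \<in> carrier M; y \<in> carrier M\<rbrakk> \<Longrightarrow> hinner M' (j x) (j y) = hinner M x y"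
  "x \<in> carrier M \<Longrightarrow> hnorm M' (j x) = hnorm M x"
  by (simp_all add: transport_def Let_def inv_into_f_f[OF inj] hnorm_def)

lemma tr_module: "Module.module (A_alg \<Omega>) M'"
  by (rule module_image(1)[OF A_module]) (auto simp: action_closed)

lemma tr_minus [simp]: "\<lbrakk>x \<in> carrier M; y \<in> carrier M\<rbrakk> \<Longrightarrow> j x \<ominus>\<^bsub>M'\<^esub> j y = j (x \<ominus> y)"
  by (rule module_image(3)[OF A_module]) (auto simp: action_closed)

lemma tr_hilbert_module: "hilbert_module \<Omega> M'"
proof -
  interpret T: pre_hilbert "underlying \<Omega> M'"
  proof (intro pre_hilbert.intro pre_hilbert_axioms.intro module_underlying tr_module)
    fix u v w assume "u \<in> carrier (underlying \<Omega> M')" "v \<in> carrier (underlying \<Omega> M')" "w \<in> carrier (underlying \<Omega> M')"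
    then show "hinner (underlying \<Omega> M') (u \<oplus>\<^bsub>underlying \<Omega> M'\<^esub> v) w = hinner (underlying \<Omega> M') u w + hinner (underlying \<Omega> M') v w"
      by (auto simp: underlying_all H.hinner_add_left)
  next
    fix u v c assume "u \<in> carrier (underlying \<Omega> M')" "v \<in> carrier (underlying \<Omega> M')"
    then obtain x y where *: "x \<in> carrier M" "y \<in> carrier M" "u = j x" "v = j y" by (auto simp: underlying_all)
    show "hinner (underlying \<Omega> M') (c \<odot>\<^bsub>underlying \<Omega> M'\<^esub> u) v = c * hinner (underlying \<Omega> M') u v"
      using * by (simp add: underlying_all H.hinner_smult_left action_closed A_const_in)
    show "hinner (underlying \<Omega> M') v u = cnj (hinner (underlying \<Omega> M') u v)"
      using * H.hinner_commute[of x y] by (simp add: underlying_all)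
  next
    fix u assume "u \<in> carrier (underlying \<Omega> M')"
    then obtain x where *: "x \<in> carrier M" "u = j x" by (auto simp: underlying_all)
    show "0 \<le> Re (hinner (underlying \<Omega> M') u u)" using * by (simp add: underlying_all H.hinner_nonneg)
    assume "hinner (underlying \<Omega> M') u u = 0"
    then show "u = \<zero>\<^bsub>underlying \<Omega> M'\<^esub>" using * H.hinner_definite by (simp add: underlying_all)
  qed
  have "T.MS.mcomplete" unfolding T.mcomplete_iff unfolding underlying_all
  proof (intro allI impI, elim conjE)
    fix s :: "nat \<Rightarrow> 'c" 
    assume s: "\<forall>n. s n \<in> carrier M'" and c: "\<forall>e>0. \<exists>N. \<forall>m\<ge>N. \<forall>n\<ge>N. hnorm M' (s m \<ominus>\<^bsub>M'\<^esub> s n) < e"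
    then obtain t where t: "\<And>n. t n \<in> carrier M" "\<And>n. s n = j (t n)" by (simp add: image_iff) metis
    have "\<forall>e>0. \<exists>N. \<forall>m\<ge>N. \<forall>n\<ge>N. hnorm M (t m \<ominus> t n) < e"
      using c t by simp
    then obtain x where x: "x \<in> carrier M" "(\<lambda>n. hnorm M (t n \<ominus> x)) \<longlonglongrightarrow> 0"
      using complete[unfolded H.mcomplete_iff, rule_format, of t] t(1) by auto
    then show "\<exists>x\<in>carrier M'. (\<lambda>n. hnorm M' (s n \<ominus>\<^bsub>M'\<^esub> x)) \<longlonglongrightarrow> 0"
      using t by (intro bexI[of _ "j x"]) auto
  qed
  then have hs: "hilbert_space (underlying \<Omega> M')" by (simp add: hilbert_space_iff T.pre_hilbert_axioms)
  obtain C where "C \<ge> 0" "\<And>\<phi> x. \<phi> \<in> A_carrier \<Omega> \<Longrightarrow> x \<in> carrier M \<Longrightarrow> 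
        hnorm M (\<phi> \<odot> x) \<le> C * A_norm \<Omega> \<phi> * hnorm M x" using action_bound by metis
  then show ?thesis by (intro hilbert_moduleI[OF tr_module hs, of C]) (auto simp: action_closed)
qed

sublocale T: hilb_module \<Omega> M'
  by (intro hilb_module.intro bounded_domain_axioms hilb_module_axioms.intro tr_hilbert_module)

lemma tr_closure:
  assumes "S \<subseteq> carrier M" shows "htop M' closure_of (j ` S) = j ` (htop M closure_of S)"
proof -
  have "(\<exists>v\<in>j ` S. v \<in> carrier M' \<and> hnorm M' (j x \<ominus>\<^bsub>M'\<^esub> v) < e) \<longleftrightarrow> 
     (\<exists>y\<in>S. y \<in> carrier M \<and> hnorm M (x \<ominus> y) < e)" if "x \<in> carrier M" for x e
    using assms that by (auto simp: subset_iff) 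
  then show ?thesis unfolding H.closure_of_eq T.H.closure_of_eq by auto
qed

lemma tr_generating:
  assumes "generating \<Omega> M S" shows "generating \<Omega> M' (j ` S)"
proof -
  have S: "S \<subseteq> carrier M" and d: "htop M closure_of lincombs (A_alg \<Omega>) M S = carrier M" 
    using assms by (auto simp: generating_def)
  have jS: "j ` S \<subseteq> carrier M'" using S by auto
  have "j y \<in> lincombs (A_alg \<Omega>) M' (j ` S)" if "y \<in> lincombs (A_alg \<Omega>) M S" for y
    using S that
  proof (induction rule: mod.lincombs_induct)
    case zero show ?case using T.mod.lincombs_zero by simp
  next
    case (insert a x w)
    have "w \<in> carrier M" "x \<in> carrier M" using insert S mod.lincombs_closed[OF S] by auto
    then have "j (a \<odot> x \<oplus> w) = a \<odot>\<^bsub>M'\<^esub> j x \<oplus>\<^bsub>M'\<^esub> j w" using insert(1) by (simp add: action_closed)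
    then show ?case using T.mod.lincombs_insert[OF jS _ insert(1,4), of "j x"] insert(2) by simp
  qed
  then have "htop M' closure_of (j ` lincombs (A_alg \<Omega>) M S) \<subseteq> htop M' closure_of lincombs (A_alg \<Omega>) M' (j ` S)"
    by (intro closure_of_mono) auto
  then have "carrier M' \<subseteq> htop M' closure_of lincombs (A_alg \<Omega>) M' (j ` S)"
    using tr_closure[OF mod.lincombs_closed[OF S]] d by simp
  moreover have "htop M' closure_of lincombs (A_alg \<Omega>) M' (j ` S) \<subseteq> carrier M'" 
    unfolding T.H.closure_of_eq by blast
  ultimately show ?thesis using jS by (simp add: generating_def)
qed

lemma tr_inv [simp]: "x \<in> carrier M \<Longrightarrow> inv_into (carrier M) j (j x) = x"
  by (rule inv_into_f_f[OF inj])

lemma tr_functional: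
  assumes "functional_at \<Omega> M z \<Lambda> B" 
  shows "functional_at \<Omega> M' z (\<lambda>u. \<Lambda> (inv_into (carrier M) j u)) B"
  using assms by (auto simp: functional_at_def action_closed)

end

definition separable_mod :: "('r, 'a, 'k) hilb_scheme \<Rightarrow> 'a set \<Rightarrow> bool" where
  "separable_mod M S \<longleftrightarrow> (\<exists>D. countable D \<and> D \<subseteq> S \<and> (\<forall>x\<in>S. \<forall>e>0. \<exists>d\<in>D. hnorm M (x \<ominus>\<^bsub>M\<^esub> d) < e))"

context hilb_module
begin

text \<open>
  The combinations \<open>\<Sum> \<psi>\<^sub>k s\<^sub>k\<close> with \<open>s\<^sub>k\<close> in the generating set and \<open>\<psi>\<^sub>k\<close> in a countable dense subset of \<open>\<A>(\<Omega>)\<close>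
  are indexed by lists of pairs; \<open>val\<close> evaluates such a list.
\<close>

lemma separable_if_countably_generated:
  assumes S: "countable S" "generating \<Omega> M S" shows "separable_mod M (carrier M)"
proof -
  obtain A where A: "countable A" "A \<subseteq> A_carrier \<Omega>" "\<forall>\<phi>\<in>A_carrier \<Omega>. \<forall>e>0. \<exists>\<psi>\<in>A. A_dist \<Omega> \<phi> \<psi> < e"
    using A_separable by auto
  have SM: "S \<subseteq> carrier M" and d: "htop M closure_of lincombs (A_alg \<Omega>) M S = carrier M" 
    using S by (auto simp: generating_def)
  define val where "val l = foldr (\<lambda>(\<psi>, s) w. \<psi> \<odot> s \<oplus> w) l \<zero>" for l :: "((complex ^ 'm \<Rightarrow> complex) \<times> 'a) list"
  have valc: "val l \<in> carrier M" if "l \<in> lists (A \<times> S)" for l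
    using that by (induction l) (use A(2) SM in \<open>auto simp: val_def action_closed subset_iff\<close>)
  define D where "D = val ` lists (A \<times> S)"
  obtain C where C: "C \<ge> 0" "\<And>\<phi> x. \<phi> \<in> A_carrier \<Omega> \<Longrightarrow> x \<in> carrier M \<Longrightarrow> 
        hnorm M (\<phi> \<odot> x) \<le> C * A_norm \<Omega> \<phi> * hnorm M x" using action_bound by metis
  have ap: "\<forall>e>0. \<exists>l\<in>lists (A \<times> S). hnorm M (y \<ominus> val l) < e" if "y \<in> lincombs (A_alg \<Omega>) M S" for y
    using SM that
  proof (induction rule: mod.lincombs_induct)
    case zero
    have "hnorm M (\<zero> \<ominus> val []) = 0" by (simp add: val_def a_minus_def)
    then show ?case by (metis lists.Nil)
  next
    case (insert \<phi> x w)
    have \<phi>: "\<phi> \<in> A_carrier \<Omega>" and x: "x \<in> carrier M" and w: "w \<in> carrier M" 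
      using insert SM mod.lincombs_closed[OF SM] by auto
    show ?case
    proof (intro allI impI)
      fix e :: real assume e: "e > 0"
      define K where "K = C * hnorm M x + 1"
      have K: "K > 0" using C x by (simp add: K_def add_nonneg_pos)
      obtain \<psi> where \<psi>: "\<psi> \<in> A" "A_dist \<Omega> \<phi> \<psi> < e / 2 / K" using A(3) \<phi> e K by (meson divide_pos_pos half_gt_zero)
      have \<psi>A: "\<psi> \<in> A_carrier \<Omega>" using \<psi> A by auto
      obtain l where l: "l \<in> lists (A \<times> S)" "hnorm M (w \<ominus> val l) < e / 2" 
        using insert(4) e by (meson half_gt_zero)
      note vl = valc[OF l(1)]
      have eq: "(\<phi> \<odot> x \<oplus> w) \<ominus> val ((\<psi>, x) # l) = (\<phi> \<ominus>\<^bsub>A_alg \<Omega>\<^esub> \<psi>) \<odot> x \<oplus> (w \<ominus> val l)"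
      proof -
        have "val ((\<psi>, x) # l) = \<psi> \<odot> x \<oplus> val l" by (simp add: val_def)
        then show ?thesis using \<phi> \<psi>A x w vl
          by (simp add: action_minus_left action_closed) 
             (simp add: a_minus_def mod.M.minus_add action_closed mod.M.a_ac)
      qed
      have "hnorm M ((\<phi> \<ominus>\<^bsub>A_alg \<Omega>\<^esub> \<psi>) \<odot> x) \<le> C * A_dist \<Omega> \<phi> \<psi> * hnorm M x"
        using C(2)[of "\<phi> \<ominus>\<^bsub>A_alg \<Omega>\<^esub> \<psi>" x] \<phi> \<psi>A x by (simp add: A_dist_eq)
      also have "\<dots> = (C * hnorm M x) * A_dist \<Omega> \<phi> \<psi>" by simp
      also have "\<dots> \<le> (C * hnorm M x) * (e / 2 / K)" using \<psi> C x by (intro mult_left_mono) auto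
      also have "\<dots> \<le> K * (e / 2 / K)" using e K by (intro mult_right_mono) (auto simp: K_def)
      also have "\<dots> = e / 2" using K by simp
      finally have "hnorm M ((\<phi> \<odot> x \<oplus> w) \<ominus> val ((\<psi>, x) # l)) < e"
        unfolding eq using H.hnorm_triangle[of "(\<phi> \<ominus>\<^bsub>A_alg \<Omega>\<^esub> \<psi>) \<odot> x" "w \<ominus> val l"] l(2) \<phi> \<psi>A x w vl
        by (simp add: action_closed)
      then show "\<exists>l\<in>lists (A \<times> S). hnorm M (\<phi> \<odot> x \<oplus> w \<ominus> val l) < e"
        using \<psi> l insert(2) by (intro bexI[of _ "(\<psi>, x) # l"]) auto
    qed
  qed
  have "\<exists>v\<in>D. hnorm M (x \<ominus> v) < e" if x: "x \<in> carrier M" and e: "e > 0" for x e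
  proof -
    have "x \<in> htop M closure_of lincombs (A_alg \<Omega>) M S" using x d by simp
    moreover have "e / 2 > 0" using e by simp
    ultimately obtain y where y: "y \<in> lincombs (A_alg \<Omega>) M S" "y \<in> carrier M" "hnorm M (x \<ominus> y) < e / 2"
      unfolding H.closure_of_eq by blast
    obtain l where l: "l \<in> lists (A \<times> S)" "hnorm M (y \<ominus> val l) < e / 2" 
      using ap[OF y(1)] e by (meson half_gt_zero)
    have "hnorm M (x \<ominus> val l) < e" 
      using H.hnorm_minus_triangle[OF x y(2) valc[OF l(1)]] y(3) l(2) by simp
    then show ?thesis using l by (auto simp: D_def)
  qed
  moreover have "countable D" using A S by (auto simp: D_def intro!: countable_image countable_lists)
  moreover have "D \<subseteq> carrier M" using valc by (auto simp: D_def)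
  ultimately show ?thesis unfolding separable_mod_def by blast
qed

text \<open>
  For each \<open>d\<close> in a dense set and each \<open>n\<close>, keep one point of \<open>S\<close> at distance less than \<open>1 / (n + 1)\<close> from \<open>d\<close>,
  if there is one.
\<close>

lemma separable_subset:
  assumes "separable_mod M (carrier M)" and S: "S \<subseteq> carrier M" shows "separable_mod M S"
proof -
  obtain D where D: "countable D" "D \<subseteq> carrier M" "\<forall>x\<in>carrier M. \<forall>e>0. \<exists>d\<in>D. hnorm M (x \<ominus> d) < e"
    using assms by (auto simp: separable_mod_def)
  define P where "P = (\<lambda>(d, n :: nat) s. s \<in> S \<and> hnorm M (s \<ominus> d) < 1 / Suc n)"
  define E where "E = (\<lambda>p. SOME s. P p s) ` {p \<in> D \<times> UNIV. \<exists>s. P p s}"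
  have E: "P p (SOME s. P p s)" if "\<exists>s. P p s" for p using that by (rule someI_ex)
  have "countable E" using D unfolding E_def by (intro countable_image) auto
  moreover have "E \<subseteq> S"
  proof
    fix s assume "s \<in> E"
    then obtain p where "s = (SOME s. P p s)" "\<exists>s. P p s" by (auto simp: E_def)
    then have "P p s" using E by simp
    then show "s \<in> S" by (auto simp: P_def)
  qed
  moreover have "\<exists>s\<in>E. hnorm M (x \<ominus> s) < e" if x: "x \<in> S" and e: "e > 0" for x e
  proof -
    obtain n :: nat where n: "1 / Suc n < e / 2" using e by (metis half_gt_zero nat_approx_posE)
    have xM: "x \<in> carrier M" using x S by auto
    have "1 / real (Suc n) > 0" by simp
    then obtain d where d: "d \<in> D" "hnorm M (x \<ominus> d) < 1 / Suc n" using D(3) xM by blast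
    have ex: "\<exists>s. P (d, n) s" using x d by (auto simp: P_def)
    let ?s = "SOME s. P (d, n) s"
    have s: "?s \<in> S" "hnorm M (?s \<ominus> d) < 1 / Suc n" using E[OF ex] by (auto simp: P_def)
    have dM: "d \<in> carrier M" and sM: "?s \<in> carrier M" using d D s S by auto
    have "hnorm M (x \<ominus> ?s) < e" 
      using H.hnorm_minus_triangle[OF xM dM sM] H.hnorm_minus_commute[OF dM sM] d(2) s(2) n by simp
    moreover have "?s \<in> E" using ex d by (auto simp: E_def)
    ultimately show ?thesis by blast
  qed
  ultimately show ?thesis unfolding separable_mod_def by blast
qed

text \<open>
  The distances to a dense sequence determine a point.
\<close>

lemma separable_injection:
  assumes "separable_mod M (carrier M)"
  obtains j :: "'a \<Rightarrow> nat \<Rightarrow> complex" where "inj_on j (carrier M)"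
proof -
  obtain D where D: "countable D" "D \<subseteq> carrier M" "\<forall>x\<in>carrier M. \<forall>e>0. \<exists>d\<in>D. hnorm M (x \<ominus> d) < e"
    using assms by (auto simp: separable_mod_def)
  have "D \<noteq> {}" using D(3)[rule_format, OF mod.M.zero_closed, of 1] by auto
  then have r: "range (from_nat_into D) = D" using D(1) by (rule range_from_nat_into)
  define j where "j x n = complex_of_real (hnorm M (x \<ominus> from_nat_into D n))" for x n
  have "inj_on j (carrier M)"
  proof (rule inj_onI)
    fix x y assume x: "x \<in> carrier M" and y: "y \<in> carrier M" and e: "j x = j y"
    have eq: "hnorm M (x \<ominus> d) = hnorm M (y \<ominus> d)" if "d \<in> D" for d
    proof -
      have "d \<in> range (from_nat_into D)" using that r by simp
      then obtain n where "d = from_nat_into D n" by auto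
      then show ?thesis using fun_cong[OF e, of n] by (simp add: j_def)
    qed
    have "hnorm M (x \<ominus> y) \<le> 0 + \<epsilon>" if "\<epsilon> > 0" for \<epsilon>
    proof -
      obtain d where d: "d \<in> D" "hnorm M (x \<ominus> d) < \<epsilon> / 2" using D(3) x \<open>\<epsilon> > 0\<close> by (meson half_gt_zero)
      have dM: "d \<in> carrier M" using d D by auto
      show ?thesis using H.hnorm_minus_triangle[OF x dM y] H.hnorm_minus_commute[OF dM y] eq[OF d(1)] d(2) by simp
    qed
    then have "hnorm M (x \<ominus> y) \<le> 0" by (rule field_le_epsilon)
    then have "hnorm M (x \<ominus> y) = 0" using x y by (intro order_antisym) auto
    then show "x = y" using H.hnorm_minus_eq_0_iff[OF x y] by simp
  qed
  then show thesis by (rule that)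
qed

lemma closure_lincombs_closed_submodule:
  assumes S: "S \<subseteq> carrier M"
  shows "closed_submodule \<Omega> M (htop M closure_of lincombs (A_alg \<Omega>) M S)"
proof -
  let ?L = "lincombs (A_alg \<Omega>) M S" and ?K = "htop M closure_of lincombs (A_alg \<Omega>) M S"
  note K = H.closure_of_eq[of ?L]
  have L: "?L \<subseteq> carrier M" by (rule mod.lincombs_closed[OF S])
  have KI: "x \<in> ?K" if "x \<in> carrier M" "\<And>e. e > 0 \<Longrightarrow> \<exists>y\<in>?L. hnorm M (x \<ominus> y) < e" for x
    unfolding K using that L by blast
  have KD: "\<exists>y\<in>?L. y \<in> carrier M \<and> hnorm M (x \<ominus> y) < e" "x \<in> carrier M" if "x \<in> ?K" "e > 0" for x and e :: real
    using that unfolding K by blast+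
  obtain C where C: "C \<ge> 0" "\<And>\<phi> x. \<phi> \<in> A_carrier \<Omega> \<Longrightarrow> x \<in> carrier M \<Longrightarrow> 
        hnorm M (\<phi> \<odot> x) \<le> C * A_norm \<Omega> \<phi> * hnorm M x" using action_bound by metis
  have act: "\<phi> \<odot> x \<in> ?K" if \<phi>: "\<phi> \<in> A_carrier \<Omega>" and x: "x \<in> ?K" for \<phi> x
  proof (rule KI)
    have xM: "x \<in> carrier M" using KD[OF x, of 1] by simp
    then show "\<phi> \<odot> x \<in> carrier M" using \<phi> by (simp add: action_closed)
    fix e :: real assume e: "e > 0"
    define k where "k = C * A_norm \<Omega> \<phi> + 1"
    have k: "k > 0" using C A_norm_nonneg[OF \<phi>] by (simp add: k_def add_nonneg_pos)
    obtain y where y: "y \<in> ?L" "y \<in> carrier M" "hnorm M (x \<ominus> y) < e / k" using KD(1)[OF x, of "e / k"] e k by auto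
    have "hnorm M (\<phi> \<odot> x \<ominus> \<phi> \<odot> y) \<le> (C * A_norm \<Omega> \<phi>) * hnorm M (x \<ominus> y)"
      using C(2)[OF \<phi>, of "x \<ominus> y"] xM y \<phi> by (simp add: action_minus_right)
    also have "\<dots> \<le> k * hnorm M (x \<ominus> y)" using xM y by (intro mult_right_mono) (auto simp: k_def)
    also have "\<dots> < e" using y(3) k by (simp add: field_simps)
    finally show "\<exists>y\<in>?L. hnorm M (\<phi> \<odot> x \<ominus> y) < e" 
      using mod.lincombs_smult[OF S y(1)] \<phi> by (intro bexI[of _ "\<phi> \<odot> y"]) auto
  qed
  have "submodule ?K (A_alg \<Omega>) M"
  proof (rule mod.submoduleI)
    show "?K \<subseteq> carrier M" unfolding K by blast
    show "\<zero> \<in> ?K"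
    proof (rule KI)
      show "\<exists>y\<in>?L. hnorm M (\<zero> \<ominus> y) < e" if "e > 0" for e
        by (rule bexI[OF _ mod.lincombs_zero]) (use that in \<open>simp add: a_minus_def\<close>)
    qed simp
    show "\<phi> \<odot> x \<in> ?K" if "\<phi> \<in> carrier (A_alg \<Omega>)" "x \<in> ?K" for \<phi> x using act that by simp
    show "\<ominus> x \<in> ?K" if "x \<in> ?K" for x
      using act[OF A_const_in that, of "-1"] KD[OF that, of 1] H.minus_smult[of x 1] H.one_smult[of x] by simp
    show "x \<oplus> y \<in> ?K" if x: "x \<in> ?K" and y: "y \<in> ?K" for x y
    proof (rule KI)
      have M: "x \<in> carrier M" "y \<in> carrier M" using KD(2)[OF x, of 1] KD(2)[OF y, of 1] by auto
      then show "x \<oplus> y \<in> carrier M" by simp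
      fix e :: real assume e: "e > 0"
      obtain x' where x': "x' \<in> ?L" "x' \<in> carrier M" "hnorm M (x \<ominus> x') < e / 2" using KD(1)[OF x, of "e / 2"] e by auto
      obtain y' where y': "y' \<in> ?L" "y' \<in> carrier M" "hnorm M (y \<ominus> y') < e / 2" using KD(1)[OF y, of "e / 2"] e by auto
      have "(x \<oplus> y) \<ominus> (x' \<oplus> y') = (x \<ominus> x') \<oplus> (y \<ominus> y')"
        using M x' y' by (simp add: a_minus_def mod.M.minus_add mod.M.a_ac)
      then have "hnorm M ((x \<oplus> y) \<ominus> (x' \<oplus> y')) < e"
        using H.hnorm_triangle[of "x \<ominus> x'" "y \<ominus> y'"] M x' y' by simp
      then show "\<exists>u\<in>?L. hnorm M (x \<oplus> y \<ominus> u) < e" 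
        using mod.lincombs_add[OF S x'(1) y'(1)] by blast
    qed
  qed
  moreover have "closedin (htop M) ?K" by simp
  ultimately show ?thesis by (simp add: closed_submodule_def)
qed

lemma restrict_lincombs:
  assumes K: "submodule K (A_alg \<Omega>) M" and S: "S \<subseteq> K"
  shows "lincombs (A_alg \<Omega>) (M\<lparr>carrier := K\<rparr>) S = lincombs (A_alg \<Omega>) M S"
proof -
  let ?N = "M\<lparr>carrier := K\<rparr>"
  interpret N: Module.module "A_alg \<Omega>" ?N by (rule submodule.submodule_is_module[OF K A_module])
  have SM: "S \<subseteq> carrier M" and SN: "S \<subseteq> carrier ?N" using S submoduleD(1)[OF K] by auto
  show ?thesis
  proof (intro subset_antisym subsetI)
    fix x assume "x \<in> lincombs (A_alg \<Omega>) ?N S"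
    with SN show "x \<in> lincombs (A_alg \<Omega>) M S"
      by (induction rule: N.lincombs_induct) (use mod.lincombs_zero mod.lincombs_insert[OF SM] in auto)
  next
    fix x assume "x \<in> lincombs (A_alg \<Omega>) M S"
    with SM show "x \<in> lincombs (A_alg \<Omega>) ?N S"
      by (induction rule: mod.lincombs_induct) (use N.lincombs_zero N.lincombs_insert[OF SN] in auto)
  qed
qed

lemma restrict_closure:
  assumes K: "closed_submodule \<Omega> M K" and S: "S \<subseteq> K"
  shows "htop (M\<lparr>carrier := K\<rparr>) closure_of S = htop M closure_of S"
proof -
  let ?N = "M\<lparr>carrier := K\<rparr>"
  have sub: "submodule K (A_alg \<Omega>) M" and cl: "closedin (htop M) K" using K by (auto simp: closed_submodule_def)
  interpret N: hilb_module \<Omega> ?N 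
    by (intro hilb_module.intro bounded_domain_axioms hilb_module_axioms.intro closed_submodule_hilbert_module K)
  have "htop M closure_of S \<subseteq> K" using S cl by (rule closure_of_minimal)
  moreover have "x \<in> htop ?N closure_of S \<longleftrightarrow> x \<in> K \<and> x \<in> htop M closure_of S" for x
    unfolding N.H.closure_of_eq H.closure_of_eq
    using S submoduleD(1)[OF sub] by (auto simp: restrict_hnorm restrict_minus[OF sub] subset_iff)
  ultimately show ?thesis by blast
qed

end

section \<open>The direct sum of a module with square summable sequences\<close>

text \<open>
  The Hilbert module \<open>(R \<otimes> \<ell>\<^sup>2) \<oplus> N\<close>, with \<open>R \<otimes> \<ell>\<^sup>2\<close> realized as the square summable sequences in \<open>R\<close>.
\<close>

definition sum_module :: "('m, 'b) hmod \<Rightarrow> ('m, 'a) hmod \<Rightarrow> ('m, (nat \<Rightarrow> 'b) \<times> 'a) hmod" where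
  "sum_module R N =
    \<lparr>carrier = {(h, m). (\<forall>i. h i \<in> carrier R) \<and> summable (\<lambda>i. (hnorm R (h i))\<^sup>2) \<and> m \<in> carrier N},
     mult = undefined, one = undefined, zero = (\<lambda>i. \<zero>\<^bsub>R\<^esub>, \<zero>\<^bsub>N\<^esub>),
     add = (\<lambda>(h, m) (h', m'). (\<lambda>i. h i \<oplus>\<^bsub>R\<^esub> h' i, m \<oplus>\<^bsub>N\<^esub> m')),
     smult = (\<lambda>\<phi> (h, m). (\<lambda>i. \<phi> \<odot>\<^bsub>R\<^esub> h i, \<phi> \<odot>\<^bsub>N\<^esub> m)),
     hinner = (\<lambda>(h, m) (h', m'). (\<Sum>i. hinner R (h i) (h' i)) + hinner N m m')\<rparr>"

lemma sum_module_simps: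
  "(h, m) \<in> carrier (sum_module R N) \<longleftrightarrow> 
     (\<forall>i. h i \<in> carrier R) \<and> summable (\<lambda>i. (hnorm R (h i))\<^sup>2) \<and> m \<in> carrier N"
  "\<zero>\<^bsub>sum_module R N\<^esub> = (\<lambda>i. \<zero>\<^bsub>R\<^esub>, \<zero>\<^bsub>N\<^esub>)"
  "(h, m) \<oplus>\<^bsub>sum_module R N\<^esub> (h', m') = (\<lambda>i. h i \<oplus>\<^bsub>R\<^esub> h' i, m \<oplus>\<^bsub>N\<^esub> m')"
  "\<phi> \<odot>\<^bsub>sum_module R N\<^esub> (h, m) = (\<lambda>i. \<phi> \<odot>\<^bsub>R\<^esub> h i, \<phi> \<odot>\<^bsub>N\<^esub> m)"
  "hinner (sum_module R N) (h, m) (h', m') = (\<Sum>i. hinner R (h i) (h' i)) + hinner N m m'"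
  by (simp_all add: sum_module_def)

locale hilb_module_pair = R: hilb_module \<Omega> R + N: hilb_module \<Omega> N 
  for \<Omega> :: "(complex ^ 'm) set" and R :: "('m, 'b) hmod" and N :: "('m, 'a) hmod"
begin

abbreviation "W \<equiv> sum_module R N"

lemma summable_inner:
  assumes "\<And>i. h i \<in> carrier R" "summable (\<lambda>i. (hnorm R (h i))\<^sup>2)" 
    "\<And>i. k i \<in> carrier R" "summable (\<lambda>i. (hnorm R (k i))\<^sup>2)"
  shows "summable (\<lambda>i. hinner R (h i) (k i))"
proof (rule summable_comparison_test')
  show "summable (\<lambda>i. (hnorm R (h i))\<^sup>2 + (hnorm R (k i))\<^sup>2)" by (intro summable_add assms)
  show "norm (hinner R (h i) (k i)) \<le> (hnorm R (h i))\<^sup>2 + (hnorm R (k i))\<^sup>2" for i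
    using R.H.SI.Cauchy_Schwarz[OF assms(1,3), of i i] sum_squares_bound[of "hnorm R (h i)" "hnorm R (k i)"]
      mult_nonneg_nonneg[OF R.H.hnorm_nonneg[OF assms(1)[of i]] R.H.hnorm_nonneg[OF assms(3)[of i]]] by linarith
qed

lemma summable_sum:
  assumes "\<And>i. h i \<in> carrier R" "summable (\<lambda>i. (hnorm R (h i))\<^sup>2)" 
    "\<And>i. k i \<in> carrier R" "summable (\<lambda>i. (hnorm R (k i))\<^sup>2)"
  shows "summable (\<lambda>i. (hnorm R (h i \<oplus>\<^bsub>R\<^esub> k i))\<^sup>2)"
proof (rule summable_comparison_test')
  show "summable (\<lambda>i. 2 * (hnorm R (h i))\<^sup>2 + 2 * (hnorm R (k i))\<^sup>2)" by (intro summable_add summable_mult assms)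
  show "norm ((hnorm R (h i \<oplus>\<^bsub>R\<^esub> k i))\<^sup>2) \<le> 2 * (hnorm R (h i))\<^sup>2 + 2 * (hnorm R (k i))\<^sup>2" for i
  proof -
    have "(hnorm R (h i \<oplus>\<^bsub>R\<^esub> k i))\<^sup>2 \<le> (hnorm R (h i) + hnorm R (k i))\<^sup>2" 
      using assms by (intro power_mono R.H.hnorm_triangle) auto
    also have "\<dots> \<le> 2 * (hnorm R (h i))\<^sup>2 + 2 * (hnorm R (k i))\<^sup>2"
      using sum_squares_bound[of "hnorm R (h i)" "hnorm R (k i)"] by (simp add: power2_sum)
    finally show ?thesis by simp
  qed
qed

lemma summable_action:
  assumes "\<And>i. h i \<in> carrier R" "summable (\<lambda>i. (hnorm R (h i))\<^sup>2)" "\<phi> \<in> A_carrier \<Omega>"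
  shows "summable (\<lambda>i. (hnorm R (\<phi> \<odot>\<^bsub>R\<^esub> h i))\<^sup>2)"
proof -
  obtain C where C: "C \<ge> 0" "\<And>\<phi> x. \<phi> \<in> A_carrier \<Omega> \<Longrightarrow> x \<in> carrier R \<Longrightarrow> 
        hnorm R (\<phi> \<odot>\<^bsub>R\<^esub> x) \<le> C * A_norm \<Omega> \<phi> * hnorm R x" using R.action_bound by metis
  show ?thesis
  proof (rule summable_comparison_test')
    show "summable (\<lambda>i. (C * A_norm \<Omega> \<phi>)\<^sup>2 * (hnorm R (h i))\<^sup>2)" by (intro summable_mult assms)
    show "norm ((hnorm R (\<phi> \<odot>\<^bsub>R\<^esub> h i))\<^sup>2) \<le> (C * A_norm \<Omega> \<phi>)\<^sup>2 * (hnorm R (h i))\<^sup>2" for i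
      using power_mono[OF C(2)[OF assms(3) assms(1)[of i]], of 2] assms by (simp add: power_mult_distrib R.action_closed)
  qed
qed

lemma W_module: "Module.module (A_alg \<Omega>) W"
proof (rule moduleI[OF R.mod.R.is_cring])
  show "abelian_group W"
  proof (rule abelian_groupI)
    fix u assume "u \<in> carrier W"
    then obtain h m where u: "u = (h, m)" "(h, m) \<in> carrier W" by (cases u) auto
    show "\<exists>v\<in>carrier W. v \<oplus>\<^bsub>W\<^esub> u = \<zero>\<^bsub>W\<^esub>"
      using u by (intro bexI[of _ "(\<lambda>i. \<ominus>\<^bsub>R\<^esub> h i, \<ominus>\<^bsub>N\<^esub> m)"]) 
        (auto simp: sum_module_simps R.mod.M.l_neg N.mod.M.l_neg)
  qed (auto simp: sum_module_simps R.mod.M.a_ac N.mod.M.a_ac summable_sum)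
qed (auto simp: sum_module_simps summable_action R.action_closed N.action_closed R.mod.smult_l_distr 
      N.mod.smult_l_distr R.mod.smult_r_distr N.mod.smult_r_distr R.mod.smult_assoc1 N.mod.smult_assoc1
      R.H.one_smult N.H.one_smult)

lemma W_inner_self:
  assumes "(h, m) \<in> carrier W"
  shows "hinner W (h, m) (h, m) = of_real ((\<Sum>i. (hnorm R (h i))\<^sup>2) + (hnorm N m)\<^sup>2)"
proof -
  have h: "\<And>i. h i \<in> carrier R" "summable (\<lambda>i. (hnorm R (h i))\<^sup>2)" "m \<in> carrier N" 
    using assms by (auto simp: sum_module_simps)
  have "hinner R (h i) (h i) = of_real ((hnorm R (h i))\<^sup>2)" for i
    using R.H.SI.self_real[OF h(1)[of i]] R.H.hnorm_sq[OF h(1)[of i]] by simp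
  moreover have "hinner N m m = of_real ((hnorm N m)\<^sup>2)"
    using N.H.SI.self_real[OF h(3)] N.H.hnorm_sq[OF h(3)] by simp
  ultimately show ?thesis
    unfolding sum_module_simps by (simp only: suminf_of_real[OF h(2)] of_real_add)
qed

lemma W_hnorm:
  "(h, m) \<in> carrier W \<Longrightarrow> hnorm W (h, m) = sqrt ((\<Sum>i. (hnorm R (h i))\<^sup>2) + (hnorm N m)\<^sup>2)"
  by (simp add: hnorm_def[of W] W_inner_self)

lemma W_pre_hilbert: "pre_hilbert (underlying \<Omega> W)"
proof (intro pre_hilbert.intro R.module_underlying W_module pre_hilbert_axioms.intro, unfold underlying_all)
  fix u v w assume "u \<in> carrier W" "v \<in> carrier W" "w \<in> carrier W"
  then obtain h m h' m' k n where u: "u = (h, m)" "(h, m) \<in> carrier W" "v = (h', m')" "(h', m') \<in> carrier W" 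
    "w = (k, n)" "(k, n) \<in> carrier W" by (cases u; cases v; cases w) auto
  note c = u(2,4,6)[unfolded sum_module_simps(1)]
  have "(\<Sum>i. hinner R (h i \<oplus>\<^bsub>R\<^esub> h' i) (k i)) = (\<Sum>i. hinner R (h i) (k i) + hinner R (h' i) (k i))"
    using c by (simp add: R.H.hinner_add_left)
  also have "\<dots> = (\<Sum>i. hinner R (h i) (k i)) + (\<Sum>i. hinner R (h' i) (k i))"
    by (rule suminf_add[symmetric]) (use c in \<open>auto intro!: summable_inner\<close>)
  finally show "hinner W (u \<oplus>\<^bsub>W\<^esub> v) w = hinner W u w + hinner W v w"
    using c by (simp add: u sum_module_simps N.H.hinner_add_left)
next
  fix u w c assume "u \<in> carrier W" "w \<in> carrier W"
  then obtain h m k n where u: "u = (h, m)" "(h, m) \<in> carrier W" 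
    "w = (k, n)" "(k, n) \<in> carrier W" by (cases u; cases w) auto
  note cc = u(2,4)[unfolded sum_module_simps(1)]
  have s: "summable (\<lambda>i. hinner R (h i) (k i))" using cc by (auto intro!: summable_inner)
  have "(\<Sum>i. hinner R (A_const \<Omega> c \<odot>\<^bsub>R\<^esub> h i) (k i)) = c * (\<Sum>i. hinner R (h i) (k i))"
    using cc by (simp add: R.H.hinner_smult_left suminf_mult[OF s])
  then show "hinner W (A_const \<Omega> c \<odot>\<^bsub>W\<^esub> u) w = c * hinner W u w"
    using cc by (simp add: u sum_module_simps N.H.hinner_smult_left algebra_simps)
  have "hinner R (k i) (h i) = cnj (hinner R (h i) (k i))" for i using cc R.H.hinner_commute by blast
  moreover have "(\<lambda>i. cnj (hinner R (h i) (k i))) sums cnj (\<Sum>i. hinner R (h i) (k i))"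
    by (rule sums_cnj[THEN iffD2, OF summable_sums[OF s]])
  ultimately have "(\<Sum>i. hinner R (k i) (h i)) = cnj (\<Sum>i. hinner R (h i) (k i))" by (simp add: sums_iff)
  moreover have "hinner N n m = cnj (hinner N m n)" using cc N.H.hinner_commute by blast
  ultimately show "hinner W w u = cnj (hinner W u w)" by (simp add: u sum_module_simps)
next
  fix u assume "u \<in> carrier W"
  then obtain h m where u: "u = (h, m)" "(h, m) \<in> carrier W" by (cases u) auto
  note cc = u(2)[unfolded sum_module_simps(1)]
  have s: "0 \<le> (\<Sum>i. (hnorm R (h i))\<^sup>2)" using cc by (intro suminf_nonneg) auto
  show "0 \<le> Re (hinner W u u)" unfolding u(1) W_inner_self[OF u(2)] using s by simp
  assume "hinner W u u = 0"
  then have "(\<Sum>i. (hnorm R (h i))\<^sup>2) + (hnorm N m)\<^sup>2 = 0" 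
    unfolding u(1) W_inner_self[OF u(2)] using of_real_eq_0_iff by blast
  then have 0: "(\<Sum>i. (hnorm R (h i))\<^sup>2) = 0" "(hnorm N m)\<^sup>2 = 0"
    using s zero_le_power2[of "hnorm N m"] by linarith+
  then have "\<forall>i. (hnorm R (h i))\<^sup>2 = 0" 
    using cc suminf_eq_zero_iff[of "\<lambda>i. (hnorm R (h i))\<^sup>2"] by simp
  then have "h i = \<zero>\<^bsub>R\<^esub>" for i using cc R.H.hnorm_eq_0D by simp
  moreover have "m = \<zero>\<^bsub>N\<^esub>" using 0 cc N.H.hnorm_eq_0D by simp
  ultimately show "u = \<zero>\<^bsub>W\<^esub>" by (simp add: u sum_module_simps fun_eq_iff)
qed

sublocale W: pre_hilb_module \<Omega> W
  by (intro pre_hilb_module.intro R.bounded_domain_axioms pre_hilb_module_axioms.intro W_module W_pre_hilbert)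

lemma W_minus: 
  assumes "(h, m) \<in> carrier W" "(k, n) \<in> carrier W" 
  shows "(h, m) \<ominus>\<^bsub>W\<^esub> (k, n) = (\<lambda>i. h i \<ominus>\<^bsub>R\<^esub> k i, m \<ominus>\<^bsub>N\<^esub> n)"
proof -
  have "\<ominus>\<^bsub>W\<^esub> (k, n) = A_const \<Omega> (-1) \<odot>\<^bsub>W\<^esub> (k, n)"
    using W.H.minus_smult[OF assms(2), of 1] W.H.one_smult[OF assms(2)] assms by simp
  moreover have "A_const \<Omega> (-1) \<odot>\<^bsub>R\<^esub> k i = \<ominus>\<^bsub>R\<^esub> k i" for i
    using R.H.minus_smult[of "k i" 1] R.H.one_smult[of "k i"] assms by (simp add: sum_module_simps)
  moreover have "A_const \<Omega> (-1) \<odot>\<^bsub>N\<^esub> n = \<ominus>\<^bsub>N\<^esub> n"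
    using N.H.minus_smult[of n 1] N.H.one_smult[of n] assms by (simp add: sum_module_simps)
  ultimately show ?thesis by (simp add: a_minus_def sum_module_simps)
qed

lemma W_coord_le:
  assumes "(h, m) \<in> carrier W"
  shows "hnorm R (h i) \<le> hnorm W (h, m)" "hnorm N m \<le> hnorm W (h, m)" 
    "sqrt (\<Sum>i. (hnorm R (h i))\<^sup>2) \<le> hnorm W (h, m)"
proof -
  have c: "\<And>i. h i \<in> carrier R" "summable (\<lambda>i. (hnorm R (h i))\<^sup>2)" "m \<in> carrier N" 
    using assms by (auto simp: sum_module_simps)
  have "(hnorm R (h i))\<^sup>2 \<le> (\<Sum>i. (hnorm R (h i))\<^sup>2)" 
    using sum_le_suminf[OF c(2), of "{i}"] by simp
  then have "sqrt ((hnorm R (h i))\<^sup>2) \<le> hnorm W (h, m)" 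
    unfolding W_hnorm[OF assms] by (intro real_sqrt_le_mono add_increasing2) auto
  then show "hnorm R (h i) \<le> hnorm W (h, m)" using c by simp
  have "0 \<le> (\<Sum>i. (hnorm R (h i))\<^sup>2)" using c by (intro suminf_nonneg) auto
  then have "sqrt ((hnorm N m)\<^sup>2) \<le> hnorm W (h, m)" unfolding W_hnorm[OF assms] by (intro real_sqrt_le_mono) simp
  then show "hnorm N m \<le> hnorm W (h, m)" using c by simp
  show "sqrt (\<Sum>i. (hnorm R (h i))\<^sup>2) \<le> hnorm W (h, m)" unfolding W_hnorm[OF assms] by simp
qed

text \<open>
  The coordinates of a Cauchy sequence converge. That they do so in the norm of \<open>W\<close> follows by passing to
  the limit in finite partial sums of the squared distance.
\<close>

lemma W_complete: "W.H.MS.mcomplete"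
  unfolding W.H.mcomplete_iff
proof (intro allI impI, elim conjE)
  fix s :: "nat \<Rightarrow> (nat \<Rightarrow> 'b) \<times> 'a" 
  assume s: "\<forall>n. s n \<in> carrier W" and c: "\<forall>e>0. \<exists>K. \<forall>m\<ge>K. \<forall>n\<ge>K. hnorm W (s m \<ominus>\<^bsub>W\<^esub> s n) < e"
  define a b where "a n = fst (s n)" and "b n = snd (s n)" for n
  have sab: "s n = (a n, b n)" for n by (simp add: a_def b_def)
  have cW: "(a n, b n) \<in> carrier W" for n using s sab by metis
  note cab = cW[unfolded sum_module_simps(1)]
  have aR: "a n i \<in> carrier R" and as: "summable (\<lambda>i. (hnorm R (a n i))\<^sup>2)" and bN: "b n \<in> carrier N" for n i 
    using cab by auto
  have diff: "s m \<ominus>\<^bsub>W\<^esub> s n = (\<lambda>i. a m i \<ominus>\<^bsub>R\<^esub> a n i, b m \<ominus>\<^bsub>N\<^esub> b n)" for m n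
    unfolding sab by (rule W_minus[OF cW cW])
  have dW: "(\<lambda>i. a m i \<ominus>\<^bsub>R\<^esub> a n i, b m \<ominus>\<^bsub>N\<^esub> b n) \<in> carrier W" for m n
    unfolding diff[symmetric] using s by simp
  have cau: "\<exists>K. \<forall>m\<ge>K. \<forall>n\<ge>K. P m n < e" 
    if "e > 0" "\<And>m n. P m n \<le> hnorm W (s m \<ominus>\<^bsub>W\<^esub> s n)" for e :: real and P
    using c that by (meson order_le_less_trans)
  have "\<exists>x\<in>carrier R. (\<lambda>n. hnorm R (a n i \<ominus>\<^bsub>R\<^esub> x)) \<longlonglongrightarrow> 0" for i
    by (rule R.complete[unfolded R.H.mcomplete_iff, rule_format, of "\<lambda>n. a n i"])
       (use aR cau W_coord_le(1)[OF dW] in \<open>auto simp: diff\<close>)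
  then obtain x where x: "\<And>i. x i \<in> carrier R" "\<And>i. (\<lambda>n. hnorm R (a n i \<ominus>\<^bsub>R\<^esub> x i)) \<longlonglongrightarrow> 0" by metis
  have "\<exists>y\<in>carrier N. (\<lambda>n. hnorm N (b n \<ominus>\<^bsub>N\<^esub> y)) \<longlonglongrightarrow> 0"
    by (rule N.complete[unfolded N.H.mcomplete_iff, rule_format, of b])
       (use bN cau W_coord_le(2)[OF dW] in \<open>auto simp: diff\<close>)
  then obtain y where y: "y \<in> carrier N" "(\<lambda>n. hnorm N (b n \<ominus>\<^bsub>N\<^esub> y)) \<longlonglongrightarrow> 0" by auto
  have dl: "(\<lambda>k. hnorm R (a n i \<ominus>\<^bsub>R\<^esub> a k i)) \<longlonglongrightarrow> hnorm R (a n i \<ominus>\<^bsub>R\<^esub> x i)" for n i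
  proof (rule LIM_zero_cancel, rule tendsto_0_le[OF x(2)[of i], where K = 1], rule always_eventually, rule allI)
    fix k
    show "norm (hnorm R (a n i \<ominus>\<^bsub>R\<^esub> a k i) - hnorm R (a n i \<ominus>\<^bsub>R\<^esub> x i)) \<le> norm (hnorm R (a k i \<ominus>\<^bsub>R\<^esub> x i)) * 1"
      using R.H.hnorm_minus_triangle[OF aR[of n i] x(1)[of i] aR[of k i]] 
        R.H.hnorm_minus_triangle[OF aR[of n i] aR[of k i] x(1)[of i]] R.H.hnorm_minus_commute[OF x(1)[of i] aR[of k i]] 
      by simp
  qed
  have tail: "\<exists>K. \<forall>n\<ge>K. summable (\<lambda>i. (hnorm R (a n i \<ominus>\<^bsub>R\<^esub> x i))\<^sup>2) \<and> (\<Sum>i. (hnorm R (a n i \<ominus>\<^bsub>R\<^esub> x i))\<^sup>2) \<le> e\<^sup>2" 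
    if e: "e > 0" for e
  proof -
    obtain K where K: "\<And>m n. m \<ge> K \<Longrightarrow> n \<ge> K \<Longrightarrow> hnorm W (s m \<ominus>\<^bsub>W\<^esub> s n) < e" using c e by blast
    have part: "(\<Sum>i<I. (hnorm R (a n i \<ominus>\<^bsub>R\<^esub> x i))\<^sup>2) \<le> e\<^sup>2" if n: "n \<ge> K" for n I
    proof (rule LIMSEQ_le_const2)
      show "(\<lambda>k. \<Sum>i<I. (hnorm R (a n i \<ominus>\<^bsub>R\<^esub> a k i))\<^sup>2) \<longlonglongrightarrow> (\<Sum>i<I. (hnorm R (a n i \<ominus>\<^bsub>R\<^esub> x i))\<^sup>2)"
        by (intro tendsto_sum tendsto_power dl)
      have "(\<Sum>i<I. (hnorm R (a n i \<ominus>\<^bsub>R\<^esub> a k i))\<^sup>2) \<le> e\<^sup>2" if "k \<ge> K" for k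
      proof -
        have sm: "summable (\<lambda>i. (hnorm R (a n i \<ominus>\<^bsub>R\<^esub> a k i))\<^sup>2)" using dW[of n k] by (simp add: sum_module_simps)
        have "(\<Sum>i<I. (hnorm R (a n i \<ominus>\<^bsub>R\<^esub> a k i))\<^sup>2) \<le> (\<Sum>i. (hnorm R (a n i \<ominus>\<^bsub>R\<^esub> a k i))\<^sup>2)"
          by (rule sum_le_suminf[OF sm]) auto
        also have "\<dots> = (sqrt (\<Sum>i. (hnorm R (a n i \<ominus>\<^bsub>R\<^esub> a k i))\<^sup>2))\<^sup>2" using sm by (simp add: suminf_nonneg)
        also have "\<dots> \<le> e\<^sup>2"
          using W_coord_le(3)[OF dW[of n k]] K[OF n that] sm unfolding diff by (intro power_mono) (auto simp: suminf_nonneg)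
        finally show ?thesis .
      qed
      then show "\<exists>K. \<forall>k\<ge>K. (\<Sum>i<I. (hnorm R (a n i \<ominus>\<^bsub>R\<^esub> a k i))\<^sup>2) \<le> e\<^sup>2" by blast
    qed
    have "summable (\<lambda>i. (hnorm R (a n i \<ominus>\<^bsub>R\<^esub> x i))\<^sup>2) \<and> (\<Sum>i. (hnorm R (a n i \<ominus>\<^bsub>R\<^esub> x i))\<^sup>2) \<le> e\<^sup>2" if n: "n \<ge> K" for n
    proof -
      have "summable (\<lambda>i. (hnorm R (a n i \<ominus>\<^bsub>R\<^esub> x i))\<^sup>2)"
        by (rule summableI_nonneg_bounded[where x = "e\<^sup>2"]) (use part[OF n] in auto)
      then show ?thesis using part[OF n] by (auto intro: suminf_le_const)
    qed
    then show ?thesis by blast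
  qed
  obtain K1 where "\<forall>n\<ge>K1. summable (\<lambda>i. (hnorm R (a n i \<ominus>\<^bsub>R\<^esub> x i))\<^sup>2)" using tail[of 1] by auto
  then have s1: "summable (\<lambda>i. (hnorm R (a K1 i \<ominus>\<^bsub>R\<^esub> x i))\<^sup>2)" by auto
  have "summable (\<lambda>i. (hnorm R (a K1 i \<oplus>\<^bsub>R\<^esub> \<ominus>\<^bsub>R\<^esub> (a K1 i \<ominus>\<^bsub>R\<^esub> x i)))\<^sup>2)"
    by (rule summable_sum) (use aR as x s1 in auto)
  moreover have "a K1 i \<oplus>\<^bsub>R\<^esub> \<ominus>\<^bsub>R\<^esub> (a K1 i \<ominus>\<^bsub>R\<^esub> x i) = x i" for i
    using aR[of K1 i] x(1)[of i] by (simp add: a_minus_def R.mod.M.minus_add R.mod.M.r_neg2 R.mod.M.a_assoc[symmetric] R.mod.M.r_neg)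
  ultimately have xW: "(x, y) \<in> carrier W" using x y by (simp add: sum_module_simps)
  have "(\<lambda>n. hnorm W (s n \<ominus>\<^bsub>W\<^esub> (x, y))) \<longlonglongrightarrow> 0"
  proof (rule LIMSEQ_I)
    fix e :: real assume e: "e > 0"
    obtain K where K: "\<And>n. n \<ge> K \<Longrightarrow> (\<Sum>i. (hnorm R (a n i \<ominus>\<^bsub>R\<^esub> x i))\<^sup>2) \<le> (e / 2)\<^sup>2" 
      using tail[of "e / 2"] e by auto
    obtain L where L: "\<And>n. n \<ge> L \<Longrightarrow> hnorm N (b n \<ominus>\<^bsub>N\<^esub> y) < e / 2" 
      using LIMSEQ_D[OF y(2), of "e / 2"] e bN y(1) by auto
    have "hnorm W (s n \<ominus>\<^bsub>W\<^esub> (x, y)) < e" if "n \<ge> max K L" for n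
    proof -
      have d: "s n \<ominus>\<^bsub>W\<^esub> (x, y) = (\<lambda>i. a n i \<ominus>\<^bsub>R\<^esub> x i, b n \<ominus>\<^bsub>N\<^esub> y)" unfolding sab by (rule W_minus[OF cW xW])
      have dc: "(\<lambda>i. a n i \<ominus>\<^bsub>R\<^esub> x i, b n \<ominus>\<^bsub>N\<^esub> y) \<in> carrier W" unfolding d[symmetric] using s xW by simp
      have "(hnorm N (b n \<ominus>\<^bsub>N\<^esub> y))\<^sup>2 \<le> (e / 2)\<^sup>2" using L[of n] that bN y by (intro power_mono) auto
      then have "(\<Sum>i. (hnorm R (a n i \<ominus>\<^bsub>R\<^esub> x i))\<^sup>2) + (hnorm N (b n \<ominus>\<^bsub>N\<^esub> y))\<^sup>2 \<le> (e / 2)\<^sup>2 + (e / 2)\<^sup>2"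
        using K[of n] that by simp
      also have "\<dots> < e\<^sup>2" using e by (simp add: power2_eq_square)
      finally have "sqrt ((\<Sum>i. (hnorm R (a n i \<ominus>\<^bsub>R\<^esub> x i))\<^sup>2) + (hnorm N (b n \<ominus>\<^bsub>N\<^esub> y))\<^sup>2) < sqrt (e\<^sup>2)"
        by (rule real_sqrt_less_mono)
      then show ?thesis unfolding d W_hnorm[OF dc] using e by simp
    qed
    moreover have "0 \<le> hnorm W (s n \<ominus>\<^bsub>W\<^esub> (x, y))" for n using s xW by simp
    ultimately show "\<exists>no. \<forall>n\<ge>no. norm (hnorm W (s n \<ominus>\<^bsub>W\<^esub> (x, y)) - 0) < e" 
      by (intro exI[of _ "max K L"]) auto
  qed
  then show "\<exists>w\<in>carrier W. (\<lambda>n. hnorm W (s n \<ominus>\<^bsub>W\<^esub> w)) \<longlonglongrightarrow> 0" using xW by blast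
qed

lemma W_hilbert_module: "hilbert_module \<Omega> W"
proof -
  obtain C where C: "C \<ge> 0" "\<And>\<phi> x. \<phi> \<in> A_carrier \<Omega> \<Longrightarrow> x \<in> carrier R \<Longrightarrow> 
        hnorm R (\<phi> \<odot>\<^bsub>R\<^esub> x) \<le> C * A_norm \<Omega> \<phi> * hnorm R x" using R.action_bound by metis
  obtain D where D: "D \<ge> 0" "\<And>\<phi> x. \<phi> \<in> A_carrier \<Omega> \<Longrightarrow> x \<in> carrier N \<Longrightarrow> 
        hnorm N (\<phi> \<odot>\<^bsub>N\<^esub> x) \<le> D * A_norm \<Omega> \<phi> * hnorm N x" using N.action_bound by metis
  have hs: "hilbert_space (underlying \<Omega> W)"
    using W_complete W_pre_hilbert by (simp add: hilbert_space_iff underlying_all)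
  have "hnorm W (\<phi> \<odot>\<^bsub>W\<^esub> u) \<le> (C + D) * A_norm \<Omega> \<phi> * hnorm W u" if \<phi>: "\<phi> \<in> A_carrier \<Omega>" and "u \<in> carrier W" for \<phi> u
  proof -
    obtain h m where u: "u = (h, m)" "(h, m) \<in> carrier W" using \<open>u \<in> carrier W\<close> by (cases u) auto
    have c: "\<And>i. h i \<in> carrier R" "summable (\<lambda>i. (hnorm R (h i))\<^sup>2)" "m \<in> carrier N" 
      using u by (auto simp: sum_module_simps)
    define k where "k = (C + D) * A_norm \<Omega> \<phi>"
    have k: "k \<ge> 0" using C D R.A_norm_nonneg[OF \<phi>] by (simp add: k_def)
    have kC: "C * A_norm \<Omega> \<phi> \<le> k" "D * A_norm \<Omega> \<phi> \<le> k" 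
      unfolding k_def using C D R.A_norm_nonneg[OF \<phi>] by (auto intro!: mult_right_mono)
    have 1: "(hnorm R (\<phi> \<odot>\<^bsub>R\<^esub> h i))\<^sup>2 \<le> k\<^sup>2 * (hnorm R (h i))\<^sup>2" for i
    proof -
      have "hnorm R (\<phi> \<odot>\<^bsub>R\<^esub> h i) \<le> k * hnorm R (h i)"
        using C(2)[OF \<phi> c(1)[of i]] mult_right_mono[OF kC(1) R.H.hnorm_nonneg[OF c(1)[of i]]] by linarith
      then show ?thesis using c \<phi> by (simp add: R.action_closed power_mono flip: power_mult_distrib)
    qed
    have "hnorm N (\<phi> \<odot>\<^bsub>N\<^esub> m) \<le> k * hnorm N m"
      using D(2)[OF \<phi> c(3)] mult_right_mono[OF kC(2) N.H.hnorm_nonneg[OF c(3)]] by linarith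
    then have 2: "(hnorm N (\<phi> \<odot>\<^bsub>N\<^esub> m))\<^sup>2 \<le> k\<^sup>2 * (hnorm N m)\<^sup>2" 
      using c \<phi> by (simp add: N.action_closed power_mono flip: power_mult_distrib)
    have aW: "(\<lambda>i. \<phi> \<odot>\<^bsub>R\<^esub> h i, \<phi> \<odot>\<^bsub>N\<^esub> m) \<in> carrier W"
      using c \<phi> by (simp add: sum_module_simps R.action_closed N.action_closed summable_action)
    have "(\<Sum>i. (hnorm R (\<phi> \<odot>\<^bsub>R\<^esub> h i))\<^sup>2) \<le> (\<Sum>i. k\<^sup>2 * (hnorm R (h i))\<^sup>2)"
      using 1 c \<phi> by (intro suminf_le summable_mult summable_action) auto
    also have "\<dots> = k\<^sup>2 * (\<Sum>i. (hnorm R (h i))\<^sup>2)" by (rule suminf_mult[OF c(2)])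
    finally have "(\<Sum>i. (hnorm R (\<phi> \<odot>\<^bsub>R\<^esub> h i))\<^sup>2) + (hnorm N (\<phi> \<odot>\<^bsub>N\<^esub> m))\<^sup>2 
        \<le> k\<^sup>2 * ((\<Sum>i. (hnorm R (h i))\<^sup>2) + (hnorm N m)\<^sup>2)"
      using 2 by (simp add: distrib_left)
    then have "hnorm W (\<phi> \<odot>\<^bsub>W\<^esub> u) \<le> sqrt (k\<^sup>2 * ((\<Sum>i. (hnorm R (h i))\<^sup>2) + (hnorm N m)\<^sup>2))"
      unfolding u(1) sum_module_simps W_hnorm[OF aW] by (rule real_sqrt_le_mono)
    also have "\<dots> = k * hnorm W u" unfolding u(1) W_hnorm[OF u(2)] using k by (simp add: real_sqrt_mult)
    finally show ?thesis by (simp add: k_def)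
  qed
  then show ?thesis using C D by (intro R.hilbert_moduleI[OF W_module hs, of "C + D"]) auto
qed

end

section \<open>The closed graph that covers a module\<close>

primrec psum :: "('r, 'a, 'k) hilb_scheme \<Rightarrow> (nat \<Rightarrow> 'a) \<Rightarrow> nat \<Rightarrow> 'a" where
  "psum E u 0 = \<zero>\<^bsub>E\<^esub>"
| "psum E u (Suc n) = psum E u n \<oplus>\<^bsub>E\<^esub> u n"

context normed_space
begin

lemma psum_closed: "(\<And>i. u i \<in> carrier H) \<Longrightarrow> psum H u n \<in> carrier H" by (induction n) auto

lemma psum_add: 
  assumes "\<And>i. u i \<in> carrier H" "\<And>i. v i \<in> carrier H"
  shows "psum H (\<lambda>i. u i \<oplus> v i) n = psum H u n \<oplus> psum H v n"
  by (induction n) (use assms psum_closed[of u] psum_closed[of v] in \<open>auto simp: M.a_ac\<close>)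

lemma psum_single:
  assumes "u i \<in> carrier H" shows "psum H (\<lambda>k. if k = i then u k else \<zero>) n = (if i < n then u i else \<zero>)"
  by (induction n) (use assms in \<open>auto simp: less_Suc_eq\<close>)

lemma hnorm_psum: 
  assumes "\<And>i. u i \<in> carrier H" shows "hnorm H (psum H u n) \<le> (\<Sum>i<n. hnorm H (u i))"
proof (induction n)
  case (Suc n)
  then show ?case using hnorm_triangle[of "psum H u n" "u n"] assms psum_closed[of u] by simp
qed simp

end

locale graph = hilb_module_pair \<Omega> R N for \<Omega> :: "(complex ^ 'm) set" and R :: "('m, 'b) hmod" and N :: "('m, 'a) hmod" +
  fixes g :: 'b and f :: "nat \<Rightarrow> 'a"
  assumes g: "g \<in> carrier R" and f: "\<And>i. f i \<in> carrier N" and f_summable: "summable (\<lambda>i. (hnorm N (f i))\<^sup>2)"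
begin

sublocale WH: hilb_module \<Omega> W
  by (intro hilb_module.intro R.bounded_domain_axioms hilb_module_axioms.intro W_hilbert_module)

definition "d i = ((\<lambda>k. if k = i then g else \<zero>\<^bsub>R\<^esub>), f i)"

text \<open>
  The closure of the graph of \<open>\<Sum> \<phi>\<^sub>i g \<otimes> e\<^sub>i \<mapsto> \<Sum> \<phi>\<^sub>i f\<^sub>i\<close>.
\<close>

definition "K = htop W closure_of lincombs (A_alg \<Omega>) W (range d)"

definition "G = W\<lparr>carrier := K\<rparr>"

lemma d_W: "d i \<in> carrier W"
proof -
  have "summable (\<lambda>k. (hnorm R (if k = i then g else \<zero>\<^bsub>R\<^esub>))\<^sup>2)" by (rule summable_finite[of "{i}"]) auto
  then show ?thesis using f g by (auto simp: d_def sum_module_simps)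
qed

lemma range_d: "range d \<subseteq> carrier W" using d_W by auto

lemma K_closed_submodule: "closed_submodule \<Omega> W K"
  unfolding K_def by (rule WH.closure_lincombs_closed_submodule[OF range_d])

lemma K_sub: "submodule K (A_alg \<Omega>) W" using K_closed_submodule by (simp add: closed_submodule_def)

lemmas K_subD = W.submoduleD[OF K_sub]

sublocale G: hilb_module \<Omega> G
  unfolding G_def
  by (intro hilb_module.intro R.bounded_domain_axioms hilb_module_axioms.intro 
      WH.closed_submodule_hilbert_module K_closed_submodule)

lemma G_simps:
  "carrier G = K" "add G = add W" "smult G = smult W" "zero G = zero W" "hnorm G = hnorm W"
  by (simp_all add: G_def restrict_hnorm)

lemma lincombs_K: "lincombs (A_alg \<Omega>) W (range d) \<subseteq> K"
proof
  fix x assume x: "x \<in> lincombs (A_alg \<Omega>) W (range d)"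
  then have "x \<in> carrier W" using W.mod.lincombs_closed[OF range_d] by auto
  then show "x \<in> K" unfolding K_def W.H.closure_of_eq 
    using x by (auto intro!: bexI[of _ x] simp: a_minus_def W.mod.M.r_neg)
qed

lemma d_K: "range d \<subseteq> K" 
  using lincombs_K W.mod.lincombs_gen[OF range_d] by blast

lemma G_generating: "generating \<Omega> G (range d)"
proof -
  have "htop G closure_of lincombs (A_alg \<Omega>) G (range d) = htop W closure_of lincombs (A_alg \<Omega>) W (range d)"
    unfolding G_def WH.restrict_lincombs[OF K_sub d_K] 
    by (rule WH.restrict_closure[OF K_closed_submodule lincombs_K])
  then show ?thesis using d_K by (simp add: generating_def G_simps K_def)
qed

lemma K_cases:
  assumes "u \<in> K" obtains h m where "u = (h, m)" "(h, m) \<in> carrier W" "\<And>i. h i \<in> carrier R" "m \<in> carrier N"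
proof -
  obtain h m where "u = (h, m)" by (cases u)
  then show thesis using that assms K_subD(1) by (auto simp: sum_module_simps subset_iff)
qed

text \<open>
  On a finite combination \<open>(h, y)\<close> of the \<open>d i\<close> the coefficients can be moved across \<open>\<beta>\<close>, so that
  \<open>\<beta> y g = \<Sum> \<beta> (f i) (h i)\<close>. By the Cauchy-Schwarz inequality the norm of this is at most
  \<open>C * sqrt (\<Sum> \<parallel>f i\<parallel>\<^sup>2)\<close> times the norm of \<open>h\<close>, and \<open>h\<close> tends to 0 as \<open>(h, y)\<close> approaches \<open>(0, m)\<close>.
\<close>

lemma balanced_map_vanishes:
  assumes "normed_space E" and C: "C \<ge> 0"
    and cl: "\<And>x r. x \<in> carrier N \<Longrightarrow> r \<in> carrier R \<Longrightarrow> \<beta> x r \<in> carrier E"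
    and add1: "\<And>x y r. x \<in> carrier N \<Longrightarrow> y \<in> carrier N \<Longrightarrow> r \<in> carrier R \<Longrightarrow> \<beta> (x \<oplus>\<^bsub>N\<^esub> y) r = \<beta> x r \<oplus>\<^bsub>E\<^esub> \<beta> y r"
    and add2: "\<And>x r s. x \<in> carrier N \<Longrightarrow> r \<in> carrier R \<Longrightarrow> s \<in> carrier R \<Longrightarrow> \<beta> x (r \<oplus>\<^bsub>R\<^esub> s) = \<beta> x r \<oplus>\<^bsub>E\<^esub> \<beta> x s"
    and bal: "\<And>\<phi> x r. \<phi> \<in> A_carrier \<Omega> \<Longrightarrow> x \<in> carrier N \<Longrightarrow> r \<in> carrier R \<Longrightarrow> \<beta> (\<phi> \<odot>\<^bsub>N\<^esub> x) r = \<beta> x (\<phi> \<odot>\<^bsub>R\<^esub> r)"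
    and bd: "\<And>x r. x \<in> carrier N \<Longrightarrow> r \<in> carrier R \<Longrightarrow> hnorm E (\<beta> x r) \<le> C * hnorm N x * hnorm R r"
    and m: "((\<lambda>i. \<zero>\<^bsub>R\<^esub>), m) \<in> K"
  shows "\<beta> m g = \<zero>\<^bsub>E\<^esub>"
proof -
  interpret E: normed_space E by fact
  have \<beta>0: "\<beta> x \<zero>\<^bsub>R\<^esub> = \<zero>\<^bsub>E\<^esub>" if "x \<in> carrier N" for x
    using bd[OF that, of "\<zero>\<^bsub>R\<^esub>"] cl[OF that, of "\<zero>\<^bsub>R\<^esub>"] 
    by (intro E.hnorm_eq_0D order_antisym) auto
  have mN: "m \<in> carrier N" and mW: "((\<lambda>i. \<zero>\<^bsub>R\<^esub>), m) \<in> carrier W" 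
    using m K_subD(1) by (auto simp: sum_module_simps)
  \<comment> \<open>the sequence \<open>fst w\<close> is finitely supported, so the partial sums are eventually constant\<close>
  have val: "\<exists>n0. \<forall>n\<ge>n0. \<beta> (snd w) g = psum E (\<lambda>i. \<beta> (f i) (fst w i)) n" 
    if "w \<in> lincombs (A_alg \<Omega>) W (range d)" for w
    using range_d that
  proof (induction rule: W.mod.lincombs_induct)
    case zero
    have z: "\<beta> (f i) \<zero>\<^bsub>R\<^esub> = \<zero>\<^bsub>E\<^esub>" for i using \<beta>0 f by simp
    have "psum E (\<lambda>i. \<zero>\<^bsub>E\<^esub>) n = \<zero>\<^bsub>E\<^esub>" for n by (induction n) auto
    moreover have "\<beta> \<zero>\<^bsub>N\<^esub> g = \<zero>\<^bsub>E\<^esub>"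
      using bd[of "\<zero>\<^bsub>N\<^esub>" g] cl[of "\<zero>\<^bsub>N\<^esub>" g] g by (intro E.hnorm_eq_0D order_antisym) auto
    ultimately show ?case by (simp add: sum_module_simps z)
  next
    case (insert a x w)
    obtain i where x: "x = d i" using insert by auto
    obtain h y where w: "w = (h, y)" by (cases w)
    have "w \<in> carrier W" using insert(3) W.mod.lincombs_closed[OF range_d] by auto
    then have hR: "h k \<in> carrier R" and yN: "y \<in> carrier N" for k by (auto simp: w sum_module_simps)
    have a: "a \<in> A_carrier \<Omega>" using insert by simp
    obtain n0 where n0: "\<And>n. n \<ge> n0 \<Longrightarrow> \<beta> y g = psum E (\<lambda>i. \<beta> (f i) (h i)) n" using insert(4) w by auto
    have sum: "a \<odot>\<^bsub>W\<^esub> x \<oplus>\<^bsub>W\<^esub> w = (\<lambda>k. a \<odot>\<^bsub>R\<^esub> (if k = i then g else \<zero>\<^bsub>R\<^esub>) \<oplus>\<^bsub>R\<^esub> h k, a \<odot>\<^bsub>N\<^esub> f i \<oplus>\<^bsub>N\<^esub> y)"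
      by (simp add: x w d_def sum_module_simps)
    have ag: "a \<odot>\<^bsub>R\<^esub> g \<in> carrier R" using a g by (simp add: R.action_closed)
    have summand: "\<beta> (f k) (a \<odot>\<^bsub>R\<^esub> (if k = i then g else \<zero>\<^bsub>R\<^esub>) \<oplus>\<^bsub>R\<^esub> h k) 
        = (if k = i then \<beta> (f k) (a \<odot>\<^bsub>R\<^esub> g) else \<zero>\<^bsub>E\<^esub>) \<oplus>\<^bsub>E\<^esub> \<beta> (f k) (h k)" for k
      using f hR ag a cl[OF f hR, of k k] R.mod.smult_r_null[of a] by (auto simp: add2 \<beta>0[OF f])
    have "\<beta> (a \<odot>\<^bsub>N\<^esub> f i \<oplus>\<^bsub>N\<^esub> y) g = psum E (\<lambda>k. \<beta> (f k) (a \<odot>\<^bsub>R\<^esub> (if k = i then g else \<zero>\<^bsub>R\<^esub>) \<oplus>\<^bsub>R\<^esub> h k)) n" 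
      if n: "n \<ge> max n0 (Suc i)" for n
    proof -
      have "psum E (\<lambda>k. (if k = i then \<beta> (f k) (a \<odot>\<^bsub>R\<^esub> g) else \<zero>\<^bsub>E\<^esub>) \<oplus>\<^bsub>E\<^esub> \<beta> (f k) (h k)) n
         = psum E (\<lambda>k. if k = i then \<beta> (f k) (a \<odot>\<^bsub>R\<^esub> g) else \<zero>\<^bsub>E\<^esub>) n \<oplus>\<^bsub>E\<^esub> psum E (\<lambda>k. \<beta> (f k) (h k)) n"
        by (rule E.psum_add) (use cl f ag hR in auto)
      also have "\<dots> = \<beta> (f i) (a \<odot>\<^bsub>R\<^esub> g) \<oplus>\<^bsub>E\<^esub> \<beta> y g"
        using E.psum_single[of "\<lambda>k. \<beta> (f k) (a \<odot>\<^bsub>R\<^esub> g)" i n] n n0[of n] cl f ag by simp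
      also have "\<dots> = \<beta> (a \<odot>\<^bsub>N\<^esub> f i \<oplus>\<^bsub>N\<^esub> y) g"
        using a f g yN by (simp add: add1 bal N.action_closed)
      finally show ?thesis by (simp only: summand)
    qed
    then show ?case unfolding sum by (intro exI[of _ "max n0 (Suc i)"]) auto
  qed
  define F where "F = sqrt (\<Sum>i. (hnorm N (f i))\<^sup>2)"
  have F0: "F \<ge> 0" unfolding F_def using f_summable by (simp add: suminf_nonneg)
  have small: "hnorm E (\<beta> m g) \<le> e * (C * (hnorm R g + F))" if e: "e > 0" for e
  proof -
    obtain w where w: "w \<in> lincombs (A_alg \<Omega>) W (range d)" "w \<in> carrier W" "hnorm W (((\<lambda>i. \<zero>\<^bsub>R\<^esub>), m) \<ominus>\<^bsub>W\<^esub> w) < e"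
      using m e unfolding K_def W.H.closure_of_eq by blast
    obtain h y where hy: "w = (h, y)" by (cases w)
    have hR: "h k \<in> carrier R" and yN: "y \<in> carrier N" and wW: "(h, y) \<in> carrier W" for k 
      using w(2) by (auto simp: hy sum_module_simps)
    have diff: "((\<lambda>i. \<zero>\<^bsub>R\<^esub>), m) \<ominus>\<^bsub>W\<^esub> w = (\<lambda>i. \<zero>\<^bsub>R\<^esub> \<ominus>\<^bsub>R\<^esub> h i, m \<ominus>\<^bsub>N\<^esub> y)"
      unfolding hy by (rule W_minus[OF mW wW])
    have dW: "(\<lambda>i. \<zero>\<^bsub>R\<^esub> \<ominus>\<^bsub>R\<^esub> h i, m \<ominus>\<^bsub>N\<^esub> y) \<in> carrier W" unfolding diff[symmetric] using mW w by simp
    have nh: "hnorm R (\<zero>\<^bsub>R\<^esub> \<ominus>\<^bsub>R\<^esub> h i) = hnorm R (h i)" for i using hR by (simp add: a_minus_def)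
    have hs: "summable (\<lambda>i. (hnorm R (h i))\<^sup>2)" using wW by (simp add: sum_module_simps)
    have le: "hnorm N (m \<ominus>\<^bsub>N\<^esub> y) \<le> e" "sqrt (\<Sum>i. (hnorm R (h i))\<^sup>2) \<le> e"
      using W_coord_le(2,3)[OF dW] w(3) unfolding diff nh by linarith+
    obtain n where n: "\<beta> y g = psum E (\<lambda>i. \<beta> (f i) (h i)) n" using val[OF w(1)] hy by auto
    have "hnorm E (\<beta> y g) \<le> (\<Sum>i<n. hnorm E (\<beta> (f i) (h i)))"
      unfolding n by (rule E.hnorm_psum) (use cl f hR in auto)
    also have "\<dots> \<le> (\<Sum>i<n. C * (\<bar>hnorm N (f i)\<bar> * \<bar>hnorm R (h i)\<bar>))"
      using bd[OF f hR] f hR by (intro sum_mono) (simp add: mult.assoc)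
    also have "\<dots> = C * (\<Sum>i<n. \<bar>hnorm N (f i)\<bar> * \<bar>hnorm R (h i)\<bar>)" by (simp add: sum_distrib_left)
    also have "\<dots> \<le> C * (F * e)"
    proof (intro mult_left_mono C)
      have "(\<Sum>i<n. \<bar>hnorm N (f i)\<bar> * \<bar>hnorm R (h i)\<bar>) 
          \<le> L2_set (\<lambda>i. hnorm N (f i)) {..<n} * L2_set (\<lambda>i. hnorm R (h i)) {..<n}" by (rule L2_set_mult_ineq)
      also have "\<dots> \<le> F * e"
      proof (rule mult_mono)
        show "L2_set (\<lambda>i. hnorm N (f i)) {..<n} \<le> F"
          unfolding L2_set_def F_def by (intro real_sqrt_le_mono sum_le_suminf f_summable) auto
        have "L2_set (\<lambda>i. hnorm R (h i)) {..<n} \<le> sqrt (\<Sum>i. (hnorm R (h i))\<^sup>2)"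
          unfolding L2_set_def by (intro real_sqrt_le_mono sum_le_suminf hs) auto
        then show "L2_set (\<lambda>i. hnorm R (h i)) {..<n} \<le> e" using le(2) by linarith
      qed (use F0 in auto)
      finally show "(\<Sum>i<n. \<bar>hnorm N (f i)\<bar> * \<bar>hnorm R (h i)\<bar>) \<le> F * e" .
    qed
    finally have 1: "hnorm E (\<beta> y g) \<le> C * (F * e)" .
    have "hnorm E (\<beta> (m \<ominus>\<^bsub>N\<^esub> y) g) \<le> C * hnorm N (m \<ominus>\<^bsub>N\<^esub> y) * hnorm R g" using mN yN g by (intro bd) auto
    also have "\<dots> \<le> C * e * hnorm R g" using le(1) C g by (intro mult_right_mono mult_left_mono) auto
    finally have 2: "hnorm E (\<beta> (m \<ominus>\<^bsub>N\<^esub> y) g) \<le> C * e * hnorm R g" .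
    have "\<beta> m g = \<beta> (m \<ominus>\<^bsub>N\<^esub> y) g \<oplus>\<^bsub>E\<^esub> \<beta> y g"
      using add1[of "m \<ominus>\<^bsub>N\<^esub> y" y g] mN yN g N.H.minus_add_cancel[OF mN yN] by simp
    then have "hnorm E (\<beta> m g) \<le> hnorm E (\<beta> (m \<ominus>\<^bsub>N\<^esub> y) g) + hnorm E (\<beta> y g)"
      using E.hnorm_triangle[OF cl cl, of "m \<ominus>\<^bsub>N\<^esub> y" g y g] mN yN g by simp
    then show ?thesis using 1 2 by (simp add: algebra_simps)
  qed
  have "hnorm E (\<beta> m g) \<le> 0"
  proof (rule field_le_epsilon)
    fix e :: real assume e: "e > 0"
    define k where "k = C * (hnorm R g + F) + 1"
    have k: "k > 0" using C F0 g by (simp add: k_def add_nonneg_pos)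
    have "hnorm E (\<beta> m g) \<le> (e / k) * (C * (hnorm R g + F))" using small[of "e / k"] e k by simp
    also have "\<dots> \<le> (e / k) * k" using e k by (intro mult_left_mono) (auto simp: k_def)
    finally show "hnorm E (\<beta> m g) \<le> 0 + e" using k by simp
  qed
  then show ?thesis using cl[OF mN g] by (intro E.hnorm_eq_0D order_antisym) auto
qed

end

definition separated :: "(complex ^ 'm) set \<Rightarrow> ('m, 'a) hmod \<Rightarrow> bool" where
  "separated \<Omega> M \<longleftrightarrow> (\<forall>x\<in>carrier M. (\<forall>z\<in>\<Omega>. \<forall>\<Lambda> B. functional_at \<Omega> M z \<Lambda> B \<longrightarrow> \<Lambda> x = 0) \<longrightarrow> x = \<zero>\<^bsub>M\<^esub>)"

locale graph_rank_one = graph \<Omega> R N g f + rank_one \<Omega> R g \<gamma>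
  for \<Omega> :: "(complex ^ 'm) set" and R :: "('m, 'b) hmod" and N :: "('m, 'a) hmod" and g f \<gamma> +
  assumes f_gen: "generating \<Omega> N (range f)"
begin

lemma \<gamma>_functional: "z \<in> \<Omega> \<Longrightarrow> \<exists>B. functional_at \<Omega> R z (\<gamma> z) B"
  using \<gamma>_bd[of z] by (meson IntI centre_in_ball)

definition "\<Lambda> z i w = \<gamma> z (fst w i)" for w :: "(nat \<Rightarrow> 'b) \<times> 'a"

lemma \<Lambda>_functional: "z \<in> \<Omega> \<Longrightarrow> functional_at \<Omega> R z (\<gamma> z) B \<Longrightarrow> functional_at \<Omega> G z (\<Lambda> z i) B"
proof -
  assume z: "z \<in> \<Omega>" and B: "functional_at \<Omega> R z (\<gamma> z) B"
  note L = R.functional_at_simps[OF B z]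
  show ?thesis unfolding functional_at_def
  proof (intro conjI ballI)
    show "B \<ge> 0" by (rule L)
    fix u assume "u \<in> carrier G"
    then obtain h m where u: "u = (h, m)" "(h, m) \<in> carrier W" "\<And>i. h i \<in> carrier R" "m \<in> carrier N"
      unfolding G_simps by (rule K_cases) blast
    show "cmod (\<Lambda> z i u) \<le> B * hnorm G u"
      using L(3)[OF u(3)[of i]] mult_left_mono[OF W_coord_le(1)[OF u(2), of i] L(4)] 
      by (simp add: \<Lambda>_def u(1) G_simps)
    show "\<Lambda> z i (\<phi> \<odot>\<^bsub>G\<^esub> u) = \<phi> z * \<Lambda> z i u" if "\<phi> \<in> A_carrier \<Omega>" for \<phi>
      using L(2)[OF that u(3)] by (simp add: \<Lambda>_def u(1) G_simps sum_module_simps)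
    fix v assume "v \<in> carrier G"
    then obtain k n where v: "v = (k, n)" "(k, n) \<in> carrier W" "\<And>i. k i \<in> carrier R" "n \<in> carrier N"
      unfolding G_simps by (rule K_cases) blast
    show "\<Lambda> z i (u \<oplus>\<^bsub>G\<^esub> v) = \<Lambda> z i u + \<Lambda> z i v"
      using L(1)[OF u(3) v(3)] by (simp add: \<Lambda>_def u(1) v(1) G_simps sum_module_simps)
  qed
qed

text \<open>
  Closability says that an element of \<open>G\<close> is determined by its first component, and the functionals \<open>\<gamma>\<^sub>z\<close>
  see that component in every coordinate. So the criterion for quasi-freeness applies to \<open>G\<close>.
\<close>

theorem quasi_free_cover:
  assumes closable: "\<And>m. \<lbrakk>m \<in> carrier N; ((\<lambda>i. \<zero>\<^bsub>R\<^esub>), m) \<in> K\<rbrakk> \<Longrightarrow> m = \<zero>\<^bsub>N\<^esub>"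
  shows "\<exists>(R' :: ('m, nat \<Rightarrow> complex) hmod) X. hilbert_module \<Omega> R' \<and> quasi_free \<Omega> R' \<and> 
    separable_mod R' (carrier R') \<and> separated \<Omega> R' \<and> module_map \<Omega> R' N X \<and> 
    htop N closure_of (X ` carrier R') = carrier N"
proof -
  have "separable_mod G (carrier G)"
    by (rule G.separable_if_countably_generated[OF _ G_generating]) simp
  then obtain j :: "(nat \<Rightarrow> 'b) \<times> 'a \<Rightarrow> nat \<Rightarrow> complex" where j: "inj_on j (carrier G)"
    by (rule G.separable_injection)
  interpret J: transported \<Omega> G j
    by (intro transported.intro G.hilb_module_axioms transported_axioms.intro j)
  let ?R = "transport j G" and ?i = "inv_into (carrier G) j"
  have sep: "w = \<zero>\<^bsub>G\<^esub>" if w: "w \<in> carrier G" and 0: "\<And>z i. z \<in> \<Omega> \<Longrightarrow> \<Lambda> z i w = 0" for w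
  proof -
    obtain h m where u: "w = (h, m)" "(h, m) \<in> carrier W" "\<And>i. h i \<in> carrier R" "m \<in> carrier N"
      using w unfolding G_simps by (rule K_cases) blast
    have "h i = \<zero>\<^bsub>R\<^esub>" for i using \<gamma>_sep[OF u(3)[of i]] 0[of _ i] by (simp add: \<Lambda>_def u(1))
    then have h: "h = (\<lambda>i. \<zero>\<^bsub>R\<^esub>)" by auto
    then have "m = \<zero>\<^bsub>N\<^esub>" using closable[OF u(4)] w by (simp add: u(1) G_simps)
    then show ?thesis by (simp add: u(1) h G_simps sum_module_simps)
  qed
  have gen: "generating \<Omega> ?R (range (\<lambda>i. j (d i)))"
    using J.tr_generating[OF G_generating] by (simp add: image_image)
  have "quasi_free_rel \<Omega> ?R \<infinity> (\<lambda>i. j (d i))"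
  proof (rule J.T.quasi_free_criterion[where \<Lambda> = "\<lambda>z i u. \<Lambda> z i (?i u)", OF gen])
    show "\<exists>B. functional_at \<Omega> ?R z (\<lambda>u. \<Lambda> z i (?i u)) B" if "z \<in> \<Omega>" for z i
      using \<gamma>_functional[OF that] \<Lambda>_functional[OF that] J.tr_functional by blast
    have dG: "d k \<in> carrier G" for k using d_K by (auto simp: G_simps)
    show "\<Lambda> z i (?i (j (d k))) = (if i = k then 1 else 0)" if z: "z \<in> \<Omega>" for z i k
    proof -
      obtain B where "functional_at \<Omega> R z (\<gamma> z) B" using \<gamma>_functional[OF z] by auto
      then have "\<gamma> z \<zero>\<^bsub>R\<^esub> = 0" using R.functional_at_simps(7) z by blast
      then show ?thesis using \<gamma>_g[OF z] dG by (simp add: \<Lambda>_def d_def)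
    qed
    show "u = \<zero>\<^bsub>?R\<^esub>" if u: "u \<in> carrier ?R" and 0: "\<And>z i. z \<in> \<Omega> \<Longrightarrow> \<Lambda> z i (?i u) = 0" for u
    proof -
      obtain w where w: "w \<in> carrier G" "u = j w" using u by auto
      have "w = \<zero>\<^bsub>G\<^esub>" by (rule sep[OF w(1)]) (use 0 w in simp)
      then show ?thesis using w by simp
    qed
    fix z0 assume "z0 \<in> \<Omega>"
    then obtain r B where r: "r > 0" and B: "\<And>z. z \<in> \<Omega> \<inter> ball z0 r \<Longrightarrow> functional_at \<Omega> R z (\<gamma> z) B"
      using \<gamma>_bd by blast
    have B0: "B \<ge> 0" using B[of z0] \<open>z0 \<in> \<Omega>\<close> r by (simp add: functional_at_def)
    have "summable (\<lambda>i. (cmod (\<Lambda> z i (?i u)))\<^sup>2) \<and> sqrt (\<Sum>i. (cmod (\<Lambda> z i (?i u)))\<^sup>2) \<le> B * hnorm ?R u"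
      if zr: "z \<in> \<Omega> \<inter> ball z0 r" and u: "u \<in> carrier ?R" for z u
    proof -
      obtain w where w: "w \<in> carrier G" "u = j w" using u by auto
      obtain h m where hm: "w = (h, m)" "(h, m) \<in> carrier W" "\<And>i. h i \<in> carrier R" "m \<in> carrier N"
        using w(1) unfolding G_simps by (rule K_cases) blast
      have hs: "summable (\<lambda>i. (hnorm R (h i))\<^sup>2)" using hm by (simp add: sum_module_simps)
      have le: "(cmod (\<gamma> z (h i)))\<^sup>2 \<le> B\<^sup>2 * (hnorm R (h i))\<^sup>2" for i
        using R.functional_at_simps(3)[OF B[OF zr] _ hm(3)[of i]] zr
        by (simp add: power_mono flip: power_mult_distrib)
      have s: "summable (\<lambda>i. (cmod (\<gamma> z (h i)))\<^sup>2)"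
        by (rule summable_comparison_test'[OF summable_mult[OF hs, of "B\<^sup>2"]]) (use le in auto)
      have "(\<Sum>i. (cmod (\<gamma> z (h i)))\<^sup>2) \<le> (\<Sum>i. B\<^sup>2 * (hnorm R (h i))\<^sup>2)"
        using le s by (intro suminf_le summable_mult hs) auto
      also have "\<dots> = B\<^sup>2 * (\<Sum>i. (hnorm R (h i))\<^sup>2)" by (rule suminf_mult[OF hs])
      finally have "sqrt (\<Sum>i. (cmod (\<gamma> z (h i)))\<^sup>2) \<le> sqrt (B\<^sup>2 * (\<Sum>i. (hnorm R (h i))\<^sup>2))"
        by (rule real_sqrt_le_mono)
      also have "\<dots> = B * sqrt (\<Sum>i. (hnorm R (h i))\<^sup>2)" using B0 by (simp add: real_sqrt_mult)
      also have "\<dots> \<le> B * hnorm W (h, m)" by (intro mult_left_mono W_coord_le(3) hm B0)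
      finally have le': "sqrt (\<Sum>i. (cmod (\<gamma> z (h i)))\<^sup>2) \<le> B * hnorm W (h, m)" .
      have "?i u = (h, m)" "hnorm ?R u = hnorm W (h, m)" using w hm(1) G_simps(5) by simp_all
      then show ?thesis using s le' by (simp add: \<Lambda>_def)
    qed
    then show "\<exists>r>0. \<exists>B\<ge>0. \<forall>z\<in>\<Omega> \<inter> ball z0 r. \<forall>u\<in>carrier ?R. 
        summable (\<lambda>i. (cmod (\<Lambda> z i (?i u)))\<^sup>2) \<and> sqrt (\<Sum>i. (cmod (\<Lambda> z i (?i u)))\<^sup>2) \<le> B * hnorm ?R u"
      using r B0 by blast
  qed
  then have qf: "quasi_free \<Omega> ?R" unfolding quasi_free_def by blast
  have "separable_mod ?R (carrier ?R)"
    by (rule J.T.separable_if_countably_generated[OF _ gen]) simp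
  moreover have "separated \<Omega> ?R"
    unfolding separated_def
  proof (intro ballI impI)
    fix u assume "u \<in> carrier ?R" and 0: "\<forall>z\<in>\<Omega>. \<forall>L B. functional_at \<Omega> ?R z L B \<longrightarrow> L u = 0"
    then obtain w where w: "w \<in> carrier G" "u = j w" by auto
    have "\<Lambda> z i w = 0" if z: "z \<in> \<Omega>" for z i
    proof -
      obtain B where "functional_at \<Omega> ?R z (\<lambda>u. \<Lambda> z i (?i u)) B"
        using \<gamma>_functional[OF z] \<Lambda>_functional[OF z] J.tr_functional by blast
      then have "\<Lambda> z i (?i u) = 0" using 0 z by blast
      then show ?thesis using w by simp
    qed
    then show "u = \<zero>\<^bsub>?R\<^esub>" using sep[OF w(1)] w by simp
  qed
  moreover define X where "X u = snd (?i u)" for u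
  have Xj: "X (j w) = snd w" if "w \<in> carrier G" for w using that by (simp add: X_def)
  have "module_map \<Omega> ?R N X"
    unfolding module_map_def bounded_hom_def
  proof (intro exI[of _ 1] conjI ballI funcsetI)
    fix u assume "u \<in> carrier ?R"
    then obtain w where w: "w \<in> carrier G" "u = j w" by auto
    obtain h m where hm: "w = (h, m)" "(h, m) \<in> carrier W" "\<And>i. h i \<in> carrier R" "m \<in> carrier N"
      using w(1) unfolding G_simps by (rule K_cases) blast
    show "X u \<in> carrier N" using w hm by (simp add: Xj)
    show "hnorm N (X u) \<le> 1 * hnorm ?R u" using W_coord_le(2)[OF hm(2)] w hm(1) by (simp add: Xj G_simps)
    show "X (\<phi> \<odot>\<^bsub>?R\<^esub> u) = \<phi> \<odot>\<^bsub>N\<^esub> X u" if "\<phi> \<in> carrier (A_alg \<Omega>)" for \<phi>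
    proof -
      have "\<phi> \<odot>\<^bsub>G\<^esub> w \<in> carrier G" using that w by (simp add: G.action_closed)
      then show ?thesis using w hm(1) by (simp add: Xj) (simp add: G_simps sum_module_simps)
    qed
    fix v assume "v \<in> carrier ?R"
    then obtain w' where w': "w' \<in> carrier G" "v = j w'" by auto
    obtain k n where kn: "w' = (k, n)" by (cases w')
    have "w \<oplus>\<^bsub>G\<^esub> w' \<in> carrier G" using w w' by simp
    then show "X (u \<oplus>\<^bsub>?R\<^esub> v) = X u \<oplus>\<^bsub>N\<^esub> X v"
      using w w' hm(1) kn by (simp add: Xj) (simp add: G_simps sum_module_simps)
  qed
  moreover have "htop N closure_of (X ` carrier ?R) = carrier N"
  proof -
    have img: "X ` carrier ?R = snd ` K" using Xj by (auto simp: G_simps image_iff) metis+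
    have "y \<in> snd ` K" if "y \<in> lincombs (A_alg \<Omega>) N (range f)" for y
    proof -
      have "range f \<subseteq> carrier N" using f by auto
      then show ?thesis using that
      proof (induction rule: N.mod.lincombs_induct)
        case zero
        have "snd \<zero>\<^bsub>W\<^esub> = \<zero>\<^bsub>N\<^esub>" by (simp add: sum_module_simps)
        then show ?case using K_subD(2) by (metis imageI)
      next
        case (insert a x y)
        obtain i where i: "x = f i" using insert by auto
        obtain h where h: "(h, y) \<in> K" using insert(4) by auto
        have "a \<odot>\<^bsub>W\<^esub> d i \<oplus>\<^bsub>W\<^esub> (h, y) \<in> K" 
          using insert(1) d_K h by (intro K_subD(4,5)) auto
        moreover have "snd (a \<odot>\<^bsub>W\<^esub> d i \<oplus>\<^bsub>W\<^esub> (h, y)) = a \<odot>\<^bsub>N\<^esub> x \<oplus>\<^bsub>N\<^esub> y"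
          by (simp add: d_def i sum_module_simps)
        ultimately show ?case by (metis imageI)
      qed
    qed
    then have "htop N closure_of lincombs (A_alg \<Omega>) N (range f) \<subseteq> htop N closure_of (snd ` K)"
      by (intro closure_of_mono) auto
    moreover have "htop N closure_of (snd ` K) \<subseteq> carrier N" unfolding N.H.closure_of_eq by blast
    ultimately show ?thesis using f_gen unfolding generating_def img by blast
  qed
  ultimately show ?thesis using qf J.tr_hilbert_module by blast
qed

end

section \<open>The resolution\<close>

lemma (in hilb_module) square_summable_generators:
  assumes "countable S" "generating \<Omega> M S"
  obtains f :: "nat \<Rightarrow> 'a" where "\<And>i. f i \<in> carrier M" "summable (\<lambda>i. (hnorm M (f i))\<^sup>2)" 
    "generating \<Omega> M (range f)"
proof -
  have S: "S \<subseteq> carrier M" and d: "htop M closure_of lincombs (A_alg \<Omega>) M S = carrier M" 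
    using assms by (auto simp: generating_def)
  \<comment> \<open>zero is added because the generating set may be empty\<close>
  define s where "s = from_nat_into (insert \<zero> S)"
  have rs: "range s = insert \<zero> S" unfolding s_def using assms by (intro range_from_nat_into) auto
  have sM: "s i \<in> carrier M" for i using rs S by (metis insertE mod.M.zero_closed rangeI subsetD)
  define c where "c i = (1 / 2) ^ i / (1 + hnorm M (s i))" for i
  have c: "c i > 0" for i using sM[of i] by (simp add: c_def add_pos_nonneg)
  define f where "f i = A_const \<Omega> (of_real (c i)) \<odot> s i" for i
  have fM: "f i \<in> carrier M" for i by (simp add: f_def action_closed A_const_in sM)
  have "hnorm M (f i) \<le> (1 / 2) ^ i" for i
  proof -
    have "hnorm M (f i) = (1 / 2) ^ i * (hnorm M (s i) / (1 + hnorm M (s i)))"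

    proof -
      have "hnorm M (f i) = c i * hnorm M (s i)"
        using c[of i] H.hnorm_smult[OF sM[of i], of "of_real (c i)"] by (simp add: f_def)
      then show ?thesis by (simp add: c_def)
    qed
    also have "\<dots> \<le> (1 / 2) ^ i * 1" using sM[of i] by (intro mult_left_mono) (auto simp: divide_le_eq_1 add_pos_nonneg)
    finally show ?thesis by simp
  qed
  then have "(hnorm M (f i))\<^sup>2 \<le> (1 / 4) ^ i" for i
    using power_mono[of "hnorm M (f i)" "(1 / 2) ^ i" 2] fM[of i] 
    by (simp add: power2_eq_square flip: power_mult_distrib)
  then have sm: "summable (\<lambda>i. (hnorm M (f i))\<^sup>2)"
    by (intro summable_comparison_test'[OF summable_geometric[of "1 / 4 :: real"]]) auto
  have rf: "range f \<subseteq> carrier M" using fM by auto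
  have "lincombs (A_alg \<Omega>) M S \<subseteq> lincombs (A_alg \<Omega>) M (range f)"
  proof
    fix y assume "y \<in> lincombs (A_alg \<Omega>) M S"
    with S show "y \<in> lincombs (A_alg \<Omega>) M (range f)"
    proof (induction rule: mod.lincombs_induct)
      case zero show ?case by (rule mod.lincombs_zero)
    next
      case (insert a x w)
      have "x \<in> range s" using rs insert(2) by auto
      then obtain i where i: "x = s i" by auto
      have k: "of_real (1 / c i) * of_real (c i) = (1 :: complex)" using c[of i] by (simp flip: of_real_mult)
      have "A_const \<Omega> (of_real (1 / c i)) \<odot> f i = x"
        using H.smult_smult[OF sM[of i], of "of_real (1 / c i)" "of_real (c i)"] H.one_smult[OF sM[of i]] 
        unfolding f_def i k by simp
      then have e: "a \<odot> x = (a \<otimes>\<^bsub>A_alg \<Omega>\<^esub> A_const \<Omega> (of_real (1 / c i))) \<odot> f i"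
        using mod.smult_assoc1[of a "A_const \<Omega> (of_real (1 / c i))" "f i"] insert(1) fM[of i] A_const_in by simp
      have "f i \<in> range f" by simp
      then show ?case unfolding e by (intro mod.lincombs_insert[OF rf]) (use insert A_const_in in auto)
    qed
  qed
  then have "htop M closure_of lincombs (A_alg \<Omega>) M S \<subseteq> htop M closure_of lincombs (A_alg \<Omega>) M (range f)"
    by (rule closure_of_mono)
  moreover have "htop M closure_of lincombs (A_alg \<Omega>) M (range f) \<subseteq> carrier M" 
    unfolding H.closure_of_eq by blast
  ultimately have "generating \<Omega> M (range f)" using d rf by (auto simp: generating_def)
  then show thesis using that fM sm by blast
qed

context graph
begin

text \<open>
  The balanced map is the module tensor product.
\<close>

lemma closable_if_smooth:
  assumes "smooth_rel \<Omega> N R g" and m: "m \<in> carrier N" "((\<lambda>i. \<zero>\<^bsub>R\<^esub>), m) \<in> K"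
  shows "m = \<zero>\<^bsub>N\<^esub>"
proof -
  interpret T: tensor_modules \<Omega> N R by (intro tensor_modules.intro N.hilb_module_axioms R.hilb_module_axioms)
  have z: "mtens \<Omega> N R \<zero>\<^bsub>N\<^esub> g = \<zero>\<^bsub>T.Q\<^esub>" using g by (simp add: T.mtens_eq T.htens_zero_left T.zero_Q)
  have "mtens \<Omega> N R m g = \<zero>\<^bsub>underlying \<Omega> T.Q\<^esub>"
  proof (rule balanced_map_vanishes[OF T.Q.normed_space_axioms zero_le_one, where \<beta> = "mtens \<Omega> N R", OF _ _ _ _ _ m(2)], unfold underlying_all)
    fix x r assume x: "x \<in> carrier N" and r: "r \<in> carrier R"
    show "mtens \<Omega> N R x r \<in> carrier T.Q" using x r by (simp add: T.mtens_eq T.carrier_Q T.htens_closed)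
    show "hnorm T.Q (mtens \<Omega> N R x r) \<le> 1 * hnorm N x * hnorm R r"
      using x r T.p_le[of "htens N R x r"] by (simp add: T.mtens_eq T.hnorm_Q T.htens_closed T.hnorm_htens)
    show "mtens \<Omega> N R (x \<oplus>\<^bsub>N\<^esub> y) r = mtens \<Omega> N R x r \<oplus>\<^bsub>T.Q\<^esub> mtens \<Omega> N R y r" if "y \<in> carrier N" for y
      using x r that by (simp add: T.mtens_eq T.htens_add T.add_Q T.htens_closed)
    show "mtens \<Omega> N R x (r \<oplus>\<^bsub>R\<^esub> s) = mtens \<Omega> N R x r \<oplus>\<^bsub>T.Q\<^esub> mtens \<Omega> N R x s" if "s \<in> carrier R" for s
      using x r that by (simp add: T.mtens_eq T.htens_add T.add_Q T.htens_closed)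
    show "mtens \<Omega> N R (\<phi> \<odot>\<^bsub>N\<^esub> x) r = mtens \<Omega> N R x (\<phi> \<odot>\<^bsub>R\<^esub> r)" if "\<phi> \<in> A_carrier \<Omega>" for \<phi>
      using x r that T.relator_in[OF that x r] 
      by (simp add: T.mtens_eq T.pi_eq_iff T.htens_closed N.action_closed R.action_closed)
  qed
  then have "mtens \<Omega> N R m g = mtens \<Omega> N R \<zero>\<^bsub>N\<^esub> g" by (simp add: z underlying_all)
  then show ?thesis using assms(1) m(1) unfolding smooth_rel_def inj_on_def by auto
qed

text \<open>
  The balanced maps are \<open>(x, r) \<mapsto> \<Lambda> x * \<gamma> z r\<close>, with values in \<open>\<complex>\<^sub>z\<close>.
\<close>

lemma closable_if_separated:
  assumes "separated \<Omega> N" and \<gamma>: "\<And>z. z \<in> \<Omega> \<Longrightarrow> \<exists>B. functional_at \<Omega> R z (\<gamma> z) B" "\<And>z. z \<in> \<Omega> \<Longrightarrow> \<gamma> z g = 1"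
    and m: "m \<in> carrier N" "((\<lambda>i. \<zero>\<^bsub>R\<^esub>), m) \<in> K"
  shows "m = \<zero>\<^bsub>N\<^esub>"
proof -
  have "\<Lambda> m = 0" if z: "z \<in> \<Omega>" and \<Lambda>: "functional_at \<Omega> N z \<Lambda> B" for z \<Lambda> B
  proof -
    obtain B' where B': "functional_at \<Omega> R z (\<gamma> z) B'" using \<gamma>(1)[OF z] by auto
    note L = N.functional_at_simps[OF \<Lambda> z] and L' = R.functional_at_simps[OF B' z]
    interpret P: hilb_module \<Omega> "point_module z"
      by (intro hilb_module.intro R.bounded_domain_axioms hilb_module_axioms.intro R.hilbert_module_point z)
    have "\<Lambda> m * \<gamma> z g = \<zero>\<^bsub>underlying \<Omega> (point_module z)\<^esub>"
    proof (rule balanced_map_vanishes[OF P.H.normed_space_axioms, where \<beta> = "\<lambda>x r. \<Lambda> x * \<gamma> z r" and C = "B * B'", OF _ _ _ _ _ _ m(2)], unfold underlying_all)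
      fix x r assume x: "x \<in> carrier N" and r: "r \<in> carrier R"
      have "cmod (\<Lambda> x) * cmod (\<gamma> z r) \<le> (B * hnorm N x) * (B' * hnorm R r)"
        using L(3)[OF x] L'(3)[OF r] L(4) x by (intro mult_mono) auto
      then show "hnorm (point_module z) (\<Lambda> x * \<gamma> z r) \<le> B * B' * hnorm N x * hnorm R r"
        by (simp add: norm_mult mult_ac)
    qed (use L L' in \<open>auto simp: algebra_simps\<close>)
    then show ?thesis using \<gamma>(2)[OF z] by (simp add: underlying_all)
  qed
  then show ?thesis using assms(1) m(1) unfolding separated_def by blast
qed

end

text \<open>
  The properties that one step of the resolution hands to the next: the last two make every closed
  submodule of \<open>M\<close> countably generated and closable.
\<close>

definition resolving :: "(complex ^ 'm) set \<Rightarrow> ('m, 'a) hmod \<Rightarrow> bool" where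
  "resolving \<Omega> M \<longleftrightarrow> hilbert_module \<Omega> M \<and> quasi_free \<Omega> M \<and> separable_mod M (carrier M) \<and> separated \<Omega> M"

context rank_one
begin

lemma cover:
  fixes N :: "('m, 'c) hmod"
  assumes N: "hilbert_module \<Omega> N" "countable S" "generating \<Omega> N S"
    and sm: "smooth_rel \<Omega> N R g \<or> separated \<Omega> N"
  shows "\<exists>(R' :: ('m, nat \<Rightarrow> complex) hmod) X. resolving \<Omega> R' \<and> module_map \<Omega> R' N X \<and> 
    htop N closure_of (X ` carrier R') = carrier N"
proof -
  interpret N: hilb_module \<Omega> N by (intro hilb_module.intro bounded_domain_axioms hilb_module_axioms.intro N)
  obtain f where f: "\<And>i. f i \<in> carrier N" "summable (\<lambda>i. (hnorm N (f i))\<^sup>2)" "generating \<Omega> N (range f)"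
    using N.square_summable_generators[OF N(2,3)] by blast
  interpret graph_rank_one \<Omega> R N g f \<gamma>
    by (intro graph_rank_one.intro graph.intro hilb_module_pair.intro graph_axioms.intro graph_rank_one_axioms.intro
        rank_one_axioms hilb_module_axioms N.hilb_module_axioms g f)
  have "m = \<zero>\<^bsub>N\<^esub>" if "m \<in> carrier N" "((\<lambda>i. \<zero>\<^bsub>R\<^esub>), m) \<in> K" for m
    using sm closable_if_smooth[OF _ that] closable_if_separated[OF _ \<gamma>_functional \<gamma>_g that] by blast
  then show ?thesis using quasi_free_cover unfolding resolving_def by blast
qed

lemma kernel_closed_submodule:
  fixes M :: "('m, 'c) hmod" and N :: "('m, 'd) hmod"
  assumes "hilbert_module \<Omega> M" "hilbert_module \<Omega> N" "module_map \<Omega> M N X"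
  shows "closed_submodule \<Omega> M (a_kernel M N X)"
proof -
  interpret M: hilb_module \<Omega> M by (intro hilb_module.intro bounded_domain_axioms hilb_module_axioms.intro assms)
  interpret N: hilb_module \<Omega> N by (intro hilb_module.intro bounded_domain_axioms hilb_module_axioms.intro assms)
  obtain B where B: "bounded_hom (A_alg \<Omega>) M N X B" using assms by (auto simp: module_map_def)
  have c: "\<And>x. x \<in> carrier M \<Longrightarrow> X x \<in> carrier N"
    and a: "\<And>x y. x \<in> carrier M \<Longrightarrow> y \<in> carrier M \<Longrightarrow> X (x \<oplus>\<^bsub>M\<^esub> y) = X x \<oplus>\<^bsub>N\<^esub> X y"
    and s: "\<And>\<phi> x. \<phi> \<in> A_carrier \<Omega> \<Longrightarrow> x \<in> carrier M \<Longrightarrow> X (\<phi> \<odot>\<^bsub>M\<^esub> x) = \<phi> \<odot>\<^bsub>N\<^esub> X x"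
    and b: "\<And>x. x \<in> carrier M \<Longrightarrow> hnorm N (X x) \<le> B * hnorm M x"
    using B by (auto simp: bounded_hom_def)
  let ?K = "a_kernel M N X"
  have K: "x \<in> ?K \<longleftrightarrow> x \<in> carrier M \<and> X x = \<zero>\<^bsub>N\<^esub>" for x by (simp add: a_kernel_def')
  have neg: "X (\<ominus>\<^bsub>M\<^esub> x) = \<ominus>\<^bsub>N\<^esub> X x" if "x \<in> carrier M" for x
    using s[OF A_const_in that, of "-1"] M.H.minus_smult[OF that, of 1] M.H.one_smult[OF that] 
      N.H.minus_smult[OF c[OF that], of 1] N.H.one_smult[OF c[OF that]] that c by simp
  have z: "X \<zero>\<^bsub>M\<^esub> = \<zero>\<^bsub>N\<^esub>" using b[of "\<zero>\<^bsub>M\<^esub>"] c by (intro N.H.hnorm_eq_0D order_antisym) auto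
  have "submodule ?K (A_alg \<Omega>) M"
    by (rule M.mod.submoduleI) (auto simp: K a s neg z c M.action_closed N.mod.smult_r_null)
  moreover have "closedin (htop M) ?K" unfolding M.H.closedin_iff
  proof (intro conjI ballI impI)
    fix x assume x: "x \<in> carrier M" and ap: "\<forall>e>0. \<exists>y\<in>?K. hnorm M (x \<ominus>\<^bsub>M\<^esub> y) < e"
    have "hnorm N (X x) \<le> 0"
    proof (rule field_le_epsilon)
      fix e :: real assume e: "e > 0"
      define k where "k = \<bar>B\<bar> + 1"
      have k: "k > 0" by (simp add: k_def)
      obtain y where y: "y \<in> carrier M" "X y = \<zero>\<^bsub>N\<^esub>" "hnorm M (x \<ominus>\<^bsub>M\<^esub> y) < e / k" 
        using ap e k K by (meson divide_pos_pos)
      have "X x = X (x \<ominus>\<^bsub>M\<^esub> y)" using x y c by (simp add: a_minus_def a neg)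
      then have "hnorm N (X x) \<le> B * hnorm M (x \<ominus>\<^bsub>M\<^esub> y)" using b[of "x \<ominus>\<^bsub>M\<^esub> y"] x y by simp
      also have "\<dots> \<le> k * (e / k)" using x y(1,3) k by (intro mult_mono) (auto simp: k_def)
      finally show "hnorm N (X x) \<le> 0 + e" using k by simp
    qed
    then have "X x = \<zero>\<^bsub>N\<^esub>" using c[OF x] by (intro N.H.hnorm_eq_0D order_antisym) auto
    then show "x \<in> ?K" using x K by simp
  qed (auto simp: K)
  ultimately show ?thesis by (simp add: closed_submodule_def)
qed

text \<open>
  A submodule inherits separability, hence a countable generating set, and the functionals of \<open>M\<close>.
\<close>

lemma cover_submodule:
  fixes M :: "('m, 'c) hmod"
  assumes M: "resolving \<Omega> M" and K: "closed_submodule \<Omega> M K"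
  shows "\<exists>(R' :: ('m, nat \<Rightarrow> complex) hmod) X. resolving \<Omega> R' \<and> module_map \<Omega> R' M X \<and> 
    htop M closure_of (X ` carrier R') = K"
proof -
  have hM: "hilbert_module \<Omega> M" and sepM: "separable_mod M (carrier M)" and sM: "separated \<Omega> M" 
    using M by (auto simp: resolving_def)
  interpret M: hilb_module \<Omega> M by (intro hilb_module.intro bounded_domain_axioms hilb_module_axioms.intro hM)
  have sub: "submodule K (A_alg \<Omega>) M" using K by (simp add: closed_submodule_def)
  have KM: "K \<subseteq> carrier M" using M.submoduleD(1)[OF sub] .
  let ?N = "M\<lparr>carrier := K\<rparr>"
  interpret N: hilb_module \<Omega> ?N 
    by (intro hilb_module.intro bounded_domain_axioms hilb_module_axioms.intro M.closed_submodule_hilbert_module K)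
  obtain D where D: "countable D" "D \<subseteq> K" "\<forall>x\<in>K. \<forall>e>0. \<exists>d\<in>D. hnorm M (x \<ominus>\<^bsub>M\<^esub> d) < e"
    using M.separable_subset[OF sepM KM] by (auto simp: separable_mod_def)
  have "\<exists>y\<in>lincombs (A_alg \<Omega>) ?N D. y \<in> carrier ?N \<and> hnorm ?N (x \<ominus>\<^bsub>?N\<^esub> y) < e" if xe: "x \<in> K" "e > 0" for x e
  proof -
    obtain y where y: "y \<in> D" "hnorm M (x \<ominus>\<^bsub>M\<^esub> y) < e" using D(3) xe by blast
    have "D \<subseteq> carrier ?N" using D by simp
    then have "y \<in> lincombs (A_alg \<Omega>) ?N D" using y(1) by (rule N.mod.lincombs_gen)
    moreover have "y \<in> K" using y D by auto
    ultimately show ?thesis using y by (auto simp: M.restrict_minus[OF sub] restrict_hnorm intro!: bexI[of _ y])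
  qed
  then have gen: "generating \<Omega> ?N D"
    using D(2) unfolding generating_def N.H.closure_of_eq by auto
  have "separated \<Omega> ?N" unfolding separated_def
  proof (intro ballI impI)
    fix x assume x: "x \<in> carrier ?N" and 0: "\<forall>z\<in>\<Omega>. \<forall>\<Lambda> B. functional_at \<Omega> ?N z \<Lambda> B \<longrightarrow> \<Lambda> x = 0"
    have "functional_at \<Omega> ?N z \<Lambda> B" if "functional_at \<Omega> M z \<Lambda> B" for z \<Lambda> B
      using that KM by (auto simp: functional_at_def restrict_hnorm subset_iff)
    then have "\<forall>z\<in>\<Omega>. \<forall>\<Lambda> B. functional_at \<Omega> M z \<Lambda> B \<longrightarrow> \<Lambda> x = 0" using 0 by blast
    moreover have "x \<in> carrier M" using x KM by auto
    ultimately have "x = \<zero>\<^bsub>M\<^esub>" using sM unfolding separated_def by blast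
    then show "x = \<zero>\<^bsub>?N\<^esub>" by simp
  qed
  then obtain R' :: "('m, nat \<Rightarrow> complex) hmod" and X where R': "resolving \<Omega> R'" and X: "module_map \<Omega> R' ?N X" 
    and d: "htop ?N closure_of (X ` carrier R') = carrier ?N"
    using cover[OF N.hilbert_module D(1) gen] by blast
  have "module_map \<Omega> R' M X" using X KM by (auto simp: module_map_def bounded_hom_def restrict_hnorm)
  moreover have "X ` carrier R' \<subseteq> K" using X by (auto simp: module_map_def bounded_hom_def)
  then have "htop M closure_of (X ` carrier R') = K" using M.restrict_closure[OF K] d by simp
  ultimately show ?thesis using R' by blast
qed

theorem weak_resolution_exists:
  fixes M :: "('m, 'c) hmod"
  assumes M: "hilbert_module \<Omega> M" "countable S" "generating \<Omega> M S" and sm: "smooth_rel \<Omega> M R g"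
  shows "has_weak_resolution \<Omega> M"
proof -
  obtain R1 :: "('m, nat \<Rightarrow> complex) hmod" and X0 where R1: "resolving \<Omega> R1" "module_map \<Omega> R1 M X0" 
    "htop M closure_of (X0 ` carrier R1) = carrier M"
    using cover[OF M] sm by blast
  \<comment> \<open>the state is a module together with its submodule still to be covered, the kernel of the map to its predecessor\<close>
  define P :: "nat \<Rightarrow> ('m, nat \<Rightarrow> complex) hmod \<times> (nat \<Rightarrow> complex) set \<Rightarrow> bool" where
    "P n p \<longleftrightarrow> resolving \<Omega> (fst p) \<and> closed_submodule \<Omega> (fst p) (snd p) \<and> 
      (n = 0 \<longrightarrow> p = (R1, a_kernel R1 M X0))" for n p
  define Q where "Q p q \<longleftrightarrow> (\<exists>X. module_map \<Omega> (fst q) (fst p) X \<and> 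
      htop (fst p) closure_of (X ` carrier (fst q)) = snd p \<and> snd q = a_kernel (fst q) (fst p) X)" 
    for p q :: "('m, nat \<Rightarrow> complex) hmod \<times> (nat \<Rightarrow> complex) set"
  have "\<exists>F. \<forall>n. P n (F n) \<and> Q (F n) (F (Suc n))"
  proof (rule dependent_nat_choice)
    show "\<exists>p. P 0 p" 
      using R1 kernel_closed_submodule[OF _ M(1) R1(2)] by (auto simp: P_def resolving_def)
    fix p n assume p: "P n p"
    obtain R' :: "('m, nat \<Rightarrow> complex) hmod" and X where R': "resolving \<Omega> R'" "module_map \<Omega> R' (fst p) X" 
      "htop (fst p) closure_of (X ` carrier R') = snd p"
      using p cover_submodule[of "fst p" "snd p"] unfolding P_def by blast
    have "closed_submodule \<Omega> R' (a_kernel R' (fst p) X)"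
      using R' p by (intro kernel_closed_submodule) (auto simp: P_def resolving_def)
    then show "\<exists>q. P (Suc n) q \<and> Q p q"
      using R' by (intro exI[of _ "(R', a_kernel R' (fst p) X)"]) (auto simp: P_def Q_def)
  qed
  then obtain F where F: "\<And>n. P n (F n)" "\<And>n. Q (F n) (F (Suc n))" by blast
  then obtain Y where Y: "\<And>n. module_map \<Omega> (fst (F (Suc n))) (fst (F n)) (Y n)"
    "\<And>n. htop (fst (F n)) closure_of (Y n ` carrier (fst (F (Suc n)))) = snd (F n)"
    "\<And>n. snd (F (Suc n)) = a_kernel (fst (F (Suc n))) (fst (F n)) (Y n)"
    unfolding Q_def by metis
  define R' where "R' i = fst (F (i - 1))" for i
  define X where "X i = Y (i - 1)" for i
  have F0: "F 0 = (R1, a_kernel R1 M X0)" using F(1)[of 0] by (simp add: P_def)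
  have idx: "\<exists>n. i = Suc n" if "i \<ge> 1" for i :: nat using that by (cases i) auto
  have "weak_resolution \<Omega> M \<infinity> R' X0 X"
    unfolding weak_resolution_def
  proof (intro conjI allI impI)
    show "quasi_free \<Omega> (R' i)" for i using F(1)[of "i - 1"] by (simp add: P_def resolving_def R'_def)
    show "module_map \<Omega> (R' 1) M X0" "htop M closure_of (X0 ` carrier (R' 1)) = carrier M"
      using R1 by (simp_all add: R'_def F0)
    show "module_map \<Omega> (R' (i + 1)) (R' i) (X i)" if "1 \<le> i" for i
      using idx[OF that] Y(1) by (auto simp: R'_def X_def)
    show "a_kernel (R' 1) M X0 = htop (R' 1) closure_of (X 1 ` carrier (R' 2))"
      using Y(2)[of 0] by (simp add: R'_def X_def F0)
    show "a_kernel (R' (i + 1)) (R' i) (X i) = htop (R' (i + 1)) closure_of (X (i + 1) ` carrier (R' (i + 2)))"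
      if "1 \<le> i" for i
      using idx[OF that] Y(2,3) by (auto simp: R'_def X_def)
  qed auto
  then show ?thesis unfolding has_weak_resolution_def by blast
qed

end

theorem theorem2:
  fixes \<Omega> :: "(complex ^ 'm) set" and M :: "('m, 'a) hmod"
  assumes "bounded \<Omega>" "open \<Omega>" "connected \<Omega>" "\<Omega> \<noteq> {}"
    and "hilbert_module \<Omega> M" "countably_generated \<Omega> M" "class_SM TYPE('b) \<Omega> M"
  shows "has_weak_resolution \<Omega> M"
proof -
  have bd: "bounded_domain \<Omega>" using assms by (intro bounded_domain.intro)
  obtain R :: "('m, 'b) hmod" and g where R: "quasi_free_rel \<Omega> R 1 (\<lambda>_. g)" "smooth_rel \<Omega> M R g"
    using assms(7) unfolding class_SM_def by blast
  obtain S where S: "countable S" "generating \<Omega> M S" using assms(6) unfolding countably_generated_def by blast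
  obtain \<gamma> where "rank_one \<Omega> R g \<gamma>" using rank_one_functionals[OF bd R(1)] by blast
  then interpret rank_one \<Omega> R g \<gamma> .
  show ?thesis by (rule weak_resolution_exists[OF assms(5) S R(2)])
qed

end
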